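(* Assume the univalence axiom for a universe $\mathsf{Type}$ and propositional truncation. Let $C := (\mathbb{N}\to\mathbf{2})$ and $X := B\mathsf{Aut}(C) := \sum_{Z:\mathsf{Type}} \|Z = C\|$. Then there exist a function $f : X\to X$ and a witness $I : \prod_{x:X} (f(f(x)) = f(x))$ (so $(f,I)$ is a pre-idempotent) such that $f$ has no splitting. That is, it is not the case that there exist a type $A:\mathsf{Type}$, functions $r : X\to A$ and $s : A \to X$, and homotopies $H : \prod_{a:A} (r(s(a)) = a)$ and $K : \prod_{x:X} (s(r(x)) = f(x))$.
   Context: We work in intensional Martin-Löf type theory with $\Sigma$, $\Pi$, identity types (written $=$), coproducts $+$, the natural numbers $\mathbb{N}$, the two-element type $\mathbf{2}$, and a universe $\mathsf{Type}$. Propositional truncation assigns to each type $A$ a mere proposition $\|A\|$, with a map $|{-}| : A \to \|A\|$, such that every function from $A$ into a mere proposition factors through $\|A\|$. A mere proposition is a type $P$ with $\prod_{x,y:P}(x=y)$. A pre-idempotent on $X$ is a pair $(f,I)$ with $f:X\to X$ and $I:\prod_{x:X}(f(f(x))=f(x))$. *)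

theory Defs
  imports Main
begin

text \<open>
  The object theory is formalised as raw syntax in de Bruijn style together with mutually inductive
  judgements: well-formed context, typing, and \<^emph>\<open>typed\<close> judgmental equality. The presentation follows
  the appendix of the Homotopy Type Theory book: a cumulative hierarchy of Russell universes, judgmental
  \<open>\<eta>\<close> for \<open>\<Pi>\<close> only, and \<open>\<Sigma>\<close> with its dependent eliminator. A theorem of the type theory is a type
  for which some term is derivable.

  Binders: \<open>Pi A B\<close>, \<open>Sig A B\<close> and \<open>Lam A b\<close> bind index 0 in the second argument. In \<open>Split C g p\<close>
  the motive \<open>C\<close> binds one variable and \<open>g\<close> two (index 1 is the first component, index 0 the second).
  In \<open>CaseSum C c d e\<close> the first three arguments bind one variable each. In \<open>Absurd C e\<close> and
  \<open>IndTwo C c d e\<close> only \<open>C\<close> binds, one variable. In \<open>IndNat C z s n\<close>, \<open>C\<close> binds one variable and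
  \<open>s\<close> two (index 1 is the predecessor, index 0 the induction hypothesis). In \<open>J C c a b p\<close>, \<open>C\<close> binds
  three variables (index 2 and 1 are the end points, index 0 the path) and \<open>c\<close> one.
\<close>

datatype tm =
    Var nat
  | Univ nat
  | Pi tm tm | Lam tm tm | App tm tm
  | Sig tm tm | Dpair tm tm | Split tm tm tm
  | Plus tm tm | Inj1 tm | Inj2 tm | CaseSum tm tm tm tm
  | Empty | Absurd tm tm
  | Two | Two0 | Two1 | IndTwo tm tm tm tm
  | NatT | Zero | Succ tm | IndNat tm tm tm tm
  | Eq tm tm tm | Refl tm | J tm tm tm tm tm
  | Trunc tm | Tr tm | TrPath tm tm | TrRec tm tm tm tm

definition upr :: "(nat \<Rightarrow> nat) \<Rightarrow> nat \<Rightarrow> nat" where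
  "upr \<rho> = case_nat 0 (\<lambda>n. Suc (\<rho> n))"

primrec ren :: "(nat \<Rightarrow> nat) \<Rightarrow> tm \<Rightarrow> tm" where
  "ren \<rho> (Var n) = Var (\<rho> n)"
| "ren \<rho> (Univ i) = Univ i"
| "ren \<rho> (Pi A B) = Pi (ren \<rho> A) (ren (upr \<rho>) B)"
| "ren \<rho> (Lam A b) = Lam (ren \<rho> A) (ren (upr \<rho>) b)"
| "ren \<rho> (App f a) = App (ren \<rho> f) (ren \<rho> a)"
| "ren \<rho> (Sig A B) = Sig (ren \<rho> A) (ren (upr \<rho>) B)"
| "ren \<rho> (Dpair a b) = Dpair (ren \<rho> a) (ren \<rho> b)"
| "ren \<rho> (Split C g p) = Split (ren (upr \<rho>) C) (ren (upr (upr \<rho>)) g) (ren \<rho> p)"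
| "ren \<rho> (Plus A B) = Plus (ren \<rho> A) (ren \<rho> B)"
| "ren \<rho> (Inj1 a) = Inj1 (ren \<rho> a)"
| "ren \<rho> (Inj2 b) = Inj2 (ren \<rho> b)"
| "ren \<rho> (CaseSum C c d e) =
     CaseSum (ren (upr \<rho>) C) (ren (upr \<rho>) c) (ren (upr \<rho>) d) (ren \<rho> e)"
| "ren \<rho> Empty = Empty"
| "ren \<rho> (Absurd C e) = Absurd (ren (upr \<rho>) C) (ren \<rho> e)"
| "ren \<rho> Two = Two"
| "ren \<rho> Two0 = Two0"
| "ren \<rho> Two1 = Two1"
| "ren \<rho> (IndTwo C c d e) = IndTwo (ren (upr \<rho>) C) (ren \<rho> c) (ren \<rho> d) (ren \<rho> e)"
| "ren \<rho> NatT = NatT"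
| "ren \<rho> Zero = Zero"
| "ren \<rho> (Succ n) = Succ (ren \<rho> n)"
| "ren \<rho> (IndNat C z s n) =
     IndNat (ren (upr \<rho>) C) (ren \<rho> z) (ren (upr (upr \<rho>)) s) (ren \<rho> n)"
| "ren \<rho> (Eq A a b) = Eq (ren \<rho> A) (ren \<rho> a) (ren \<rho> b)"
| "ren \<rho> (Refl a) = Refl (ren \<rho> a)"
| "ren \<rho> (J C c a b p) =
     J (ren (upr (upr (upr \<rho>))) C) (ren (upr \<rho>) c) (ren \<rho> a) (ren \<rho> b) (ren \<rho> p)"
| "ren \<rho> (Trunc A) = Trunc (ren \<rho> A)"
| "ren \<rho> (Tr a) = Tr (ren \<rho> a)"
| "ren \<rho> (TrPath a b) = TrPath (ren \<rho> a) (ren \<rho> b)"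
| "ren \<rho> (TrRec P h g a) = TrRec (ren \<rho> P) (ren \<rho> h) (ren \<rho> g) (ren \<rho> a)"

abbreviation wk :: "tm \<Rightarrow> tm" where
  "wk \<equiv> ren Suc"

definition up :: "(nat \<Rightarrow> tm) \<Rightarrow> nat \<Rightarrow> tm" where
  "up \<sigma> = case_nat (Var 0) (\<lambda>n. wk (\<sigma> n))"

primrec sub :: "(nat \<Rightarrow> tm) \<Rightarrow> tm \<Rightarrow> tm" where
  "sub \<sigma> (Var n) = \<sigma> n"
| "sub \<sigma> (Univ i) = Univ i"
| "sub \<sigma> (Pi A B) = Pi (sub \<sigma> A) (sub (up \<sigma>) B)"
| "sub \<sigma> (Lam A b) = Lam (sub \<sigma> A) (sub (up \<sigma>) b)"
| "sub \<sigma> (App f a) = App (sub \<sigma> f) (sub \<sigma> a)"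
| "sub \<sigma> (Sig A B) = Sig (sub \<sigma> A) (sub (up \<sigma>) B)"
| "sub \<sigma> (Dpair a b) = Dpair (sub \<sigma> a) (sub \<sigma> b)"
| "sub \<sigma> (Split C g p) = Split (sub (up \<sigma>) C) (sub (up (up \<sigma>)) g) (sub \<sigma> p)"
| "sub \<sigma> (Plus A B) = Plus (sub \<sigma> A) (sub \<sigma> B)"
| "sub \<sigma> (Inj1 a) = Inj1 (sub \<sigma> a)"
| "sub \<sigma> (Inj2 b) = Inj2 (sub \<sigma> b)"
| "sub \<sigma> (CaseSum C c d e) =
     CaseSum (sub (up \<sigma>) C) (sub (up \<sigma>) c) (sub (up \<sigma>) d) (sub \<sigma> e)"
| "sub \<sigma> Empty = Empty"
| "sub \<sigma> (Absurd C e) = Absurd (sub (up \<sigma>) C) (sub \<sigma> e)"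
| "sub \<sigma> Two = Two"
| "sub \<sigma> Two0 = Two0"
| "sub \<sigma> Two1 = Two1"
| "sub \<sigma> (IndTwo C c d e) = IndTwo (sub (up \<sigma>) C) (sub \<sigma> c) (sub \<sigma> d) (sub \<sigma> e)"
| "sub \<sigma> NatT = NatT"
| "sub \<sigma> Zero = Zero"
| "sub \<sigma> (Succ n) = Succ (sub \<sigma> n)"
| "sub \<sigma> (IndNat C z s n) =
     IndNat (sub (up \<sigma>) C) (sub \<sigma> z) (sub (up (up \<sigma>)) s) (sub \<sigma> n)"
| "sub \<sigma> (Eq A a b) = Eq (sub \<sigma> A) (sub \<sigma> a) (sub \<sigma> b)"
| "sub \<sigma> (Refl a) = Refl (sub \<sigma> a)"
| "sub \<sigma> (J C c a b p) =
     J (sub (up (up (up \<sigma>))) C) (sub (up \<sigma>) c) (sub \<sigma> a) (sub \<sigma> b) (sub \<sigma> p)"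
| "sub \<sigma> (Trunc A) = Trunc (sub \<sigma> A)"
| "sub \<sigma> (Tr a) = Tr (sub \<sigma> a)"
| "sub \<sigma> (TrPath a b) = TrPath (sub \<sigma> a) (sub \<sigma> b)"
| "sub \<sigma> (TrRec P h g a) = TrRec (sub \<sigma> P) (sub \<sigma> h) (sub \<sigma> g) (sub \<sigma> a)"

text \<open>
  \<open>inst1 a\<close> replaces index 0; \<open>inst2 a b\<close> and \<open>inst3 a b c\<close> list the replacements from the outermost
  to the innermost variable. \<open>at1 t\<close> (resp. \<open>at2 t\<close>) replaces index 0 by a term \<open>t\<close> living in a
  context in which that variable has been exchanged for one (resp. two) new ones.
\<close>

abbreviation inst1 :: "tm \<Rightarrow> tm \<Rightarrow> tm" where
  "inst1 a \<equiv> sub (case_nat a Var)"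

abbreviation inst2 :: "tm \<Rightarrow> tm \<Rightarrow> tm \<Rightarrow> tm" where
  "inst2 a b \<equiv> sub (case_nat b (case_nat a Var))"

abbreviation inst3 :: "tm \<Rightarrow> tm \<Rightarrow> tm \<Rightarrow> tm \<Rightarrow> tm" where
  "inst3 a b c \<equiv> sub (case_nat c (case_nat b (case_nat a Var)))"

abbreviation at1 :: "tm \<Rightarrow> tm \<Rightarrow> tm" where
  "at1 t \<equiv> sub (case_nat t (\<lambda>n. Var (Suc n)))"

abbreviation at2 :: "tm \<Rightarrow> tm \<Rightarrow> tm" where
  "at2 t \<equiv> sub (case_nat t (\<lambda>n. Var (Suc (Suc n))))"

abbreviation diag :: "tm \<Rightarrow> tm" where
  "diag \<equiv> sub (case_nat (Refl (Var 0)) (case_nat (Var 0) (case_nat (Var 0) (\<lambda>n. Var (Suc n)))))"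

definition arrow :: "tm \<Rightarrow> tm \<Rightarrow> tm" where
  "arrow A B = Pi A (wk B)"

definition prodT :: "tm \<Rightarrow> tm \<Rightarrow> tm" where
  "prodT A B = Sig A (wk B)"

definition neg :: "tm \<Rightarrow> tm" where
  "neg A = arrow A Empty"

definition isProp :: "tm \<Rightarrow> tm" where
  "isProp P = Pi P (Pi (wk P) (Eq (wk (wk P)) (Var 1) (Var 0)))"

text \<open>
  The head of a context is the most recent variable. The computation rule of \<open>TrRec\<close> on \<open>Tr a\<close> is
  not taken as a judgmental equality: it holds propositionally since the target is a mere proposition.
\<close>

inductive
  wf_ctx :: "tm list \<Rightarrow> bool" and
  has_type :: "tm list \<Rightarrow> tm \<Rightarrow> tm \<Rightarrow> bool" ("_ \<turnstile> _ \<Colon> _" [51, 51, 51] 50) and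
  jeq :: "tm list \<Rightarrow> tm \<Rightarrow> tm \<Rightarrow> tm \<Rightarrow> bool" ("_ \<turnstile> _ \<doteq> _ \<Colon> _" [51, 51, 51, 51] 50)
where
  wf_nil: "wf_ctx []"
| wf_cons: "\<Gamma> \<turnstile> A \<Colon> Univ i \<Longrightarrow> wf_ctx (A # \<Gamma>)"

| ty_var: "wf_ctx \<Gamma> \<Longrightarrow> n < length \<Gamma> \<Longrightarrow> \<Gamma> \<turnstile> Var n \<Colon> ren (\<lambda>k. k + Suc n) (\<Gamma> ! n)"
| ty_conv: "\<Gamma> \<turnstile> a \<Colon> A \<Longrightarrow> \<Gamma> \<turnstile> A \<doteq> B \<Colon> Univ i \<Longrightarrow> \<Gamma> \<turnstile> a \<Colon> B"

| eq_refl: "\<Gamma> \<turnstile> a \<Colon> A \<Longrightarrow> \<Gamma> \<turnstile> a \<doteq> a \<Colon> A"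
| eq_sym: "\<Gamma> \<turnstile> a \<doteq> b \<Colon> A \<Longrightarrow> \<Gamma> \<turnstile> b \<doteq> a \<Colon> A"
| eq_trans: "\<Gamma> \<turnstile> a \<doteq> b \<Colon> A \<Longrightarrow> \<Gamma> \<turnstile> b \<doteq> c \<Colon> A \<Longrightarrow> \<Gamma> \<turnstile> a \<doteq> c \<Colon> A"
| eq_conv: "\<Gamma> \<turnstile> a \<doteq> b \<Colon> A \<Longrightarrow> \<Gamma> \<turnstile> A \<doteq> B \<Colon> Univ i \<Longrightarrow> \<Gamma> \<turnstile> a \<doteq> b \<Colon> B"

| ty_Univ: "wf_ctx \<Gamma> \<Longrightarrow> \<Gamma> \<turnstile> Univ i \<Colon> Univ (Suc i)"
| ty_cumul: "\<Gamma> \<turnstile> A \<Colon> Univ i \<Longrightarrow> \<Gamma> \<turnstile> A \<Colon> Univ (Suc i)"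
| eq_cumul: "\<Gamma> \<turnstile> A \<doteq> B \<Colon> Univ i \<Longrightarrow> \<Gamma> \<turnstile> A \<doteq> B \<Colon> Univ (Suc i)"

| ty_Pi: "\<Gamma> \<turnstile> A \<Colon> Univ i \<Longrightarrow> A # \<Gamma> \<turnstile> B \<Colon> Univ i \<Longrightarrow> \<Gamma> \<turnstile> Pi A B \<Colon> Univ i"
| eq_Pi: "\<Gamma> \<turnstile> A \<doteq> A' \<Colon> Univ i \<Longrightarrow> A # \<Gamma> \<turnstile> B \<doteq> B' \<Colon> Univ i \<Longrightarrow> \<Gamma> \<turnstile> Pi A B \<doteq> Pi A' B' \<Colon> Univ i"
| ty_Lam: "\<Gamma> \<turnstile> A \<Colon> Univ i \<Longrightarrow> A # \<Gamma> \<turnstile> b \<Colon> B \<Longrightarrow> \<Gamma> \<turnstile> Lam A b \<Colon> Pi A B"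
| eq_Lam: "\<Gamma> \<turnstile> A \<doteq> A' \<Colon> Univ i \<Longrightarrow> A # \<Gamma> \<turnstile> b \<doteq> b' \<Colon> B \<Longrightarrow> \<Gamma> \<turnstile> Lam A b \<doteq> Lam A' b' \<Colon> Pi A B"
| ty_App: "\<Gamma> \<turnstile> f \<Colon> Pi A B \<Longrightarrow> \<Gamma> \<turnstile> a \<Colon> A \<Longrightarrow> \<Gamma> \<turnstile> App f a \<Colon> inst1 a B"
| eq_App: "\<Gamma> \<turnstile> f \<doteq> f' \<Colon> Pi A B \<Longrightarrow> \<Gamma> \<turnstile> a \<doteq> a' \<Colon> A \<Longrightarrow> \<Gamma> \<turnstile> App f a \<doteq> App f' a' \<Colon> inst1 a B"
| beta: "A # \<Gamma> \<turnstile> b \<Colon> B \<Longrightarrow> \<Gamma> \<turnstile> a \<Colon> A \<Longrightarrow> \<Gamma> \<turnstile> App (Lam A b) a \<doteq> inst1 a b \<Colon> inst1 a B"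
| eta: "\<Gamma> \<turnstile> f \<Colon> Pi A B \<Longrightarrow> \<Gamma> \<turnstile> f \<doteq> Lam A (App (wk f) (Var 0)) \<Colon> Pi A B"

| ty_Sig: "\<Gamma> \<turnstile> A \<Colon> Univ i \<Longrightarrow> A # \<Gamma> \<turnstile> B \<Colon> Univ i \<Longrightarrow> \<Gamma> \<turnstile> Sig A B \<Colon> Univ i"
| eq_Sig: "\<Gamma> \<turnstile> A \<doteq> A' \<Colon> Univ i \<Longrightarrow> A # \<Gamma> \<turnstile> B \<doteq> B' \<Colon> Univ i \<Longrightarrow> \<Gamma> \<turnstile> Sig A B \<doteq> Sig A' B' \<Colon> Univ i"
| ty_Dpair: "A # \<Gamma> \<turnstile> B \<Colon> Univ i \<Longrightarrow> \<Gamma> \<turnstile> a \<Colon> A \<Longrightarrow> \<Gamma> \<turnstile> b \<Colon> inst1 a B \<Longrightarrow> \<Gamma> \<turnstile> Dpair a b \<Colon> Sig A B"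
| eq_Dpair: "A # \<Gamma> \<turnstile> B \<Colon> Univ i \<Longrightarrow> \<Gamma> \<turnstile> a \<doteq> a' \<Colon> A \<Longrightarrow> \<Gamma> \<turnstile> b \<doteq> b' \<Colon> inst1 a B \<Longrightarrow>
    \<Gamma> \<turnstile> Dpair a b \<doteq> Dpair a' b' \<Colon> Sig A B"
| ty_Split: "Sig A B # \<Gamma> \<turnstile> C \<Colon> Univ i \<Longrightarrow> B # A # \<Gamma> \<turnstile> g \<Colon> at2 (Dpair (Var 1) (Var 0)) C \<Longrightarrow>
    \<Gamma> \<turnstile> p \<Colon> Sig A B \<Longrightarrow> \<Gamma> \<turnstile> Split C g p \<Colon> inst1 p C"
| eq_Split: "Sig A B # \<Gamma> \<turnstile> C \<doteq> C' \<Colon> Univ i \<Longrightarrow>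
    B # A # \<Gamma> \<turnstile> g \<doteq> g' \<Colon> at2 (Dpair (Var 1) (Var 0)) C \<Longrightarrow>
    \<Gamma> \<turnstile> p \<doteq> p' \<Colon> Sig A B \<Longrightarrow> \<Gamma> \<turnstile> Split C g p \<doteq> Split C' g' p' \<Colon> inst1 p C"
| Split_Dpair: "Sig A B # \<Gamma> \<turnstile> C \<Colon> Univ i \<Longrightarrow> B # A # \<Gamma> \<turnstile> g \<Colon> at2 (Dpair (Var 1) (Var 0)) C \<Longrightarrow>
    \<Gamma> \<turnstile> a \<Colon> A \<Longrightarrow> \<Gamma> \<turnstile> b \<Colon> inst1 a B \<Longrightarrow>
    \<Gamma> \<turnstile> Split C g (Dpair a b) \<doteq> inst2 a b g \<Colon> inst1 (Dpair a b) C"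

| ty_Plus: "\<Gamma> \<turnstile> A \<Colon> Univ i \<Longrightarrow> \<Gamma> \<turnstile> B \<Colon> Univ i \<Longrightarrow> \<Gamma> \<turnstile> Plus A B \<Colon> Univ i"
| eq_Plus: "\<Gamma> \<turnstile> A \<doteq> A' \<Colon> Univ i \<Longrightarrow> \<Gamma> \<turnstile> B \<doteq> B' \<Colon> Univ i \<Longrightarrow> \<Gamma> \<turnstile> Plus A B \<doteq> Plus A' B' \<Colon> Univ i"
| ty_Inj1: "\<Gamma> \<turnstile> B \<Colon> Univ i \<Longrightarrow> \<Gamma> \<turnstile> a \<Colon> A \<Longrightarrow> \<Gamma> \<turnstile> Inj1 a \<Colon> Plus A B"
| eq_Inj1: "\<Gamma> \<turnstile> B \<Colon> Univ i \<Longrightarrow> \<Gamma> \<turnstile> a \<doteq> a' \<Colon> A \<Longrightarrow> \<Gamma> \<turnstile> Inj1 a \<doteq> Inj1 a' \<Colon> Plus A B"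
| ty_Inj2: "\<Gamma> \<turnstile> A \<Colon> Univ i \<Longrightarrow> \<Gamma> \<turnstile> b \<Colon> B \<Longrightarrow> \<Gamma> \<turnstile> Inj2 b \<Colon> Plus A B"
| eq_Inj2: "\<Gamma> \<turnstile> A \<Colon> Univ i \<Longrightarrow> \<Gamma> \<turnstile> b \<doteq> b' \<Colon> B \<Longrightarrow> \<Gamma> \<turnstile> Inj2 b \<doteq> Inj2 b' \<Colon> Plus A B"
| ty_CaseSum: "Plus A B # \<Gamma> \<turnstile> C \<Colon> Univ i \<Longrightarrow> A # \<Gamma> \<turnstile> c \<Colon> at1 (Inj1 (Var 0)) C \<Longrightarrow>
    B # \<Gamma> \<turnstile> d \<Colon> at1 (Inj2 (Var 0)) C \<Longrightarrow> \<Gamma> \<turnstile> e \<Colon> Plus A B \<Longrightarrow> \<Gamma> \<turnstile> CaseSum C c d e \<Colon> inst1 e C"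
| eq_CaseSum: "Plus A B # \<Gamma> \<turnstile> C \<doteq> C' \<Colon> Univ i \<Longrightarrow> A # \<Gamma> \<turnstile> c \<doteq> c' \<Colon> at1 (Inj1 (Var 0)) C \<Longrightarrow>
    B # \<Gamma> \<turnstile> d \<doteq> d' \<Colon> at1 (Inj2 (Var 0)) C \<Longrightarrow> \<Gamma> \<turnstile> e \<doteq> e' \<Colon> Plus A B \<Longrightarrow>
    \<Gamma> \<turnstile> CaseSum C c d e \<doteq> CaseSum C' c' d' e' \<Colon> inst1 e C"
| CaseSum_Inj1: "Plus A B # \<Gamma> \<turnstile> C \<Colon> Univ i \<Longrightarrow> A # \<Gamma> \<turnstile> c \<Colon> at1 (Inj1 (Var 0)) C \<Longrightarrow>
    B # \<Gamma> \<turnstile> d \<Colon> at1 (Inj2 (Var 0)) C \<Longrightarrow> \<Gamma> \<turnstile> a \<Colon> A \<Longrightarrow>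
    \<Gamma> \<turnstile> CaseSum C c d (Inj1 a) \<doteq> inst1 a c \<Colon> inst1 (Inj1 a) C"
| CaseSum_Inj2: "Plus A B # \<Gamma> \<turnstile> C \<Colon> Univ i \<Longrightarrow> A # \<Gamma> \<turnstile> c \<Colon> at1 (Inj1 (Var 0)) C \<Longrightarrow>
    B # \<Gamma> \<turnstile> d \<Colon> at1 (Inj2 (Var 0)) C \<Longrightarrow> \<Gamma> \<turnstile> b \<Colon> B \<Longrightarrow>
    \<Gamma> \<turnstile> CaseSum C c d (Inj2 b) \<doteq> inst1 b d \<Colon> inst1 (Inj2 b) C"

| ty_Empty: "wf_ctx \<Gamma> \<Longrightarrow> \<Gamma> \<turnstile> Empty \<Colon> Univ i"
| ty_Absurd: "Empty # \<Gamma> \<turnstile> C \<Colon> Univ i \<Longrightarrow> \<Gamma> \<turnstile> e \<Colon> Empty \<Longrightarrow> \<Gamma> \<turnstile> Absurd C e \<Colon> inst1 e C"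
| eq_Absurd: "Empty # \<Gamma> \<turnstile> C \<doteq> C' \<Colon> Univ i \<Longrightarrow> \<Gamma> \<turnstile> e \<doteq> e' \<Colon> Empty \<Longrightarrow>
    \<Gamma> \<turnstile> Absurd C e \<doteq> Absurd C' e' \<Colon> inst1 e C"

| ty_Two: "wf_ctx \<Gamma> \<Longrightarrow> \<Gamma> \<turnstile> Two \<Colon> Univ i"
| ty_Two0: "wf_ctx \<Gamma> \<Longrightarrow> \<Gamma> \<turnstile> Two0 \<Colon> Two"
| ty_Two1: "wf_ctx \<Gamma> \<Longrightarrow> \<Gamma> \<turnstile> Two1 \<Colon> Two"
| ty_IndTwo: "Two # \<Gamma> \<turnstile> C \<Colon> Univ i \<Longrightarrow> \<Gamma> \<turnstile> c \<Colon> inst1 Two0 C \<Longrightarrow> \<Gamma> \<turnstile> d \<Colon> inst1 Two1 C \<Longrightarrow>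
    \<Gamma> \<turnstile> e \<Colon> Two \<Longrightarrow> \<Gamma> \<turnstile> IndTwo C c d e \<Colon> inst1 e C"
| eq_IndTwo: "Two # \<Gamma> \<turnstile> C \<doteq> C' \<Colon> Univ i \<Longrightarrow> \<Gamma> \<turnstile> c \<doteq> c' \<Colon> inst1 Two0 C \<Longrightarrow>
    \<Gamma> \<turnstile> d \<doteq> d' \<Colon> inst1 Two1 C \<Longrightarrow> \<Gamma> \<turnstile> e \<doteq> e' \<Colon> Two \<Longrightarrow>
    \<Gamma> \<turnstile> IndTwo C c d e \<doteq> IndTwo C' c' d' e' \<Colon> inst1 e C"
| IndTwo_Two0: "Two # \<Gamma> \<turnstile> C \<Colon> Univ i \<Longrightarrow> \<Gamma> \<turnstile> c \<Colon> inst1 Two0 C \<Longrightarrow> \<Gamma> \<turnstile> d \<Colon> inst1 Two1 C \<Longrightarrow>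
    \<Gamma> \<turnstile> IndTwo C c d Two0 \<doteq> c \<Colon> inst1 Two0 C"
| IndTwo_Two1: "Two # \<Gamma> \<turnstile> C \<Colon> Univ i \<Longrightarrow> \<Gamma> \<turnstile> c \<Colon> inst1 Two0 C \<Longrightarrow> \<Gamma> \<turnstile> d \<Colon> inst1 Two1 C \<Longrightarrow>
    \<Gamma> \<turnstile> IndTwo C c d Two1 \<doteq> d \<Colon> inst1 Two1 C"

| ty_NatT: "wf_ctx \<Gamma> \<Longrightarrow> \<Gamma> \<turnstile> NatT \<Colon> Univ i"
| ty_Zero: "wf_ctx \<Gamma> \<Longrightarrow> \<Gamma> \<turnstile> Zero \<Colon> NatT"
| ty_Succ: "\<Gamma> \<turnstile> n \<Colon> NatT \<Longrightarrow> \<Gamma> \<turnstile> Succ n \<Colon> NatT"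
| eq_Succ: "\<Gamma> \<turnstile> n \<doteq> n' \<Colon> NatT \<Longrightarrow> \<Gamma> \<turnstile> Succ n \<doteq> Succ n' \<Colon> NatT"
| ty_IndNat: "NatT # \<Gamma> \<turnstile> C \<Colon> Univ i \<Longrightarrow> \<Gamma> \<turnstile> z \<Colon> inst1 Zero C \<Longrightarrow>
    C # NatT # \<Gamma> \<turnstile> s \<Colon> at2 (Succ (Var 1)) C \<Longrightarrow> \<Gamma> \<turnstile> n \<Colon> NatT \<Longrightarrow> \<Gamma> \<turnstile> IndNat C z s n \<Colon> inst1 n C"
| eq_IndNat: "NatT # \<Gamma> \<turnstile> C \<doteq> C' \<Colon> Univ i \<Longrightarrow> \<Gamma> \<turnstile> z \<doteq> z' \<Colon> inst1 Zero C \<Longrightarrow>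
    C # NatT # \<Gamma> \<turnstile> s \<doteq> s' \<Colon> at2 (Succ (Var 1)) C \<Longrightarrow> \<Gamma> \<turnstile> n \<doteq> n' \<Colon> NatT \<Longrightarrow>
    \<Gamma> \<turnstile> IndNat C z s n \<doteq> IndNat C' z' s' n' \<Colon> inst1 n C"
| IndNat_Zero: "NatT # \<Gamma> \<turnstile> C \<Colon> Univ i \<Longrightarrow> \<Gamma> \<turnstile> z \<Colon> inst1 Zero C \<Longrightarrow>
    C # NatT # \<Gamma> \<turnstile> s \<Colon> at2 (Succ (Var 1)) C \<Longrightarrow>
    \<Gamma> \<turnstile> IndNat C z s Zero \<doteq> z \<Colon> inst1 Zero C"
| IndNat_Succ: "NatT # \<Gamma> \<turnstile> C \<Colon> Univ i \<Longrightarrow> \<Gamma> \<turnstile> z \<Colon> inst1 Zero C \<Longrightarrow>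
    C # NatT # \<Gamma> \<turnstile> s \<Colon> at2 (Succ (Var 1)) C \<Longrightarrow> \<Gamma> \<turnstile> n \<Colon> NatT \<Longrightarrow>
    \<Gamma> \<turnstile> IndNat C z s (Succ n) \<doteq> inst2 n (IndNat C z s n) s \<Colon> inst1 (Succ n) C"

| ty_Eq: "\<Gamma> \<turnstile> A \<Colon> Univ i \<Longrightarrow> \<Gamma> \<turnstile> a \<Colon> A \<Longrightarrow> \<Gamma> \<turnstile> b \<Colon> A \<Longrightarrow> \<Gamma> \<turnstile> Eq A a b \<Colon> Univ i"
| eq_Eq: "\<Gamma> \<turnstile> A \<doteq> A' \<Colon> Univ i \<Longrightarrow> \<Gamma> \<turnstile> a \<doteq> a' \<Colon> A \<Longrightarrow> \<Gamma> \<turnstile> b \<doteq> b' \<Colon> A \<Longrightarrow>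
    \<Gamma> \<turnstile> Eq A a b \<doteq> Eq A' a' b' \<Colon> Univ i"
| ty_Refl: "\<Gamma> \<turnstile> a \<Colon> A \<Longrightarrow> \<Gamma> \<turnstile> Refl a \<Colon> Eq A a a"
| eq_Refl: "\<Gamma> \<turnstile> a \<doteq> a' \<Colon> A \<Longrightarrow> \<Gamma> \<turnstile> Refl a \<doteq> Refl a' \<Colon> Eq A a a"
| ty_J: "Eq (wk (wk A)) (Var 1) (Var 0) # wk A # A # \<Gamma> \<turnstile> C \<Colon> Univ i \<Longrightarrow> A # \<Gamma> \<turnstile> c \<Colon> diag C \<Longrightarrow>
    \<Gamma> \<turnstile> a \<Colon> A \<Longrightarrow> \<Gamma> \<turnstile> b \<Colon> A \<Longrightarrow> \<Gamma> \<turnstile> p \<Colon> Eq A a b \<Longrightarrow> \<Gamma> \<turnstile> J C c a b p \<Colon> inst3 a b p C"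
| eq_J: "Eq (wk (wk A)) (Var 1) (Var 0) # wk A # A # \<Gamma> \<turnstile> C \<doteq> C' \<Colon> Univ i \<Longrightarrow>
    A # \<Gamma> \<turnstile> c \<doteq> c' \<Colon> diag C \<Longrightarrow>
    \<Gamma> \<turnstile> a \<doteq> a' \<Colon> A \<Longrightarrow> \<Gamma> \<turnstile> b \<doteq> b' \<Colon> A \<Longrightarrow> \<Gamma> \<turnstile> p \<doteq> p' \<Colon> Eq A a b \<Longrightarrow>
    \<Gamma> \<turnstile> J C c a b p \<doteq> J C' c' a' b' p' \<Colon> inst3 a b p C"
| J_Refl: "Eq (wk (wk A)) (Var 1) (Var 0) # wk A # A # \<Gamma> \<turnstile> C \<Colon> Univ i \<Longrightarrow> A # \<Gamma> \<turnstile> c \<Colon> diag C \<Longrightarrow>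
    \<Gamma> \<turnstile> a \<Colon> A \<Longrightarrow> \<Gamma> \<turnstile> J C c a a (Refl a) \<doteq> inst1 a c \<Colon> inst3 a a (Refl a) C"

| ty_Trunc: "\<Gamma> \<turnstile> A \<Colon> Univ i \<Longrightarrow> \<Gamma> \<turnstile> Trunc A \<Colon> Univ i"
| eq_Trunc: "\<Gamma> \<turnstile> A \<doteq> A' \<Colon> Univ i \<Longrightarrow> \<Gamma> \<turnstile> Trunc A \<doteq> Trunc A' \<Colon> Univ i"
| ty_Tr: "\<Gamma> \<turnstile> a \<Colon> A \<Longrightarrow> \<Gamma> \<turnstile> Tr a \<Colon> Trunc A"
| eq_Tr: "\<Gamma> \<turnstile> a \<doteq> a' \<Colon> A \<Longrightarrow> \<Gamma> \<turnstile> Tr a \<doteq> Tr a' \<Colon> Trunc A"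
| ty_TrPath: "\<Gamma> \<turnstile> a \<Colon> Trunc A \<Longrightarrow> \<Gamma> \<turnstile> b \<Colon> Trunc A \<Longrightarrow> \<Gamma> \<turnstile> TrPath a b \<Colon> Eq (Trunc A) a b"
| eq_TrPath: "\<Gamma> \<turnstile> a \<doteq> a' \<Colon> Trunc A \<Longrightarrow> \<Gamma> \<turnstile> b \<doteq> b' \<Colon> Trunc A \<Longrightarrow>
    \<Gamma> \<turnstile> TrPath a b \<doteq> TrPath a' b' \<Colon> Eq (Trunc A) a b"
| ty_TrRec: "\<Gamma> \<turnstile> P \<Colon> Univ i \<Longrightarrow> \<Gamma> \<turnstile> h \<Colon> isProp P \<Longrightarrow> \<Gamma> \<turnstile> g \<Colon> arrow A P \<Longrightarrow> \<Gamma> \<turnstile> a \<Colon> Trunc A \<Longrightarrow>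
    \<Gamma> \<turnstile> TrRec P h g a \<Colon> P"
| eq_TrRec: "\<Gamma> \<turnstile> P \<doteq> P' \<Colon> Univ i \<Longrightarrow> \<Gamma> \<turnstile> h \<doteq> h' \<Colon> isProp P \<Longrightarrow> \<Gamma> \<turnstile> g \<doteq> g' \<Colon> arrow A P \<Longrightarrow>
    \<Gamma> \<turnstile> a \<doteq> a' \<Colon> Trunc A \<Longrightarrow> \<Gamma> \<turnstile> TrRec P h g a \<doteq> TrRec P' h' g' a' \<Colon> P"

text \<open>
  Equivalences are bi-invertible maps: \<open>isEquiv A B f\<close> is
  \<open>(\<Sigma> g : B \<rightarrow> A. \<Pi> y : B. f (g y) = y) \<times> (\<Sigma> h : B \<rightarrow> A. \<Pi> x : A. h (f x) = x)\<close>.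
\<close>

definition isEquiv :: "tm \<Rightarrow> tm \<Rightarrow> tm \<Rightarrow> tm" where
  "isEquiv A B f = prodT
     (Sig (arrow B A) (Pi (wk B) (Eq (wk (wk B)) (App (wk (wk f)) (App (Var 1) (Var 0))) (Var 0))))
     (Sig (arrow B A) (Pi (wk A) (Eq (wk (wk A)) (App (Var 1) (App (wk (wk f)) (Var 0))) (Var 0))))"

definition Equiv :: "tm \<Rightarrow> tm \<Rightarrow> tm" where
  "Equiv A B = Sig (arrow A B) (isEquiv (wk A) (wk B) (Var 0))"

definition idfun :: "tm \<Rightarrow> tm" where
  "idfun A = Lam A (Var 0)"

definition idEquiv :: "tm \<Rightarrow> tm" where
  "idEquiv A = Dpair (idfun A)
     (Dpair (Dpair (idfun A) (Lam A (Refl (Var 0)))) (Dpair (idfun A) (Lam A (Refl (Var 0)))))"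

text \<open>The canonical map from \<open>A = B\<close> to \<open>Equiv A B\<close>, by path induction.\<close>

definition idtoeqv :: "nat \<Rightarrow> tm \<Rightarrow> tm \<Rightarrow> tm" where
  "idtoeqv i A B = Lam (Eq (Univ i) A B)
     (J (Equiv (Var 2) (Var 1)) (idEquiv (Var 0)) (wk A) (wk B) (Var 0))"

definition univalence :: "nat \<Rightarrow> tm" where
  "univalence i = Pi (Univ i) (Pi (Univ i)
     (isEquiv (Eq (Univ i) (Var 1) (Var 0)) (Equiv (Var 1) (Var 0)) (idtoeqv i (Var 1) (Var 0))))"

definition Cantor :: tm where
  "Cantor = arrow NatT Two"

definition BAut :: "nat \<Rightarrow> tm \<Rightarrow> tm" where
  "BAut i C = Sig (Univ i) (Trunc (Eq (Univ i) (Var 0) (wk C)))"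

text \<open>\<open>\<Pi> x : X. f (f x) = f x\<close>\<close>

definition preIdem :: "tm \<Rightarrow> tm \<Rightarrow> tm" where
  "preIdem X f = Pi X (Eq (wk X) (App (wk f) (App (wk f) (Var 0))) (App (wk f) (Var 0)))"

text \<open>
  Splittings of \<open>f : X \<rightarrow> X\<close> through a type of the universe \<open>Univ j\<close>:
  \<open>\<Sigma> A : Univ j. \<Sigma> r : X \<rightarrow> A. \<Sigma> s : A \<rightarrow> X. (\<Pi> a : A. r (s a) = a) \<times> (\<Pi> x : X. s (r x) = f x)\<close>.
  Below the three outer binders \<open>A\<close>, \<open>r\<close>, \<open>s\<close> have indices 2, 1, 0.
\<close>

definition splitting :: "nat \<Rightarrow> tm \<Rightarrow> tm \<Rightarrow> tm" where
  "splitting j X f =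
     (let X3 = wk (wk (wk X)); f3 = wk (wk (wk f)) in
      Sig (Univ j)
        (Sig (arrow (wk X) (Var 0))
          (Sig (arrow (Var 1) (wk (wk X)))
            (prodT
              (Pi (Var 2) (Eq (Var 3) (App (Var 2) (App (Var 1) (Var 0))) (Var 0)))
              (Pi X3 (Eq (wk X3) (App (Var 1) (App (Var 2) (Var 0))) (App (wk f3) (Var 0))))))))"

end

theory Submission
  imports Defs "HOL-Library.Monad_Syntax"
begin

text \<open>
  Let \<open>C\<close> be the Cantor space, \<open>X = BAut C\<close> and \<open>f Z = Z + C\<close>. This is a map \<open>X \<rightarrow> X\<close> and a
  pre-idempotent because \<open>C + C = C\<close>, by univalence and function extensionality.

  Suppose that \<open>f\<close> splits as \<open>s \<circ> r\<close> through \<open>A\<close>. Every loop of \<open>A\<close> is the image of a loop of \<open>X\<close>, as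
  \<open>r \<circ> s\<close> is homotopic to the identity, and \<open>ap r\<close> is injective on loops, as \<open>q + id\<close> determines \<open>q\<close>.
  It follows that a loop \<open>q\<close> at \<open>s a\<close>, that is, an automorphism of the underlying type of \<open>s a\<close>, is
  conjugate to \<open>q + id\<close> on \<open>s a + C\<close> by an equivalence independent of \<open>q\<close>. Hence all automorphisms of
  \<open>s a\<close> have a common fixed point, the image of a point of \<open>C\<close>. But \<open>s a\<close> is merely equal to \<open>C\<close>, and
  pointwise negation is an automorphism of \<open>C\<close> without fixed points.

  The derivation is found by reflection: the proof terms are written in a higher-order abstract
  syntax and typed by a checker that is proved sound for the given rules.
\<close>

section \<open>A type checker\<close>

subsection \<open>Annotated preterms\<close>

text \<open>The summand \<open>Z\<close> of \<open>f Z\<close> carries a natural injection from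
  \<open>Z\<close>, the summand \<open>C\<close> a natural point. These two facts become the
  hypotheses \<open>iota\<close>, \<open>iota_inj\<close> and \<open>point\<close> on an arbitrary
  retract; their naturality comes for free from path induction. Loops are never compared as elements
  of identity types but only through their action on fibres, so no groupoid laws for path
  composition have to be derived. Function extensionality is not a rule of the theory and has to be
  derived from univalence.

  On the formal side no substitution lemma is proved for the judgements. Each lemma of the object
  theory therefore becomes a variable of the context: proof terms mention it without unfolding its
  proof, and at the end it is removed by applying an abstraction, for which \<open>ty_Lam\<close>
  and \<open>ty_App\<close> suffice. For the same reason the checker repeats checks where one would
  usually invoke substitution or strengthening.\<close>

text \<open>
  Pairs and injections carry the annotations that make all types inferable. \<open>PTop k\<close> is the \<open>k\<close>-th
  global hypothesis or lemma, counted from the oldest one; unlike an index it is not changed by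
  renaming and substitution. \<open>er N d\<close> erases a preterm below \<open>N\<close> globals and \<open>d\<close> local binders.
\<close>

datatype ptm =
    PVar nat | PTop nat | PUniv nat
  | PPi ptm ptm | PLam ptm ptm | PApp ptm ptm
  | PSig ptm ptm | PDpair ptm ptm ptm ptm | PSplit ptm ptm ptm
  | PPlus ptm ptm | PInj1 ptm ptm | PInj2 ptm ptm | PCase ptm ptm ptm ptm
  | PEmpty | PAbsurd ptm ptm
  | PTwo | PTwo0 | PTwo1 | PIndTwo ptm ptm ptm ptm
  | PNat | PZero | PSucc ptm | PIndNat ptm ptm ptm ptm
  | PEq ptm ptm ptm | PRefl ptm | PJ ptm ptm ptm ptm ptm
  | PTrunc ptm | PTr ptm | PTrPath ptm ptm | PTrRec ptm ptm ptm ptm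

section \<open>Renaming, substitution, erasure and scoping of preterms\<close>

primrec pren :: "(nat \<Rightarrow> nat) \<Rightarrow> ptm \<Rightarrow> ptm" where
  "pren \<rho> (PVar n) = PVar (\<rho> n)"
| "pren \<rho> (PTop k) = PTop k"
| "pren \<rho> (PUniv i) = PUniv i"
| "pren \<rho> (PPi A B) = PPi (pren \<rho> A) (pren (upr \<rho>) B)"
| "pren \<rho> (PLam A b) = PLam (pren \<rho> A) (pren (upr \<rho>) b)"
| "pren \<rho> (PApp f a) = PApp (pren \<rho> f) (pren \<rho> a)"
| "pren \<rho> (PSig A B) = PSig (pren \<rho> A) (pren (upr \<rho>) B)"
| "pren \<rho> (PDpair A B a b) = PDpair (pren \<rho> A) (pren (upr \<rho>) B) (pren \<rho> a) (pren \<rho> b)"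
| "pren \<rho> (PSplit C g p) = PSplit (pren (upr \<rho>) C) (pren (upr (upr \<rho>)) g) (pren \<rho> p)"
| "pren \<rho> (PPlus A B) = PPlus (pren \<rho> A) (pren \<rho> B)"
| "pren \<rho> (PInj1 B a) = PInj1 (pren \<rho> B) (pren \<rho> a)"
| "pren \<rho> (PInj2 A b) = PInj2 (pren \<rho> A) (pren \<rho> b)"
| "pren \<rho> (PCase C c d e) =
     PCase (pren (upr \<rho>) C) (pren (upr \<rho>) c) (pren (upr \<rho>) d) (pren \<rho> e)"
| "pren \<rho> PEmpty = PEmpty"
| "pren \<rho> (PAbsurd C e) = PAbsurd (pren (upr \<rho>) C) (pren \<rho> e)"
| "pren \<rho> PTwo = PTwo"
| "pren \<rho> PTwo0 = PTwo0"
| "pren \<rho> PTwo1 = PTwo1"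
| "pren \<rho> (PIndTwo C c d e) = PIndTwo (pren (upr \<rho>) C) (pren \<rho> c) (pren \<rho> d) (pren \<rho> e)"
| "pren \<rho> PNat = PNat"
| "pren \<rho> PZero = PZero"
| "pren \<rho> (PSucc n) = PSucc (pren \<rho> n)"
| "pren \<rho> (PIndNat C z s n) =
     PIndNat (pren (upr \<rho>) C) (pren \<rho> z) (pren (upr (upr \<rho>)) s) (pren \<rho> n)"
| "pren \<rho> (PEq A a b) = PEq (pren \<rho> A) (pren \<rho> a) (pren \<rho> b)"
| "pren \<rho> (PRefl a) = PRefl (pren \<rho> a)"
| "pren \<rho> (PJ C c a b p) =
     PJ (pren (upr (upr (upr \<rho>))) C) (pren (upr \<rho>) c) (pren \<rho> a) (pren \<rho> b) (pren \<rho> p)"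
| "pren \<rho> (PTrunc A) = PTrunc (pren \<rho> A)"
| "pren \<rho> (PTr a) = PTr (pren \<rho> a)"
| "pren \<rho> (PTrPath a b) = PTrPath (pren \<rho> a) (pren \<rho> b)"
| "pren \<rho> (PTrRec P h g a) = PTrRec (pren \<rho> P) (pren \<rho> h) (pren \<rho> g) (pren \<rho> a)"

abbreviation pwk :: "ptm \<Rightarrow> ptm" where
  "pwk \<equiv> pren Suc"

definition pup :: "(nat \<Rightarrow> ptm) \<Rightarrow> nat \<Rightarrow> ptm" where
  "pup \<sigma> = case_nat (PVar 0) (\<lambda>n. pwk (\<sigma> n))"

primrec psub :: "(nat \<Rightarrow> ptm) \<Rightarrow> ptm \<Rightarrow> ptm" where
  "psub \<sigma> (PVar n) = \<sigma> n"
| "psub \<sigma> (PTop k) = PTop k"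
| "psub \<sigma> (PUniv i) = PUniv i"
| "psub \<sigma> (PPi A B) = PPi (psub \<sigma> A) (psub (pup \<sigma>) B)"
| "psub \<sigma> (PLam A b) = PLam (psub \<sigma> A) (psub (pup \<sigma>) b)"
| "psub \<sigma> (PApp f a) = PApp (psub \<sigma> f) (psub \<sigma> a)"
| "psub \<sigma> (PSig A B) = PSig (psub \<sigma> A) (psub (pup \<sigma>) B)"
| "psub \<sigma> (PDpair A B a b) = PDpair (psub \<sigma> A) (psub (pup \<sigma>) B) (psub \<sigma> a) (psub \<sigma> b)"
| "psub \<sigma> (PSplit C g p) = PSplit (psub (pup \<sigma>) C) (psub (pup (pup \<sigma>)) g) (psub \<sigma> p)"
| "psub \<sigma> (PPlus A B) = PPlus (psub \<sigma> A) (psub \<sigma> B)"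
| "psub \<sigma> (PInj1 B a) = PInj1 (psub \<sigma> B) (psub \<sigma> a)"
| "psub \<sigma> (PInj2 A b) = PInj2 (psub \<sigma> A) (psub \<sigma> b)"
| "psub \<sigma> (PCase C c d e) =
     PCase (psub (pup \<sigma>) C) (psub (pup \<sigma>) c) (psub (pup \<sigma>) d) (psub \<sigma> e)"
| "psub \<sigma> PEmpty = PEmpty"
| "psub \<sigma> (PAbsurd C e) = PAbsurd (psub (pup \<sigma>) C) (psub \<sigma> e)"
| "psub \<sigma> PTwo = PTwo"
| "psub \<sigma> PTwo0 = PTwo0"
| "psub \<sigma> PTwo1 = PTwo1"
| "psub \<sigma> (PIndTwo C c d e) = PIndTwo (psub (pup \<sigma>) C) (psub \<sigma> c) (psub \<sigma> d) (psub \<sigma> e)"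
| "psub \<sigma> PNat = PNat"
| "psub \<sigma> PZero = PZero"
| "psub \<sigma> (PSucc n) = PSucc (psub \<sigma> n)"
| "psub \<sigma> (PIndNat C z s n) =
     PIndNat (psub (pup \<sigma>) C) (psub \<sigma> z) (psub (pup (pup \<sigma>)) s) (psub \<sigma> n)"
| "psub \<sigma> (PEq A a b) = PEq (psub \<sigma> A) (psub \<sigma> a) (psub \<sigma> b)"
| "psub \<sigma> (PRefl a) = PRefl (psub \<sigma> a)"
| "psub \<sigma> (PJ C c a b p) =
     PJ (psub (pup (pup (pup \<sigma>))) C) (psub (pup \<sigma>) c) (psub \<sigma> a) (psub \<sigma> b) (psub \<sigma> p)"
| "psub \<sigma> (PTrunc A) = PTrunc (psub \<sigma> A)"
| "psub \<sigma> (PTr a) = PTr (psub \<sigma> a)"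
| "psub \<sigma> (PTrPath a b) = PTrPath (psub \<sigma> a) (psub \<sigma> b)"
| "psub \<sigma> (PTrRec P h g a) = PTrRec (psub \<sigma> P) (psub \<sigma> h) (psub \<sigma> g) (psub \<sigma> a)"

primrec er :: "nat \<Rightarrow> nat \<Rightarrow> ptm \<Rightarrow> tm" where
  "er N d (PVar n) = Var n"
| "er N d (PTop k) = Var (d + (N - Suc k))"
| "er N d (PUniv i) = Univ i"
| "er N d (PPi A B) = Pi (er N d A) (er N (Suc d) B)"
| "er N d (PLam A b) = Lam (er N d A) (er N (Suc d) b)"
| "er N d (PApp f a) = App (er N d f) (er N d a)"
| "er N d (PSig A B) = Sig (er N d A) (er N (Suc d) B)"
| "er N d (PDpair A B a b) = Dpair (er N d a) (er N d b)"
| "er N d (PSplit C g p) = Split (er N (Suc d) C) (er N (Suc (Suc d)) g) (er N d p)"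
| "er N d (PPlus A B) = Plus (er N d A) (er N d B)"
| "er N d (PInj1 B a) = Inj1 (er N d a)"
| "er N d (PInj2 A b) = Inj2 (er N d b)"
| "er N d (PCase C c e p) =
     CaseSum (er N (Suc d) C) (er N (Suc d) c) (er N (Suc d) e) (er N d p)"
| "er N d PEmpty = Empty"
| "er N d (PAbsurd C e) = Absurd (er N (Suc d) C) (er N d e)"
| "er N d PTwo = Two"
| "er N d PTwo0 = Two0"
| "er N d PTwo1 = Two1"
| "er N d (PIndTwo C c e p) = IndTwo (er N (Suc d) C) (er N d c) (er N d e) (er N d p)"
| "er N d PNat = NatT"
| "er N d PZero = Zero"
| "er N d (PSucc n) = Succ (er N d n)"
| "er N d (PIndNat C z s n) =
     IndNat (er N (Suc d) C) (er N d z) (er N (Suc (Suc d)) s) (er N d n)"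
| "er N d (PEq A a b) = Eq (er N d A) (er N d a) (er N d b)"
| "er N d (PRefl a) = Refl (er N d a)"
| "er N d (PJ C c a b p) =
     J (er N (Suc (Suc (Suc d))) C) (er N (Suc d) c) (er N d a) (er N d b) (er N d p)"
| "er N d (PTrunc A) = Trunc (er N d A)"
| "er N d (PTr a) = Tr (er N d a)"
| "er N d (PTrPath a b) = TrPath (er N d a) (er N d b)"
| "er N d (PTrRec P h g a) = TrRec (er N d P) (er N d h) (er N d g) (er N d a)"

text \<open>The types of globals have to be closed: only then do their erasures over different
  numbers of globals and binders differ by a renaming alone.\<close>

primrec scoped :: "nat \<Rightarrow> nat \<Rightarrow> ptm \<Rightarrow> bool" where
  "scoped d N (PVar n) = (n < d)"
| "scoped d N (PTop k) = (k < N)"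
| "scoped d N (PUniv i) = True"
| "scoped d N (PPi A B) = (scoped d N A \<and> scoped (Suc d) N B)"
| "scoped d N (PLam A b) = (scoped d N A \<and> scoped (Suc d) N b)"
| "scoped d N (PApp f a) = (scoped d N f \<and> scoped d N a)"
| "scoped d N (PSig A B) = (scoped d N A \<and> scoped (Suc d) N B)"
| "scoped d N (PDpair A B a b) =
     (scoped d N A \<and> scoped (Suc d) N B \<and> scoped d N a \<and> scoped d N b)"
| "scoped d N (PSplit C g p) = (scoped (Suc d) N C \<and> scoped (Suc (Suc d)) N g \<and> scoped d N p)"
| "scoped d N (PPlus A B) = (scoped d N A \<and> scoped d N B)"
| "scoped d N (PInj1 B a) = (scoped d N B \<and> scoped d N a)"
| "scoped d N (PInj2 A b) = (scoped d N A \<and> scoped d N b)"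
| "scoped d N (PCase C c e p) =
     (scoped (Suc d) N C \<and> scoped (Suc d) N c \<and> scoped (Suc d) N e \<and> scoped d N p)"
| "scoped d N PEmpty = True"
| "scoped d N (PAbsurd C e) = (scoped (Suc d) N C \<and> scoped d N e)"
| "scoped d N PTwo = True"
| "scoped d N PTwo0 = True"
| "scoped d N PTwo1 = True"
| "scoped d N (PIndTwo C c e p) =
     (scoped (Suc d) N C \<and> scoped d N c \<and> scoped d N e \<and> scoped d N p)"
| "scoped d N PNat = True"
| "scoped d N PZero = True"
| "scoped d N (PSucc n) = scoped d N n"
| "scoped d N (PIndNat C z s n) =
     (scoped (Suc d) N C \<and> scoped d N z \<and> scoped (Suc (Suc d)) N s \<and> scoped d N n)"
| "scoped d N (PEq A a b) = (scoped d N A \<and> scoped d N a \<and> scoped d N b)"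
| "scoped d N (PRefl a) = scoped d N a"
| "scoped d N (PJ C c a b p) =
     (scoped (Suc (Suc (Suc d))) N C \<and> scoped (Suc d) N c \<and> scoped d N a \<and> scoped d N b \<and> scoped d N p)"
| "scoped d N (PTrunc A) = scoped d N A"
| "scoped d N (PTr a) = scoped d N a"
| "scoped d N (PTrPath a b) = (scoped d N a \<and> scoped d N b)"
| "scoped d N (PTrRec P h g a) = (scoped d N P \<and> scoped d N h \<and> scoped d N g \<and> scoped d N a)"

text \<open>Forms that may expose a redex when an eliminator meets them. \<open>PTr\<close> is not
  among them because \<open>TrRec\<close> has no judgmental computation rule.\<close>

fun intro_form :: "ptm \<Rightarrow> bool" where
  "intro_form (PLam A b) = True"
| "intro_form (PDpair A B a b) = True"
| "intro_form (PInj1 B a) = True"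
| "intro_form (PInj2 A b) = True"
| "intro_form PTwo0 = True"
| "intro_form PTwo1 = True"
| "intro_form PZero = True"
| "intro_form (PSucc n) = True"
| "intro_form (PRefl a) = True"
| "intro_form _ = False"

fun var0 :: "ptm \<Rightarrow> bool" where
  "var0 (PVar n) = (n = 0)"
| "var0 _ = False"

fun applied_to_var0 :: "ptm \<Rightarrow> bool" where
  "applied_to_var0 (PApp f a) = var0 a"
| "applied_to_var0 _ = False"

text \<open>A quick syntactic test that errs on the safe side: an abstraction whose body is applied
  to the bound variable is rejected even if the function part also contains that variable. A false
  negative merely triggers another evaluation.\<close>

primrec isnf :: "ptm \<Rightarrow> bool" where
  "isnf (PVar n) = True"
| "isnf (PTop k) = True"
| "isnf (PUniv i) = True"
| "isnf (PPi A B) = (isnf A \<and> isnf B)"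
| "isnf (PLam A b) = (isnf A \<and> isnf b \<and> \<not> applied_to_var0 b)"
| "isnf (PApp f a) = (\<not> intro_form f \<and> isnf f \<and> isnf a)"
| "isnf (PSig A B) = (isnf A \<and> isnf B)"
| "isnf (PDpair A B a b) = (isnf A \<and> isnf B \<and> isnf a \<and> isnf b)"
| "isnf (PSplit C g p) = (\<not> intro_form p \<and> isnf C \<and> isnf g \<and> isnf p)"
| "isnf (PPlus A B) = (isnf A \<and> isnf B)"
| "isnf (PInj1 B a) = (isnf B \<and> isnf a)"
| "isnf (PInj2 A b) = (isnf A \<and> isnf b)"
| "isnf (PCase C c e p) = (\<not> intro_form p \<and> isnf C \<and> isnf c \<and> isnf e \<and> isnf p)"
| "isnf PEmpty = True"
| "isnf (PAbsurd C e) = (isnf C \<and> isnf e)"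
| "isnf PTwo = True"
| "isnf PTwo0 = True"
| "isnf PTwo1 = True"
| "isnf (PIndTwo C c e p) = (\<not> intro_form p \<and> isnf C \<and> isnf c \<and> isnf e \<and> isnf p)"
| "isnf PNat = True"
| "isnf PZero = True"
| "isnf (PSucc n) = isnf n"
| "isnf (PIndNat C z s n) = (\<not> intro_form n \<and> isnf C \<and> isnf z \<and> isnf s \<and> isnf n)"
| "isnf (PEq A a b) = (isnf A \<and> isnf a \<and> isnf b)"
| "isnf (PRefl a) = isnf a"
| "isnf (PJ C c a b p) = (\<not> intro_form p \<and> isnf C \<and> isnf c \<and> isnf a \<and> isnf b \<and> isnf p)"
| "isnf (PTrunc A) = isnf A"
| "isnf (PTr a) = isnf a"
| "isnf (PTrPath a b) = (isnf a \<and> isnf b)"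
| "isnf (PTrRec P h g a) = (isnf P \<and> isnf h \<and> isnf g \<and> isnf a)"

fun univ_of :: "ptm \<Rightarrow> nat option" where
  "univ_of (PUniv i) = Some i"
| "univ_of _ = None"

fun pi_of :: "ptm \<Rightarrow> (ptm \<times> ptm) option" where
  "pi_of (PPi A B) = Some (A, B)"
| "pi_of _ = None"

fun lam_of :: "ptm \<Rightarrow> (ptm \<times> ptm) option" where
  "lam_of (PLam A b) = Some (A, b)"
| "lam_of _ = None"

fun sig_of :: "ptm \<Rightarrow> (ptm \<times> ptm) option" where
  "sig_of (PSig A B) = Some (A, B)"
| "sig_of _ = None"

fun pair_of :: "ptm \<Rightarrow> (ptm \<times> ptm) option" where
  "pair_of (PDpair A B a b) = Some (a, b)"
| "pair_of _ = None"

fun plus_of :: "ptm \<Rightarrow> (ptm \<times> ptm) option" where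
  "plus_of (PPlus A B) = Some (A, B)"
| "plus_of _ = None"

fun inj_of :: "ptm \<Rightarrow> (bool \<times> ptm) option" where
  "inj_of (PInj1 B a) = Some (True, a)"
| "inj_of (PInj2 A b) = Some (False, b)"
| "inj_of _ = None"

fun two_of :: "ptm \<Rightarrow> bool option" where
  "two_of PTwo0 = Some False"
| "two_of PTwo1 = Some True"
| "two_of _ = None"

fun nat_of :: "ptm \<Rightarrow> ptm option option" where
  "nat_of PZero = Some None"
| "nat_of (PSucc n) = Some (Some n)"
| "nat_of _ = None"

fun eq_of :: "ptm \<Rightarrow> (ptm \<times> ptm \<times> ptm) option" where
  "eq_of (PEq A a b) = Some (A, a, b)"
| "eq_of _ = None"

fun refl_of :: "ptm \<Rightarrow> ptm option" where
  "refl_of (PRefl a) = Some a"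
| "refl_of _ = None"

fun trunc_of :: "ptm \<Rightarrow> ptm option" where
  "trunc_of (PTrunc A) = Some A"
| "trunc_of _ = None"

fun cumul :: "ptm \<Rightarrow> ptm \<Rightarrow> bool" where
  "cumul (PUniv i) (PUniv j) = (i \<le> j)"
| "cumul S T = (S = T)"

text \<open>A constant of its own, so that a congruence rule can keep the simplifier out of both
  arguments; they are already evaluated and are compared in one rewrite step.\<close>

definition same :: "ptm \<Rightarrow> ptm \<Rightarrow> bool" where
  "same s t \<longleftrightarrow> s = t"

abbreviation pinst1 :: "ptm \<Rightarrow> ptm \<Rightarrow> ptm" where
  "pinst1 a \<equiv> psub (case_nat a PVar)"

abbreviation pinst2 :: "ptm \<Rightarrow> ptm \<Rightarrow> ptm \<Rightarrow> ptm" where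
  "pinst2 a b \<equiv> psub (case_nat b (case_nat a PVar))"

abbreviation pinst3 :: "ptm \<Rightarrow> ptm \<Rightarrow> ptm \<Rightarrow> ptm \<Rightarrow> ptm" where
  "pinst3 a b c \<equiv> psub (case_nat c (case_nat b (case_nat a PVar)))"

abbreviation pat1 :: "ptm \<Rightarrow> ptm \<Rightarrow> ptm" where
  "pat1 t \<equiv> psub (case_nat t (\<lambda>n. PVar (Suc n)))"

abbreviation pat2 :: "ptm \<Rightarrow> ptm \<Rightarrow> ptm" where
  "pat2 t \<equiv> psub (case_nat t (\<lambda>n. PVar (Suc (Suc n))))"

abbreviation pdiag :: "ptm \<Rightarrow> ptm" where
  "pdiag \<equiv> psub (case_nat (PRefl (PVar 0))
     (case_nat (PVar 0) (case_nat (PVar 0) (\<lambda>n. PVar (Suc n)))))"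

text \<open>Variable 0 is replaced by the dummy \<open>PZero\<close>; weakening the result gives
  back \<open>h\<close> exactly when variable 0 does not occur in \<open>h\<close>. Binding
  \<open>Some (...)\<close> forces the evaluation of an intermediate result before it is passed
  on.\<close>

fun eta_contract :: "ptm \<Rightarrow> ptm option" where
  "eta_contract (PApp h a) =
     (if var0 a then do {
        f \<leftarrow> Some (pinst1 PZero h);
        h' \<leftarrow> Some (pwk f);
        if h' = h then Some f else None }
      else None)"
| "eta_contract _ = None"

type_synonym judge = "ptm list \<Rightarrow> ptm \<Rightarrow> (ptm \<times> ptm) option"

definition infer_type :: "judge \<Rightarrow> ptm list \<Rightarrow> ptm \<Rightarrow> (ptm \<times> nat) option" where
  "infer_type F \<Gamma> A = do { (A', K) \<leftarrow> F \<Gamma> A; i \<leftarrow> univ_of K; Some (A', i) }"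

definition check_type :: "judge \<Rightarrow> ptm list \<Rightarrow> ptm \<Rightarrow> ptm \<Rightarrow> ptm option" where
  "check_type F \<Gamma> T t = do { (t', T') \<leftarrow> F \<Gamma> t; if cumul T' T then Some t' else None }"

definition normal_type :: "judge \<Rightarrow> ptm list \<Rightarrow> ptm \<Rightarrow> ptm option" where
  "normal_type F \<Gamma> A =
     (if isnf A then Some A else do { (A', i) \<leftarrow> infer_type F \<Gamma> A; Some A' })"

text \<open>
  Replacing \<open>t\<close> by its normal form \<open>t'\<close> in an inferred type is harmless if nothing changes; otherwise
  the type itself must be known to be well formed, which is what \<open>r\<close> establishes.
\<close>

definition unchanged :: "ptm \<Rightarrow> ptm \<Rightarrow> (ptm \<times> nat) option \<Rightarrow> unit option" where
  "unchanged t t' r =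
     (if isnf t then if same t t' then Some () else None else do { _ \<leftarrow> r; Some () })"

fun lookup :: "'a list \<Rightarrow> nat \<Rightarrow> 'a option" where
  "lookup [] n = None"
| "lookup (x # xs) 0 = Some x"
| "lookup (x # xs) (Suc n) = lookup xs n"

text \<open>
  \<open>step\<close> computes the normal form and the normalised type of a preterm. Soundness cannot appeal to
  subject reduction, because injectivity of \<open>\<Pi>\<close> is not available for typed judgmental equality.
  Therefore only the input, not the normal form, is claimed to be well typed, and before a redex is
  contracted its components are checked again.
\<close>

fun step :: "ptm list \<Rightarrow> nat \<Rightarrow> judge \<Rightarrow> judge" where
  "step \<Theta> N F \<Gamma> (PVar n) = do {
       A \<leftarrow> lookup \<Gamma> n;
       T \<leftarrow> normal_type F \<Gamma> (pren (\<lambda>k. k + Suc n) A);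
       Some (PVar n, T) }"
| "step \<Theta> N F \<Gamma> (PTop k) =
       (if k < N then do { T \<leftarrow> normal_type F \<Gamma> (\<Theta> ! k); Some (PTop k, T) } else None)"
| "step \<Theta> N F \<Gamma> (PUniv i) = Some (PUniv i, PUniv (Suc i))"
| "step \<Theta> N F \<Gamma> (PPi A B) = do {
       (A', i) \<leftarrow> infer_type F \<Gamma> A;
       (B', j) \<leftarrow> infer_type F (A # \<Gamma>) B;
       Some (PPi A' B', PUniv (max i j)) }"
| "step \<Theta> N F \<Gamma> (PLam A b) = do {
       (A', i) \<leftarrow> infer_type F \<Gamma> A;
       (b', B) \<leftarrow> F (A # \<Gamma>) b;
       _ \<leftarrow> unchanged A A' (infer_type F (A # \<Gamma>) B);
       case eta_contract b' of
         None \<Rightarrow> Some (PLam A' b', PPi A' B)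
       | Some f \<Rightarrow> do { _ \<leftarrow> check_type F \<Gamma> (PPi A' B) f; Some (f, PPi A' B) } }"
| "step \<Theta> N F \<Gamma> (PApp f a) = do {
       (f', S) \<leftarrow> F \<Gamma> f;
       (A, B) \<leftarrow> pi_of S;
       a' \<leftarrow> check_type F \<Gamma> A a;
       T \<leftarrow> normal_type F \<Gamma> (pinst1 a B);
       if intro_form f' then do {
         (A0, b) \<leftarrow> lam_of f';
         if same A0 A then do {
           _ \<leftarrow> infer_type F \<Gamma> A;
           _ \<leftarrow> check_type F (A # \<Gamma>) B b;
           t' \<leftarrow> check_type F \<Gamma> T (pinst1 a b);
           Some (t', T) }
         else None }
       else Some (PApp f' a', T) }"
| "step \<Theta> N F \<Gamma> (PSig A B) = do {
       (A', i) \<leftarrow> infer_type F \<Gamma> A;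
       (B', j) \<leftarrow> infer_type F (A # \<Gamma>) B;
       Some (PSig A' B', PUniv (max i j)) }"
| "step \<Theta> N F \<Gamma> (PDpair A B a b) = do {
       (A', i) \<leftarrow> infer_type F \<Gamma> A;
       (B', j) \<leftarrow> infer_type F (A # \<Gamma>) B;
       a' \<leftarrow> check_type F \<Gamma> A' a;
       T \<leftarrow> normal_type F \<Gamma> (pinst1 a B);
       b' \<leftarrow> check_type F \<Gamma> T b;
       Some (PDpair A' B' a' b', PSig A' B') }"
| "step \<Theta> N F \<Gamma> (PSplit C g p) = do {
       (p', S) \<leftarrow> F \<Gamma> p;
       (A, B) \<leftarrow> sig_of S;
       _ \<leftarrow> infer_type F \<Gamma> A;
       _ \<leftarrow> infer_type F (A # \<Gamma>) B;
       (C', i) \<leftarrow> infer_type F (S # \<Gamma>) C;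
       U \<leftarrow> normal_type F (B # A # \<Gamma>) (pat2 (PDpair (pren (\<lambda>n. Suc (Suc n)) A)
              (pren (upr (\<lambda>n. Suc (Suc n))) B) (PVar (Suc 0)) (PVar 0)) C);
       g' \<leftarrow> check_type F (B # A # \<Gamma>) U g;
       T \<leftarrow> normal_type F \<Gamma> (pinst1 p C);
       if intro_form p' then do {
         (a, b) \<leftarrow> pair_of p';
         _ \<leftarrow> check_type F \<Gamma> A a;
         V \<leftarrow> normal_type F \<Gamma> (pinst1 a B);
         _ \<leftarrow> check_type F \<Gamma> V b;
         T' \<leftarrow> normal_type F \<Gamma> (pinst1 p' C);
         if same T' T then do { t' \<leftarrow> check_type F \<Gamma> T (pinst2 a b g); Some (t', T) }
         else None }
       else Some (PSplit C' g' p', T) }"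
| "step \<Theta> N F \<Gamma> (PPlus A B) = do {
       (A', i) \<leftarrow> infer_type F \<Gamma> A;
       (B', j) \<leftarrow> infer_type F \<Gamma> B;
       Some (PPlus A' B', PUniv (max i j)) }"
| "step \<Theta> N F \<Gamma> (PInj1 B a) = do {
       (B', i) \<leftarrow> infer_type F \<Gamma> B;
       (a', A) \<leftarrow> F \<Gamma> a;
       _ \<leftarrow> unchanged B B' (infer_type F \<Gamma> A);
       Some (PInj1 B' a', PPlus A B') }"
| "step \<Theta> N F \<Gamma> (PInj2 A b) = do {
       (A', i) \<leftarrow> infer_type F \<Gamma> A;
       (b', B) \<leftarrow> F \<Gamma> b;
       _ \<leftarrow> unchanged A A' (infer_type F \<Gamma> B);
       Some (PInj2 A' b', PPlus A' B) }"
| "step \<Theta> N F \<Gamma> (PCase C c d e) = do {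
       (e', S) \<leftarrow> F \<Gamma> e;
       (A, B) \<leftarrow> plus_of S;
       _ \<leftarrow> infer_type F \<Gamma> A;
       _ \<leftarrow> infer_type F \<Gamma> B;
       (C', i) \<leftarrow> infer_type F (S # \<Gamma>) C;
       U \<leftarrow> normal_type F (A # \<Gamma>) (pat1 (PInj1 (pwk B) (PVar 0)) C);
       c' \<leftarrow> check_type F (A # \<Gamma>) U c;
       V \<leftarrow> normal_type F (B # \<Gamma>) (pat1 (PInj2 (pwk A) (PVar 0)) C);
       d' \<leftarrow> check_type F (B # \<Gamma>) V d;
       T \<leftarrow> normal_type F \<Gamma> (pinst1 e C);
       if intro_form e' then do {
         (left, a) \<leftarrow> inj_of e';
         (D, k) \<leftarrow> Some (if left then (A, c) else (B, d));
         _ \<leftarrow> check_type F \<Gamma> D a;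
         T' \<leftarrow> normal_type F \<Gamma> (pinst1 e' C);
         if same T' T then do {
           t' \<leftarrow> check_type F \<Gamma> T (pinst1 a k); Some (t', T) }
         else None }
       else Some (PCase C' c' d' e', T) }"
| "step \<Theta> N F \<Gamma> PEmpty = Some (PEmpty, PUniv 0)"
| "step \<Theta> N F \<Gamma> (PAbsurd C e) = do {
       (C', i) \<leftarrow> infer_type F (PEmpty # \<Gamma>) C;
       e' \<leftarrow> check_type F \<Gamma> PEmpty e;
       T \<leftarrow> normal_type F \<Gamma> (pinst1 e C);
       Some (PAbsurd C' e', T) }"
| "step \<Theta> N F \<Gamma> PTwo = Some (PTwo, PUniv 0)"
| "step \<Theta> N F \<Gamma> PTwo0 = Some (PTwo0, PTwo)"
| "step \<Theta> N F \<Gamma> PTwo1 = Some (PTwo1, PTwo)"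
| "step \<Theta> N F \<Gamma> (PIndTwo C c d e) = do {
       (C', i) \<leftarrow> infer_type F (PTwo # \<Gamma>) C;
       U \<leftarrow> normal_type F \<Gamma> (pinst1 PTwo0 C);
       c' \<leftarrow> check_type F \<Gamma> U c;
       V \<leftarrow> normal_type F \<Gamma> (pinst1 PTwo1 C);
       d' \<leftarrow> check_type F \<Gamma> V d;
       e' \<leftarrow> check_type F \<Gamma> PTwo e;
       T \<leftarrow> normal_type F \<Gamma> (pinst1 e C);
       if intro_form e' then do {
         b \<leftarrow> two_of e';
         (W, w) \<leftarrow> Some (if b then (V, d') else (U, c'));
         if same W T then Some (w, T) else None }
       else Some (PIndTwo C' c' d' e', T) }"
| "step \<Theta> N F \<Gamma> PNat = Some (PNat, PUniv 0)"
| "step \<Theta> N F \<Gamma> PZero = Some (PZero, PNat)"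
| "step \<Theta> N F \<Gamma> (PSucc n) = do { n' \<leftarrow> check_type F \<Gamma> PNat n; Some (PSucc n', PNat) }"
| "step \<Theta> N F \<Gamma> (PIndNat C z s n) = do {
       (C', i) \<leftarrow> infer_type F (PNat # \<Gamma>) C;
       U \<leftarrow> normal_type F \<Gamma> (pinst1 PZero C);
       z' \<leftarrow> check_type F \<Gamma> U z;
       V \<leftarrow> normal_type F (C # PNat # \<Gamma>) (pat2 (PSucc (PVar (Suc 0))) C);
       s' \<leftarrow> check_type F (C # PNat # \<Gamma>) V s;
       n' \<leftarrow> check_type F \<Gamma> PNat n;
       T \<leftarrow> normal_type F \<Gamma> (pinst1 n C);
       if intro_form n' then do {
         k \<leftarrow> nat_of n';
         case k of
           None \<Rightarrow> if same U T then Some (z', T) else None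
         | Some m \<Rightarrow> do {
             _ \<leftarrow> check_type F \<Gamma> PNat m;
             T' \<leftarrow> normal_type F \<Gamma> (pinst1 n' C);
             if same T' T then do {
               t' \<leftarrow> check_type F \<Gamma> T (pinst2 m (PIndNat C z s m) s); Some (t', T) }
             else None } }
       else Some (PIndNat C' z' s' n', T) }"
| "step \<Theta> N F \<Gamma> (PEq A a b) = do {
       (A', i) \<leftarrow> infer_type F \<Gamma> A;
       a' \<leftarrow> check_type F \<Gamma> A' a;
       b' \<leftarrow> check_type F \<Gamma> A' b;
       Some (PEq A' a' b', PUniv i) }"
| "step \<Theta> N F \<Gamma> (PRefl a) = do {
       (a', A) \<leftarrow> F \<Gamma> a;
       _ \<leftarrow> unchanged a a' (infer_type F \<Gamma> A);
       Some (PRefl a', PEq A a' a') }"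
| "step \<Theta> N F \<Gamma> (PJ C c a b p) = do {
       (p', E) \<leftarrow> F \<Gamma> p;
       (A, x, y) \<leftarrow> eq_of E;
       a' \<leftarrow> check_type F \<Gamma> A a;
       b' \<leftarrow> check_type F \<Gamma> A b;
       if same x a' \<and> same y b' then do {
         _ \<leftarrow> infer_type F \<Gamma> A;
         A1 \<leftarrow> Some (pwk A);
         A2 \<leftarrow> Some (pwk A1);
         _ \<leftarrow> infer_type F (A # \<Gamma>) A1;
         _ \<leftarrow> infer_type F (A1 # A # \<Gamma>) A2;
         (C', i) \<leftarrow> infer_type F (PEq A2 (PVar (Suc 0)) (PVar 0) # A1 # A # \<Gamma>) C;
         U \<leftarrow> normal_type F (A # \<Gamma>) (pdiag C);
         c' \<leftarrow> check_type F (A # \<Gamma>) U c;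
         T \<leftarrow> normal_type F \<Gamma> (pinst3 a b p C);
         if intro_form p' then do {
           z \<leftarrow> refl_of p';
           T' \<leftarrow> normal_type F \<Gamma> (pinst3 a a (PRefl a) C);
           if same z x \<and> same y x \<and> same T' T then do {
             t' \<leftarrow> check_type F \<Gamma> T (pinst1 a c); Some (t', T) }
           else None }
         else Some (PJ C' c' a' b' p', T) }
       else None }"
| "step \<Theta> N F \<Gamma> (PTrunc A) = do { (A', i) \<leftarrow> infer_type F \<Gamma> A; Some (PTrunc A', PUniv i) }"
| "step \<Theta> N F \<Gamma> (PTr a) = do { (a', A) \<leftarrow> F \<Gamma> a; Some (PTr a', PTrunc A) }"
| "step \<Theta> N F \<Gamma> (PTrPath a b) = do {
       (a', A) \<leftarrow> F \<Gamma> a;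
       A0 \<leftarrow> trunc_of A;
       b' \<leftarrow> check_type F \<Gamma> A b;
       _ \<leftarrow> unchanged a a' (infer_type F \<Gamma> A);
       _ \<leftarrow> unchanged b b' (infer_type F \<Gamma> A);
       Some (PTrPath a' b', PEq A a' b') }"
| "step \<Theta> N F \<Gamma> (PTrRec P h g a) = do {
       (P', i) \<leftarrow> infer_type F \<Gamma> P;
       P1 \<leftarrow> Some (pwk P);
       P2 \<leftarrow> Some (pwk P1);
       U \<leftarrow> normal_type F \<Gamma> (PPi P (PPi P1 (PEq P2 (PVar (Suc 0)) (PVar 0))));
       h' \<leftarrow> check_type F \<Gamma> U h;
       (a', S) \<leftarrow> F \<Gamma> a;
       A \<leftarrow> trunc_of S;
       V \<leftarrow> normal_type F \<Gamma> (PPi A P1);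
       g' \<leftarrow> check_type F \<Gamma> V g;
       Some (PTrRec P' h' g' a', P') }"

primrec nf :: "nat \<Rightarrow> ptm list \<Rightarrow> nat \<Rightarrow> judge" where
  "nf 0 \<Theta> N = (\<lambda>\<Gamma> t. None)"
| "nf (Suc n) \<Theta> N = step \<Theta> N (nf n \<Theta> N)"

text \<open>Fuel for the recursion through \<open>step\<close>. Soundness holds for every value; 40
  is large enough for all proof terms below.\<close>

definition depth :: nat where
  "depth = 40"

abbreviation judgement :: "ptm list \<Rightarrow> nat \<Rightarrow> judge" where
  "judgement \<equiv> nf depth"

definition extends :: "ptm list \<Rightarrow> nat \<Rightarrow> bool" where
  "extends \<Theta> N \<longleftrightarrow> scoped 0 N (\<Theta> ! N) \<and> infer_type (judgement \<Theta> N) [] (\<Theta> ! N) \<noteq> None"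

definition checks :: "ptm list \<Rightarrow> nat \<Rightarrow> ptm \<Rightarrow> bool" where
  "checks \<Theta> N t \<longleftrightarrow> scoped 0 N (\<Theta> ! N) \<and>
     do { (T, i) \<leftarrow> infer_type (judgement \<Theta> N) [] (\<Theta> ! N);
          check_type (judgement \<Theta> N) [] T t } \<noteq> None"

section \<open>Soundness of the checker\<close>

subsection \<open>Renaming and substitution\<close>

lemma upr_simps [simp]: "upr \<rho> 0 = 0" "upr \<rho> (Suc n) = Suc (\<rho> n)"
  by (simp_all add: upr_def)

lemma up_simps [simp]: "up \<sigma> 0 = Var 0" "up \<sigma> (Suc n) = wk (\<sigma> n)"
  by (simp_all add: up_def)

lemma pup_simps [simp]: "pup \<sigma> 0 = PVar 0" "pup \<sigma> (Suc n) = pwk (\<sigma> n)"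
  by (simp_all add: pup_def)

lemma up_comp_upr: "up \<sigma> \<circ> upr \<rho> = up (\<sigma> \<circ> \<rho>)"
proof
  fix n show "(up \<sigma> \<circ> upr \<rho>) n = up (\<sigma> \<circ> \<rho>) n" by (cases n) simp_all
qed

lemma up_Var: "up Var = Var"
proof
  fix n show "up Var n = Var n" by (cases n) simp_all
qed

lemma sub_ren: "sub \<sigma> (ren \<rho> t) = sub (\<sigma> \<circ> \<rho>) t"
  by (induction t arbitrary: \<sigma> \<rho>) (simp_all add: up_comp_upr)

lemma ren_ren: "ren \<rho> (ren \<rho>' t) = ren (\<rho> \<circ> \<rho>') t"
proof -
  have upr: "upr \<rho> \<circ> upr \<rho>' = upr (\<rho> \<circ> \<rho>')" for \<rho> \<rho>'
  proof
    fix n show "(upr \<rho> \<circ> upr \<rho>') n = upr (\<rho> \<circ> \<rho>') n" by (cases n) simp_all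
  qed
  show ?thesis by (induction t arbitrary: \<rho> \<rho>') (simp_all add: upr)
qed

lemma sub_Var: "sub Var t = t"
  by (induction t) (simp_all add: up_Var)

lemma inst1_wk: "inst1 a (wk t) = t"
proof -
  have "case_nat a Var \<circ> Suc = Var" by (rule ext) simp
  then show ?thesis by (simp add: sub_ren sub_Var)
qed

lemma er_pren:
  "(\<And>k. \<rho> (d + k) = d' + k) \<Longrightarrow> er N d' (pren \<rho> t) = ren \<rho> (er N d t)"
  by (induction t arbitrary: \<rho> d d') auto

lemma er_pwk [simp]: "er N (Suc d) (pwk t) = wk (er N d t)"
  by (rule er_pren) simp

text \<open>The second clause says that beyond the \<open>d\<close> local variables the erased
  substitution only shifts. This matches \<open>psub\<close>, which leaves every \<open>PTop\<close>
  alone.\<close>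

definition er_subst :: "nat \<Rightarrow> nat \<Rightarrow> nat \<Rightarrow> (nat \<Rightarrow> ptm) \<Rightarrow> (nat \<Rightarrow> tm) \<Rightarrow> bool" where
  "er_subst N d d' \<sigma> \<tau> \<longleftrightarrow> (\<forall>n. er N d' (\<sigma> n) = \<tau> n) \<and> (\<forall>k. \<tau> (d + k) = Var (d' + k))"

lemma er_subst_up: "er_subst N d d' \<sigma> \<tau> \<Longrightarrow> er_subst N (Suc d) (Suc d') (pup \<sigma>) (up \<tau>)"
  by (auto simp: er_subst_def pup_def up_def split: nat.split)

lemma er_psub: "er_subst N d d' \<sigma> \<tau> \<Longrightarrow> er N d' (psub \<sigma> t) = sub \<tau> (er N d t)"
proof (induction t arbitrary: \<sigma> \<tau> d d')
  case (PVar n)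
  then show ?case by (simp add: er_subst_def)
next
  case (PTop k)
  then show ?case by (simp add: er_subst_def)
qed (simp_all, (blast intro: er_subst_up)+)

lemma er_pinst1: "er N d (pinst1 a t) = inst1 (er N d a) (er N (Suc d) t)"
  by (rule er_psub) (simp add: er_subst_def split: nat.split)

lemma er_pinst2: "er N d (pinst2 a b t) = inst2 (er N d a) (er N d b) (er N (Suc (Suc d)) t)"
  by (rule er_psub) (simp add: er_subst_def split: nat.split)

lemma er_pinst3:
  "er N d (pinst3 a b c t) = inst3 (er N d a) (er N d b) (er N d c) (er N (Suc (Suc (Suc d))) t)"
  by (rule er_psub) (simp add: er_subst_def split: nat.split)

lemma er_pat1: "er N (Suc d) (pat1 u t) = at1 (er N (Suc d) u) (er N (Suc d) t)"
  by (rule er_psub) (simp add: er_subst_def split: nat.split)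

lemma er_pat2: "er N (Suc (Suc d)) (pat2 u t) = at2 (er N (Suc (Suc d)) u) (er N (Suc d) t)"
  by (rule er_psub) (simp add: er_subst_def split: nat.split)

lemma er_pdiag: "er N (Suc d) (pdiag t) = diag (er N (Suc (Suc (Suc d))) t)"
  by (rule er_psub) (simp add: er_subst_def split: nat.split)

lemmas er_inst = er_pinst1 er_pinst2 er_pinst3 er_pat1 er_pat2 er_pdiag

text \<open>The passage from \<open>k\<close> globals below \<open>e\<close> binders to
  \<open>N\<close> globals below \<open>d\<close> binders: the \<open>e\<close> local variables
  stay, and the older globals skip the \<open>N - k\<close> newer ones together with the additional
  binders.\<close>

definition shifts :: "nat \<Rightarrow> nat \<Rightarrow> nat \<Rightarrow> nat \<Rightarrow> (nat \<Rightarrow> nat) \<Rightarrow> bool" where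
  "shifts k N e d \<rho> \<longleftrightarrow> (\<forall>n<e. \<rho> n = n) \<and> (\<forall>n. \<rho> (e + n) = d + (N - k) + n)"

lemma shifts_upr: "shifts k N e d \<rho> \<Longrightarrow> shifts k N (Suc e) (Suc d) (upr \<rho>)"
  by (auto simp: shifts_def upr_def split: nat.split)

lemma ren_er_scoped:
  "scoped e k t \<Longrightarrow> k \<le> N \<Longrightarrow> shifts k N e d \<rho> \<Longrightarrow> ren \<rho> (er k e t) = er N d t"
proof (induction t arbitrary: e d \<rho>)
  case (PVar n)
  then show ?case by (simp add: shifts_def)
next
  case (PTop m)
  \<comment> \<open>As \<open>m < k \<le> N\<close>, the truncated differences add up:
    \<open>(N - k) + (k - Suc m) = N - Suc m\<close>, the index that \<open>er\<close> assigns to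
    \<open>PTop m\<close> over \<open>N\<close> globals.\<close>
  then have "\<rho> (e + (k - Suc m)) = d + (N - k) + (k - Suc m)" by (simp only: shifts_def)
  then show ?case using PTop.prems by simp
qed (simp_all, (blast intro: shifts_upr)+)

subsection \<open>Evaluation judgement\<close>

definition evals :: "tm list \<Rightarrow> tm \<Rightarrow> tm \<Rightarrow> tm \<Rightarrow> bool" where
  "evals G t t' T \<longleftrightarrow> G \<turnstile> t \<Colon> T \<and> G \<turnstile> t \<doteq> t' \<Colon> T"

text \<open>Syntactic identity is a case of its own because \<open>normal_type\<close> returns a
  syntactically normal type without establishing that it is a type.\<close>

definition tyeq :: "tm list \<Rightarrow> tm \<Rightarrow> tm \<Rightarrow> bool" where
  "tyeq G A B \<longleftrightarrow> A = B \<or> (\<exists>i. G \<turnstile> A \<doteq> B \<Colon> Univ i)"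

lemma evals_ty: "evals G t t' T \<Longrightarrow> G \<turnstile> t \<Colon> T"
  by (simp add: evals_def)

lemma evals_eq: "evals G t t' T \<Longrightarrow> G \<turnstile> t \<doteq> t' \<Colon> T"
  by (simp add: evals_def)

lemma evals_refl: "G \<turnstile> t \<Colon> T \<Longrightarrow> evals G t t T"
  by (simp add: evals_def eq_refl)

lemma evals_trans: "evals G t u T \<Longrightarrow> G \<turnstile> u \<doteq> v \<Colon> T \<Longrightarrow> evals G t v T"
  by (auto simp: evals_def intro: eq_trans)

lemma tyeq_sym: "tyeq G A B \<Longrightarrow> tyeq G B A"
  by (auto simp: tyeq_def intro: eq_sym)

lemma tyeqI: "G \<turnstile> A \<doteq> B \<Colon> Univ i \<Longrightarrow> tyeq G A B"
  by (auto simp: tyeq_def)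

lemma ty_tyeq: "G \<turnstile> t \<Colon> A \<Longrightarrow> tyeq G A B \<Longrightarrow> G \<turnstile> t \<Colon> B"
  by (auto simp: tyeq_def intro: ty_conv)

lemma eq_tyeq: "G \<turnstile> t \<doteq> u \<Colon> A \<Longrightarrow> tyeq G A B \<Longrightarrow> G \<turnstile> t \<doteq> u \<Colon> B"
  by (auto simp: tyeq_def intro: eq_conv)

lemma evals_tyeq: "evals G t t' A \<Longrightarrow> tyeq G A B \<Longrightarrow> evals G t t' B"
  by (auto simp: evals_def intro: ty_tyeq eq_tyeq)

lemma ty_lift: "G \<turnstile> A \<Colon> Univ i \<Longrightarrow> i \<le> j \<Longrightarrow> G \<turnstile> A \<Colon> Univ j"
  by (induction j rule: nat_induct) (auto simp: le_Suc_eq intro: ty_cumul)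

lemma eq_lift: "G \<turnstile> A \<doteq> B \<Colon> Univ i \<Longrightarrow> i \<le> j \<Longrightarrow> G \<turnstile> A \<doteq> B \<Colon> Univ j"
  by (induction j rule: nat_induct) (auto simp: le_Suc_eq intro: eq_cumul)

lemma evals_lift: "evals G A B (Univ i) \<Longrightarrow> i \<le> j \<Longrightarrow> evals G A B (Univ j)"
  by (auto simp: evals_def intro: ty_lift eq_lift)

lemma wf_evals: "evals G A A' (Univ i) \<Longrightarrow> wf_ctx (A # G)"
  by (auto simp: evals_def intro: wf_cons)

section \<open>Typing, congruence and computation rules for evaluation\<close>

lemma evals_Pi:
  assumes "evals G A A' (Univ i)" "evals (A # G) B B' (Univ j)"
  shows "evals G (Pi A B) (Pi A' B') (Univ (max i j))"
  using evals_lift[OF assms(1), of "max i j"] evals_lift[OF assms(2), of "max i j"]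
  by (auto simp: evals_def intro: ty_Pi eq_Pi)

lemma evals_Sig:
  assumes "evals G A A' (Univ i)" "evals (A # G) B B' (Univ j)"
  shows "evals G (Sig A B) (Sig A' B') (Univ (max i j))"
  using evals_lift[OF assms(1), of "max i j"] evals_lift[OF assms(2), of "max i j"]
  by (auto simp: evals_def intro: ty_Sig eq_Sig)

lemma evals_Plus:
  assumes "evals G A A' (Univ i)" "evals G B B' (Univ j)"
  shows "evals G (Plus A B) (Plus A' B') (Univ (max i j))"
  using evals_lift[OF assms(1), of "max i j"] evals_lift[OF assms(2), of "max i j"]
  by (auto simp: evals_def intro: ty_Plus eq_Plus)

lemma evals_Eq:
  assumes "evals G A A' (Univ i)" "evals G a a' A'" "evals G b b' A'"
  shows "evals G (Eq A a b) (Eq A' a' b') (Univ i)"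
proof -
  have "tyeq G A' A" using assms(1) by (auto simp: evals_def intro: tyeqI eq_sym)
  then show ?thesis
    using assms(1) evals_tyeq[OF assms(2)] evals_tyeq[OF assms(3)]
    by (auto simp: evals_def intro: ty_Eq eq_Eq)
qed

text \<open>Replacing the domain \<open>A\<close> by \<open>A'\<close> in the product type is a
  conversion, which requires \<open>B\<close> to be a type; the typing of \<open>b\<close> does not
  provide this directly, hence the last assumption.\<close>

lemma evals_Lam:
  assumes A: "evals G A A' (Univ i)" and b: "evals (A # G) b b' B"
    and B: "A = A' \<or> (\<exists>k B'. evals (A # G) B B' (Univ k))"
  shows "evals G (Lam A b) (Lam A' b') (Pi A' B)"
proof -
  have "evals G (Lam A b) (Lam A' b') (Pi A B)"
    using A b by (auto simp: evals_def intro: ty_Lam eq_Lam)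
  moreover have "tyeq G (Pi A B) (Pi A' B)"
  proof (cases "A = A'")
    case False
    then obtain k B' where "evals (A # G) B B' (Univ k)" using B by blast
    then have "evals (A # G) B B (Univ k)" by (auto simp: evals_def intro: eq_refl)
    from evals_Pi[OF A this] show ?thesis by (auto simp: evals_def intro: tyeqI)
  qed (simp add: tyeq_def)
  ultimately show ?thesis by (rule evals_tyeq)
qed

lemma evals_eta:
  assumes "evals G t (Lam A (App (wk f) (Var 0))) (Pi A B)" "G \<turnstile> f \<Colon> Pi A B"
  shows "evals G t f (Pi A B)"
  using assms by (auto intro: evals_trans eq_sym eta)

lemma evals_App:
  assumes "evals G f f' (Pi A B)" "evals G a a' A" "tyeq G (inst1 a B) T"
  shows "evals G (App f a) (App f' a') T"
  using assms by (intro evals_tyeq[OF _ assms(3)]) (auto simp: evals_def intro: ty_App eq_App)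

lemma evals_beta:
  assumes f: "evals G f (Lam A b) (Pi A B)" and a: "evals G a a' A" and b: "A # G \<turnstile> b \<Colon> B"
    and T: "tyeq G (inst1 a B) T" and t: "evals G (inst1 a b) t T"
  shows "evals G (App f a) t T"
proof -
  have "evals G (App f a) (App (Lam A b) a) T"
    using f evals_refl[OF evals_ty[OF a]] T by (rule evals_App)
  moreover have "G \<turnstile> App (Lam A b) a \<doteq> inst1 a b \<Colon> T"
    using beta[OF b evals_ty[OF a]] T by (rule eq_tyeq)
  ultimately show ?thesis using evals_eq[OF t] by (blast intro: evals_trans)
qed

lemma evals_Dpair:
  assumes A: "evals G A A' (Univ i)" and B: "evals (A # G) B B' (Univ j)"
    and a: "evals G a a' A'" and T: "tyeq G (inst1 a B) T" and b: "evals G b b' T"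
  shows "evals G (Dpair a b) (Dpair a' b') (Sig A' B')"
proof -
  have "tyeq G A' A" using A by (auto simp: evals_def intro: tyeqI eq_sym)
  then have "evals G a a' A" using a by (rule evals_tyeq[rotated])
  moreover have "evals G b b' (inst1 a B)" using b tyeq_sym[OF T] by (rule evals_tyeq)
  ultimately have "evals G (Dpair a b) (Dpair a' b') (Sig A B)"
    using B by (auto simp: evals_def intro: ty_Dpair eq_Dpair)
  moreover have "tyeq G (Sig A B) (Sig A' B')"
    using evals_Sig[OF A B] by (auto simp: evals_def intro: tyeqI)
  ultimately show ?thesis by (rule evals_tyeq)
qed

lemma evals_Split:
  assumes p: "evals G p p' (Sig A B)" and C: "evals (Sig A B # G) C C' (Univ i)"
    and U: "tyeq (B # A # G) (at2 (Dpair (Var 1) (Var 0)) C) U"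
    and g: "evals (B # A # G) g g' U" and T: "tyeq G (inst1 p C) T"
  shows "evals G (Split C g p) (Split C' g' p') T"
  using p C evals_tyeq[OF g tyeq_sym[OF U]]
  by (intro evals_tyeq[OF _ T]) (auto simp: evals_def intro: ty_Split eq_Split)

text \<open>The evaluation of \<open>p\<close> does not make the components of its value typed, so
  they have their own assumptions. The assumption \<open>T'\<close> stands in for a substitution
  lemma: it makes the motive at \<open>p\<close> and at the pair convertible.\<close>

lemma evals_Split_Dpair:
  assumes p: "evals G p (Dpair a b) (Sig A B)" and C: "evals (Sig A B # G) C C' (Univ i)"
    and U: "tyeq (B # A # G) (at2 (Dpair (Var 1) (Var 0)) C) U"
    and g: "evals (B # A # G) g g' U" and T: "tyeq G (inst1 p C) T"
    and a: "evals G a a' A" and V: "tyeq G (inst1 a B) V" and b: "evals G b b' V"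
    and T': "tyeq G (inst1 (Dpair a b) C) T" and t: "evals G (inst2 a b g) t T"
  shows "evals G (Split C g p) t T"
proof -
  have g': "B # A # G \<turnstile> g \<Colon> at2 (Dpair (Var 1) (Var 0)) C"
    using evals_ty[OF g] tyeq_sym[OF U] by (rule ty_tyeq)
  have "evals G (Split C g p) (Split C g (Dpair a b)) T"
    using p evals_refl[OF evals_ty[OF C]] U evals_refl[OF evals_ty[OF g]] T by (rule evals_Split)
  moreover have "G \<turnstile> Split C g (Dpair a b) \<doteq> inst2 a b g \<Colon> T"
    using Split_Dpair[OF evals_ty[OF C] g' evals_ty[OF a]
        ty_tyeq[OF evals_ty[OF b] tyeq_sym[OF V]]] T' by (rule eq_tyeq)
  ultimately show ?thesis using evals_eq[OF t] by (blast intro: evals_trans)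
qed

lemma evals_Inj1:
  assumes B: "evals G B B' (Univ i)" and a: "evals G a a' A"
    and A: "B = B' \<or> (\<exists>k A'. evals G A A' (Univ k))"
  shows "evals G (Inj1 a) (Inj1 a') (Plus A B')"
proof -
  have "evals G (Inj1 a) (Inj1 a') (Plus A B)"
    using B a by (auto simp: evals_def intro: ty_Inj1 eq_Inj1)
  moreover have "tyeq G (Plus A B) (Plus A B')"
  proof (cases "B = B'")
    case False
    then obtain k A' where "evals G A A' (Univ k)" using A by blast
    then have "evals G A A (Univ k)" by (auto simp: evals_def intro: eq_refl)
    from evals_Plus[OF this B] show ?thesis by (auto simp: evals_def intro: tyeqI)
  qed (simp add: tyeq_def)
  ultimately show ?thesis by (rule evals_tyeq)
qed

lemma evals_Inj2:
  assumes A: "evals G A A' (Univ i)" and b: "evals G b b' B"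
    and B: "A = A' \<or> (\<exists>k B'. evals G B B' (Univ k))"
  shows "evals G (Inj2 b) (Inj2 b') (Plus A' B)"
proof -
  have "evals G (Inj2 b) (Inj2 b') (Plus A B)"
    using A b by (auto simp: evals_def intro: ty_Inj2 eq_Inj2)
  moreover have "tyeq G (Plus A B) (Plus A' B)"
  proof (cases "A = A'")
    case False
    then obtain k B' where "evals G B B' (Univ k)" using B by blast
    then have "evals G B B (Univ k)" by (auto simp: evals_def intro: eq_refl)
    from evals_Plus[OF A this] show ?thesis by (auto simp: evals_def intro: tyeqI)
  qed (simp add: tyeq_def)
  ultimately show ?thesis by (rule evals_tyeq)
qed

lemma evals_CaseSum:
  assumes e: "evals G e e' (Plus A B)" and C: "evals (Plus A B # G) C C' (Univ i)"
    and U: "tyeq (A # G) (at1 (Inj1 (Var 0)) C) U" and c: "evals (A # G) c c' U"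
    and V: "tyeq (B # G) (at1 (Inj2 (Var 0)) C) V" and d: "evals (B # G) d d' V"
    and T: "tyeq G (inst1 e C) T"
  shows "evals G (CaseSum C c d e) (CaseSum C' c' d' e') T"
  using e C evals_tyeq[OF c tyeq_sym[OF U]] evals_tyeq[OF d tyeq_sym[OF V]]
  by (intro evals_tyeq[OF _ T]) (auto simp: evals_def intro: ty_CaseSum eq_CaseSum)

lemma evals_CaseSum_Inj1:
  assumes e: "evals G e (Inj1 a) (Plus A B)" and C: "evals (Plus A B # G) C C' (Univ i)"
    and U: "tyeq (A # G) (at1 (Inj1 (Var 0)) C) U" and c: "evals (A # G) c c' U"
    and V: "tyeq (B # G) (at1 (Inj2 (Var 0)) C) V" and d: "evals (B # G) d d' V"
    and T: "tyeq G (inst1 e C) T" and a: "evals G a a' A"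
    and T': "tyeq G (inst1 (Inj1 a) C) T" and t: "evals G (inst1 a c) t T"
  shows "evals G (CaseSum C c d e) t T"
proof -
  have "evals G (CaseSum C c d e) (CaseSum C c d (Inj1 a)) T"
    using e evals_refl[OF evals_ty[OF C]] U evals_refl[OF evals_ty[OF c]]
      V evals_refl[OF evals_ty[OF d]] T by (rule evals_CaseSum)
  moreover have "G \<turnstile> CaseSum C c d (Inj1 a) \<doteq> inst1 a c \<Colon> T"
    using CaseSum_Inj1[OF evals_ty[OF C] ty_tyeq[OF evals_ty[OF c] tyeq_sym[OF U]]
        ty_tyeq[OF evals_ty[OF d] tyeq_sym[OF V]] evals_ty[OF a]] T' by (rule eq_tyeq)
  ultimately show ?thesis using evals_eq[OF t] by (blast intro: evals_trans)
qed

lemma evals_CaseSum_Inj2: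
  assumes e: "evals G e (Inj2 b) (Plus A B)" and C: "evals (Plus A B # G) C C' (Univ i)"
    and U: "tyeq (A # G) (at1 (Inj1 (Var 0)) C) U" and c: "evals (A # G) c c' U"
    and V: "tyeq (B # G) (at1 (Inj2 (Var 0)) C) V" and d: "evals (B # G) d d' V"
    and T: "tyeq G (inst1 e C) T" and b: "evals G b b' B"
    and T': "tyeq G (inst1 (Inj2 b) C) T" and t: "evals G (inst1 b d) t T"
  shows "evals G (CaseSum C c d e) t T"
proof -
  have "evals G (CaseSum C c d e) (CaseSum C c d (Inj2 b)) T"
    using e evals_refl[OF evals_ty[OF C]] U evals_refl[OF evals_ty[OF c]]
      V evals_refl[OF evals_ty[OF d]] T by (rule evals_CaseSum)
  moreover have "G \<turnstile> CaseSum C c d (Inj2 b) \<doteq> inst1 b d \<Colon> T"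
    using CaseSum_Inj2[OF evals_ty[OF C] ty_tyeq[OF evals_ty[OF c] tyeq_sym[OF U]]
        ty_tyeq[OF evals_ty[OF d] tyeq_sym[OF V]] evals_ty[OF b]] T' by (rule eq_tyeq)
  ultimately show ?thesis using evals_eq[OF t] by (blast intro: evals_trans)
qed

lemma evals_Absurd:
  assumes "evals (Empty # G) C C' (Univ i)" "evals G e e' Empty" "tyeq G (inst1 e C) T"
  shows "evals G (Absurd C e) (Absurd C' e') T"
  using assms(1,2)
  by (intro evals_tyeq[OF _ assms(3)]) (auto simp: evals_def intro: ty_Absurd eq_Absurd)

lemma evals_IndTwo:
  assumes C: "evals (Two # G) C C' (Univ i)"
    and U: "tyeq G (inst1 Two0 C) U" and c: "evals G c c' U"
    and V: "tyeq G (inst1 Two1 C) V" and d: "evals G d d' V"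
    and e: "evals G e e' Two" and T: "tyeq G (inst1 e C) T"
  shows "evals G (IndTwo C c d e) (IndTwo C' c' d' e') T"
  using C e evals_tyeq[OF c tyeq_sym[OF U]] evals_tyeq[OF d tyeq_sym[OF V]]
  by (intro evals_tyeq[OF _ T]) (auto simp: evals_def intro: ty_IndTwo eq_IndTwo)

lemma evals_IndTwo_Two0:
  assumes C: "evals (Two # G) C C' (Univ i)"
    and U: "tyeq G (inst1 Two0 C) T" and c: "evals G c c' T"
    and V: "tyeq G (inst1 Two1 C) V" and d: "evals G d d' V"
    and e: "evals G e Two0 Two" and T: "tyeq G (inst1 e C) T"
  shows "evals G (IndTwo C c d e) c' T"
proof -
  have "evals G (IndTwo C c d e) (IndTwo C c d Two0) T"
    using evals_refl[OF evals_ty[OF C]] U evals_refl[OF evals_ty[OF c]]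
      V evals_refl[OF evals_ty[OF d]] e T by (rule evals_IndTwo)
  moreover have "G \<turnstile> IndTwo C c d Two0 \<doteq> c \<Colon> T"
    using IndTwo_Two0[OF evals_ty[OF C] ty_tyeq[OF evals_ty[OF c] tyeq_sym[OF U]]
        ty_tyeq[OF evals_ty[OF d] tyeq_sym[OF V]]] U by (rule eq_tyeq)
  ultimately show ?thesis using evals_eq[OF c] by (blast intro: evals_trans)
qed

lemma evals_IndTwo_Two1:
  assumes C: "evals (Two # G) C C' (Univ i)"
    and U: "tyeq G (inst1 Two0 C) U" and c: "evals G c c' U"
    and V: "tyeq G (inst1 Two1 C) T" and d: "evals G d d' T"
    and e: "evals G e Two1 Two" and T: "tyeq G (inst1 e C) T"
  shows "evals G (IndTwo C c d e) d' T"
proof -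
  have "evals G (IndTwo C c d e) (IndTwo C c d Two1) T"
    using evals_refl[OF evals_ty[OF C]] U evals_refl[OF evals_ty[OF c]]
      V evals_refl[OF evals_ty[OF d]] e T by (rule evals_IndTwo)
  moreover have "G \<turnstile> IndTwo C c d Two1 \<doteq> d \<Colon> T"
    using IndTwo_Two1[OF evals_ty[OF C] ty_tyeq[OF evals_ty[OF c] tyeq_sym[OF U]]
        ty_tyeq[OF evals_ty[OF d] tyeq_sym[OF V]]] V by (rule eq_tyeq)
  ultimately show ?thesis using evals_eq[OF d] by (blast intro: evals_trans)
qed

lemma evals_IndNat:
  assumes C: "evals (NatT # G) C C' (Univ i)"
    and U: "tyeq G (inst1 Zero C) U" and z: "evals G z z' U"
    and V: "tyeq (C # NatT # G) (at2 (Succ (Var 1)) C) V" and s: "evals (C # NatT # G) s s' V"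
    and n: "evals G n n' NatT" and T: "tyeq G (inst1 n C) T"
  shows "evals G (IndNat C z s n) (IndNat C' z' s' n') T"
  using C n evals_tyeq[OF z tyeq_sym[OF U]] evals_tyeq[OF s tyeq_sym[OF V]]
  by (intro evals_tyeq[OF _ T]) (auto simp: evals_def intro: ty_IndNat eq_IndNat)

lemma evals_IndNat_Zero:
  assumes C: "evals (NatT # G) C C' (Univ i)"
    and U: "tyeq G (inst1 Zero C) T" and z: "evals G z z' T"
    and V: "tyeq (C # NatT # G) (at2 (Succ (Var 1)) C) V" and s: "evals (C # NatT # G) s s' V"
    and n: "evals G n Zero NatT" and T: "tyeq G (inst1 n C) T"
  shows "evals G (IndNat C z s n) z' T"
proof -
  have "evals G (IndNat C z s n) (IndNat C z s Zero) T"
    using evals_refl[OF evals_ty[OF C]] U evals_refl[OF evals_ty[OF z]]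
      V evals_refl[OF evals_ty[OF s]] n T by (rule evals_IndNat)
  moreover have "G \<turnstile> IndNat C z s Zero \<doteq> z \<Colon> T"
    using IndNat_Zero[OF evals_ty[OF C] ty_tyeq[OF evals_ty[OF z] tyeq_sym[OF U]]
        ty_tyeq[OF evals_ty[OF s] tyeq_sym[OF V]]] U by (rule eq_tyeq)
  ultimately show ?thesis using evals_eq[OF z] by (blast intro: evals_trans)
qed

lemma evals_IndNat_Succ:
  assumes C: "evals (NatT # G) C C' (Univ i)"
    and U: "tyeq G (inst1 Zero C) U" and z: "evals G z z' U"
    and V: "tyeq (C # NatT # G) (at2 (Succ (Var 1)) C) V" and s: "evals (C # NatT # G) s s' V"
    and n: "evals G n (Succ m) NatT" and T: "tyeq G (inst1 n C) T"
    and m: "evals G m m' NatT" and T': "tyeq G (inst1 (Succ m) C) T"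
    and t: "evals G (inst2 m (IndNat C z s m) s) t T"
  shows "evals G (IndNat C z s n) t T"
proof -
  have "evals G (IndNat C z s n) (IndNat C z s (Succ m)) T"
    using evals_refl[OF evals_ty[OF C]] U evals_refl[OF evals_ty[OF z]]
      V evals_refl[OF evals_ty[OF s]] n T by (rule evals_IndNat)
  moreover have "G \<turnstile> IndNat C z s (Succ m) \<doteq> inst2 m (IndNat C z s m) s \<Colon> T"
    using IndNat_Succ[OF evals_ty[OF C] ty_tyeq[OF evals_ty[OF z] tyeq_sym[OF U]]
        ty_tyeq[OF evals_ty[OF s] tyeq_sym[OF V]] evals_ty[OF m]] T' by (rule eq_tyeq)
  ultimately show ?thesis using evals_eq[OF t] by (blast intro: evals_trans)
qed

lemma tyeq_Eq:
  assumes "G \<turnstile> A \<Colon> Univ k" "G \<turnstile> a \<doteq> a' \<Colon> A" "G \<turnstile> b \<doteq> b' \<Colon> A"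
  shows "tyeq G (Eq A a b) (Eq A a' b')"
  using assms by (auto intro: tyeqI eq_Eq eq_refl)

lemma evals_Refl:
  assumes a: "evals G a a' A" and A: "a = a' \<or> (\<exists>k A'. evals G A A' (Univ k))"
  shows "evals G (Refl a) (Refl a') (Eq A a' a')"
proof -
  have "evals G (Refl a) (Refl a') (Eq A a a)"
    using a by (auto simp: evals_def intro: ty_Refl eq_Refl)
  moreover have "tyeq G (Eq A a a) (Eq A a' a')"
  proof (cases "a = a'")
    case False
    then obtain k A' where "evals G A A' (Univ k)" using A by blast
    then show ?thesis using a by (auto simp: evals_def intro: tyeq_Eq)
  qed (simp add: tyeq_def)
  ultimately show ?thesis by (rule evals_tyeq)
qed

lemma wf_Eq:
  assumes "wf_ctx (wk A # A # G)" "wk A # A # G \<turnstile> wk (wk A) \<Colon> Univ i"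
  shows "wf_ctx (Eq (wk (wk A)) (Var 1) (Var 0) # wk A # A # G)"
proof -
  have "(\<lambda>k. k + Suc 1) = Suc \<circ> Suc" "(\<lambda>k. k + Suc 0) = Suc" by auto
  then show ?thesis
    using ty_var[OF assms(1), of 0] ty_var[OF assms(1), of 1] assms(2)
    by (auto simp: ren_ren intro: wf_cons ty_Eq)
qed

lemma evals_J:
  assumes p: "evals G p p' (Eq A a' b')" and a: "evals G a a' A" and b: "evals G b b' A"
    and A: "evals G A A' (Univ k)"
    and C: "evals (Eq (wk (wk A)) (Var 1) (Var 0) # wk A # A # G) C C' (Univ i)"
    and U: "tyeq (A # G) (diag C) U" and c: "evals (A # G) c c' U"
    and T: "tyeq G (inst3 a b p C) T"
  shows "evals G (J C c a b p) (J C' c' a' b' p') T"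
proof -
  have "tyeq G (Eq A a' b') (Eq A a b)"
    using a b A by (auto simp: evals_def intro: tyeq_Eq eq_sym)
  then have "evals G p p' (Eq A a b)" using p by (rule evals_tyeq[rotated])
  then show ?thesis
    using C a b evals_tyeq[OF c tyeq_sym[OF U]]
    by (intro evals_tyeq[OF _ T]) (auto simp: evals_def intro: ty_J eq_J)
qed

text \<open>The contraction goes through \<open>a\<close> and \<open>Refl a\<close> instead of the
  normal form \<open>x\<close>, because \<open>a\<close> is known to be typed whereas
  \<open>x\<close> is known only as one side of an equality.\<close>

lemma evals_J_Refl:
  assumes p: "evals G p (Refl x) (Eq A x x)" and a: "evals G a x A" and b: "evals G b x A"
    and A: "evals G A A' (Univ k)"
    and C: "evals (Eq (wk (wk A)) (Var 1) (Var 0) # wk A # A # G) C C' (Univ i)"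
    and U: "tyeq (A # G) (diag C) U" and c: "evals (A # G) c c' U"
    and T: "tyeq G (inst3 a b p C) T" and T': "tyeq G (inst3 a a (Refl a) C) T"
    and t: "evals G (inst1 a c) t T"
  shows "evals G (J C c a b p) t T"
proof -
  have ax: "G \<turnstile> a \<doteq> x \<Colon> A" and bx: "G \<turnstile> b \<doteq> x \<Colon> A" and A': "G \<turnstile> A \<Colon> Univ k"
    using a b A by (auto simp: evals_def)
  have E: "tyeq G (Eq A x x) (Eq A a b)"
    using tyeq_Eq[OF A' eq_sym[OF ax] eq_sym[OF bx]] .
  have "G \<turnstile> Refl a \<doteq> Refl x \<Colon> Eq A x x"
    using eq_Refl[OF ax] tyeq_Eq[OF A' ax ax] by (rule eq_tyeq)
  then have "evals G p (Refl a) (Eq A x x)" using p by (blast intro: evals_trans eq_sym)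
  then have pa: "G \<turnstile> p \<doteq> Refl a \<Colon> Eq A a b" and p': "G \<turnstile> p \<Colon> Eq A a b"
    using evals_tyeq[OF _ E] by (auto simp: evals_def)
  have c': "A # G \<turnstile> c \<Colon> diag C" using evals_ty[OF c] tyeq_sym[OF U] by (rule ty_tyeq)
  have "evals G (J C c a b p) (J C c a a (Refl a)) (inst3 a b p C)"
    unfolding evals_def
    using ty_J[OF evals_ty[OF C] c' evals_ty[OF a] evals_ty[OF b] p']
      eq_J[OF eq_refl[OF evals_ty[OF C]] eq_refl[OF c'] eq_refl[OF evals_ty[OF a]]
        eq_trans[OF bx eq_sym[OF ax]] pa] by simp
  then have "evals G (J C c a b p) (J C c a a (Refl a)) T" using T by (rule evals_tyeq)
  moreover have "G \<turnstile> J C c a a (Refl a) \<doteq> inst1 a c \<Colon> T"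
    using J_Refl[OF evals_ty[OF C] c' evals_ty[OF a]] T' by (rule eq_tyeq)
  ultimately show ?thesis using evals_eq[OF t] by (blast intro: evals_trans)
qed

lemma evals_TrPath:
  assumes a: "evals G a a' (Trunc A)" and b: "evals G b b' (Trunc A)"
    and A: "a = a' \<and> b = b' \<or> (\<exists>k A'. evals G (Trunc A) A' (Univ k))"
  shows "evals G (TrPath a b) (TrPath a' b') (Eq (Trunc A) a' b')"
proof -
  have "evals G (TrPath a b) (TrPath a' b') (Eq (Trunc A) a b)"
    using a b by (auto simp: evals_def intro: ty_TrPath eq_TrPath)
  moreover have "tyeq G (Eq (Trunc A) a b) (Eq (Trunc A) a' b')"
  proof (cases "a = a' \<and> b = b'")
    case False
    then obtain k A' where "evals G (Trunc A) A' (Univ k)" using A by blast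
    then show ?thesis using a b by (auto simp: evals_def intro: tyeq_Eq)
  qed (simp add: tyeq_def)
  ultimately show ?thesis by (rule evals_tyeq)
qed

lemma evals_TrRec:
  assumes P: "evals G P P' (Univ i)" and U: "tyeq G (isProp P) U" and h: "evals G h h' U"
    and a: "evals G a a' (Trunc A)" and V: "tyeq G (arrow A P) V" and g: "evals G g g' V"
  shows "evals G (TrRec P h g a) (TrRec P' h' g' a') P'"
proof -
  have "evals G (TrRec P h g a) (TrRec P' h' g' a') P"
    using P a evals_tyeq[OF h tyeq_sym[OF U]] evals_tyeq[OF g tyeq_sym[OF V]]
    by (auto simp: evals_def intro: ty_TrRec eq_TrRec)
  moreover have "tyeq G P P'" using P by (auto simp: evals_def intro: tyeqI)
  ultimately show ?thesis by (rule evals_tyeq)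
qed

subsection \<open>Soundness\<close>

primrec tops :: "ptm list \<Rightarrow> nat \<Rightarrow> tm list" where
  "tops \<Theta> 0 = []"
| "tops \<Theta> (Suc n) = er n 0 (\<Theta> ! n) # tops \<Theta> n"

primrec ctx :: "ptm list \<Rightarrow> nat \<Rightarrow> ptm list \<Rightarrow> tm list" where
  "ctx \<Theta> N [] = tops \<Theta> N"
| "ctx \<Theta> N (A # \<Gamma>) = er N (length \<Gamma>) A # ctx \<Theta> N \<Gamma>"

lemma length_ctx: "length (ctx \<Theta> N \<Gamma>) = length \<Gamma> + N"
proof -
  have "length (tops \<Theta> N) = N" by (induction N) simp_all
  then show ?thesis by (induction \<Gamma>) simp_all
qed

lemma ctx_top:
  assumes "k < N"
  shows "ctx \<Theta> N \<Gamma> ! (length \<Gamma> + (N - Suc k)) = er k 0 (\<Theta> ! k)"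
proof -
  have "tops \<Theta> N ! (N - Suc k) = er k 0 (\<Theta> ! k)"
    using assms by (induction N) (auto simp: less_Suc_eq Suc_diff_Suc nth_Cons' Suc_diff_le)
  then show ?thesis by (induction \<Gamma>) simp_all
qed

lemma lookup_ctx:
  "lookup \<Gamma> n = Some A \<Longrightarrow> n < length \<Gamma> \<and> ctx \<Theta> N \<Gamma> ! n = er N (length \<Gamma> - Suc n) A"
  by (induction \<Gamma> n rule: lookup.induct) auto

lemma destr_Some [simp]:
  "univ_of S = Some i \<longleftrightarrow> S = PUniv i"
  "pi_of S = Some (A, B) \<longleftrightarrow> S = PPi A B"
  "lam_of S = Some (A, B) \<longleftrightarrow> S = PLam A B"
  "sig_of S = Some (A, B) \<longleftrightarrow> S = PSig A B"
  "plus_of S = Some (A, B) \<longleftrightarrow> S = PPlus A B"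
  "eq_of S = Some (A, a, b) \<longleftrightarrow> S = PEq A a b"
  "refl_of S = Some a \<longleftrightarrow> S = PRefl a"
  "trunc_of S = Some A \<longleftrightarrow> S = PTrunc A"
  "pair_of S = Some (a, b) \<longleftrightarrow> (\<exists>A B. S = PDpair A B a b)"
  "inj_of S = Some (l, a) \<longleftrightarrow> (\<exists>B. l \<and> S = PInj1 B a \<or> \<not> l \<and> S = PInj2 B a)"
  "two_of S = Some b' \<longleftrightarrow> b' \<and> S = PTwo1 \<or> \<not> b' \<and> S = PTwo0"
  "nat_of S = Some m \<longleftrightarrow> S = (case m of None \<Rightarrow> PZero | Some n \<Rightarrow> PSucc n)"
  by (cases S; auto split: option.split)+

lemma eta_contract_Some:
  "eta_contract b = Some f \<Longrightarrow> b = PApp (pwk f) (PVar 0)"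
  by (cases b rule: eta_contract.cases)
     (auto split: if_splits elim: var0.elims)

text \<open>The induction hypothesis on the fuel, packaged so that \<open>step_sound\<close> can
  treat the recursive calls as an arbitrary sound judge.\<close>

locale sound_judge =
  fixes \<Theta> :: "ptm list" and N :: nat and F :: judge
  assumes scoped: "\<And>k. k < N \<Longrightarrow> scoped 0 k (\<Theta> ! k)"
    and F: "\<And>\<Gamma> t t' T. F \<Gamma> t = Some (t', T) \<Longrightarrow> wf_ctx (ctx \<Theta> N \<Gamma>) \<Longrightarrow>
      evals (ctx \<Theta> N \<Gamma>) (er N (length \<Gamma>) t) (er N (length \<Gamma>) t') (er N (length \<Gamma>) T)"
begin

lemma infer_type:
  "infer_type F \<Gamma> A = Some (A', i) \<Longrightarrow> wf_ctx (ctx \<Theta> N \<Gamma>) \<Longrightarrow>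
    evals (ctx \<Theta> N \<Gamma>) (er N (length \<Gamma>) A) (er N (length \<Gamma>) A') (Univ i)"
  by (auto simp: infer_type_def bind_eq_Some_conv dest: F)

lemma check_type:
  assumes "check_type F \<Gamma> T t = Some t'" "wf_ctx (ctx \<Theta> N \<Gamma>)"
  shows "evals (ctx \<Theta> N \<Gamma>) (er N (length \<Gamma>) t) (er N (length \<Gamma>) t') (er N (length \<Gamma>) T)"
proof -
  obtain T' where T': "F \<Gamma> t = Some (t', T')" "cumul T' T"
    using assms(1) by (auto simp: check_type_def bind_eq_Some_conv split: if_splits)
  show ?thesis
    using F[OF T'(1) assms(2)] T'(2) by (cases "(T', T)" rule: cumul.cases) (auto intro: evals_lift)
qed

lemma normal_type:
  "normal_type F \<Gamma> A = Some A' \<Longrightarrow> wf_ctx (ctx \<Theta> N \<Gamma>) \<Longrightarrow>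
    tyeq (ctx \<Theta> N \<Gamma>) (er N (length \<Gamma>) A) (er N (length \<Gamma>) A')"
  by (auto simp: normal_type_def bind_eq_Some_conv tyeq_def evals_def split: if_splits
      dest: infer_type)

lemma unchanged:
  "unchanged t t' (infer_type F \<Gamma> A) = Some u \<Longrightarrow> wf_ctx (ctx \<Theta> N \<Gamma>) \<Longrightarrow>
    t = t' \<or> (\<exists>k A'. evals (ctx \<Theta> N \<Gamma>) (er N (length \<Gamma>) A) A' (Univ k))"
  by (auto simp: unchanged_def same_def bind_eq_Some_conv split: if_splits dest: infer_type)

lemma wf_infer_type:
  "infer_type F \<Gamma> A = Some (A', i) \<Longrightarrow> wf_ctx (ctx \<Theta> N \<Gamma>) \<Longrightarrow> wf_ctx (ctx \<Theta> N (A # \<Gamma>))"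
  by (auto dest: infer_type intro: wf_evals)

lemma step_sound:
  assumes step: "step \<Theta> N F \<Gamma> t = Some (t', T)" and wf: "wf_ctx (ctx \<Theta> N \<Gamma>)"
  shows "evals (ctx \<Theta> N \<Gamma>) (er N (length \<Gamma>) t) (er N (length \<Gamma>) t') (er N (length \<Gamma>) T)"
    (is "evals ?G (?e t) (?e t') (?e T)")
proof (cases t)
  case (PVar n)
  obtain A where A: "lookup \<Gamma> n = Some A" "t' = PVar n"
    "normal_type F \<Gamma> (pren (\<lambda>k. k + Suc n) A) = Some T"
    using step by (auto simp: PVar bind_eq_Some_conv)
  have n: "n < length \<Gamma>" "?G ! n = er N (length \<Gamma> - Suc n) A"
    using lookup_ctx[OF A(1)] by auto
  have "?G \<turnstile> Var n \<Colon> ren (\<lambda>k. k + Suc n) (?G ! n)"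
    using wf n by (intro ty_var) (simp_all add: length_ctx)
  also have "ren (\<lambda>k. k + Suc n) (?G ! n) = ?e (pren (\<lambda>k. k + Suc n) A)"
    unfolding n(2) by (rule er_pren[symmetric]) (use n(1) in simp)
  finally show ?thesis
    using A normal_type[OF A(3) wf] by (auto simp: PVar intro: evals_tyeq evals_refl)
next
  case (PTop k)
  have k: "k < N" "t' = PTop k" "normal_type F \<Gamma> (\<Theta> ! k) = Some T"
    using step by (auto simp: PTop bind_eq_Some_conv split: if_splits)
  define n where "n = length \<Gamma> + (N - Suc k)"
  have "?G \<turnstile> Var n \<Colon> ren (\<lambda>m. m + Suc n) (?G ! n)"
    using wf k by (intro ty_var) (simp_all add: length_ctx n_def)
  also have "?G ! n = er k 0 (\<Theta> ! k)"
    unfolding n_def using k(1) by (rule ctx_top)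
  \<comment> \<open>The type of a global is closed over its \<open>k\<close> predecessors, so its
    erasure can be moved below the later globals and all local binders.\<close>
  also have "ren (\<lambda>m. m + Suc n) (er k 0 (\<Theta> ! k)) = ?e (\<Theta> ! k)"
    using k scoped[OF k(1)] by (intro ren_er_scoped) (auto simp: n_def shifts_def)
  finally show ?thesis
    using k normal_type[OF k(3) wf] by (auto simp: PTop n_def intro: evals_tyeq evals_refl)
next
  case (PUniv i)
  then show ?thesis using step wf by (auto intro!: evals_refl ty_Univ)
next
  case (PPi A B)
  obtain A' i B' j where 1: "infer_type F \<Gamma> A = Some (A', i)"
    "infer_type F (A # \<Gamma>) B = Some (B', j)" and t': "t' = PPi A' B'" "T = PUniv (max i j)"
    using step by (auto simp: PPi bind_eq_Some_conv)
  show ?thesis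
    using evals_Pi[OF infer_type[OF 1(1) wf]]
      infer_type[OF 1(2) wf_infer_type[OF 1(1) wf]] by (simp add: PPi t')
next
  case (PSig A B)
  obtain A' i B' j where 1: "infer_type F \<Gamma> A = Some (A', i)"
    "infer_type F (A # \<Gamma>) B = Some (B', j)" and t': "t' = PSig A' B'" "T = PUniv (max i j)"
    using step by (auto simp: PSig bind_eq_Some_conv)
  show ?thesis
    using evals_Sig[OF infer_type[OF 1(1) wf]]
      infer_type[OF 1(2) wf_infer_type[OF 1(1) wf]] by (simp add: PSig t')
next
  case (PLam A b)
  obtain A' i b' B u where 1: "infer_type F \<Gamma> A = Some (A', i)" "F (A # \<Gamma>) b = Some (b', B)"
    "unchanged A A' (infer_type F (A # \<Gamma>) B) = Some u"
    and c: "(case eta_contract b' of None \<Rightarrow> Some (PLam A' b', PPi A' B)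
      | Some f \<Rightarrow> do { _ \<leftarrow> check_type F \<Gamma> (PPi A' B) f; Some (f, PPi A' B) }) = Some (t', T)"
    using step by (auto simp: PLam bind_eq_Some_conv)
  have T: "T = PPi A' B" and t': "eta_contract b' = None \<and> t' = PLam A' b' \<or>
      eta_contract b' = Some t' \<and> check_type F \<Gamma> (PPi A' B) t' \<noteq> None"
    using c by (cases "eta_contract b'"; auto simp: bind_eq_Some_conv)+
  note wf' = wf_infer_type[OF 1(1) wf]
  have *: "evals ?G (?e t) (Lam (?e A') (er N (Suc (length \<Gamma>)) b')) (?e T)"
    using infer_type[OF 1(1) wf] F[OF 1(2) wf'] unchanged[OF 1(3) wf']
    by (auto simp: PLam T intro!: evals_Lam)
  from t' show ?thesis
  proof (elim disjE conjE)
    assume "t' = PLam A' b'"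
    then show ?thesis using * by simp
  next
    assume f: "eta_contract b' = Some t'" "check_type F \<Gamma> (PPi A' B) t' \<noteq> None"
    \<comment> \<open>That \<open>t'\<close> is typed cannot be read off from the typing of its
      weakening, as this would be strengthening; it comes from the repeated check.\<close>
    then obtain f' where "check_type F \<Gamma> (PPi A' B) t' = Some f'" by auto
    from evals_ty[OF check_type[OF this wf]] show ?thesis
      using * eta_contract_Some[OF f(1)] by (auto simp: T intro: evals_eta)
  qed
next
  case (PApp f a)
  obtain f' A B a' where 1: "F \<Gamma> f = Some (f', PPi A B)" "check_type F \<Gamma> A a = Some a'"
    "normal_type F \<Gamma> (pinst1 a B) = Some T"
    and t': "if intro_form f' then \<exists>b i A' b'. f' = PLam A b \<and> infer_type F \<Gamma> A = Some (A', i) \<and>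
      check_type F (A # \<Gamma>) B b = Some b' \<and> check_type F \<Gamma> T (pinst1 a b) = Some t'
      else t' = PApp f' a'"
    using step by (auto simp: PApp bind_eq_Some_conv same_def split: if_splits)
  note 2 = F[OF 1(1) wf] check_type[OF 1(2) wf] normal_type[OF 1(3) wf]
  show ?thesis
  proof (cases "intro_form f'")
    case True
    then obtain b i A' b' where b: "f' = PLam A b" "infer_type F \<Gamma> A = Some (A', i)"
      "check_type F (A # \<Gamma>) B b = Some b'" "check_type F \<Gamma> T (pinst1 a b) = Some t'"
      using t' by auto
    show ?thesis
      using 2 b(1) evals_ty[OF check_type[OF b(3) wf_infer_type[OF b(2) wf]]]
        check_type[OF b(4) wf]
      by (auto simp: PApp er_inst intro: evals_beta)
  next
    case False
    then show ?thesis using t' 2 by (auto simp: PApp er_inst intro: evals_App)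
  qed
next
  case (PDpair A B a b)
  obtain A' i B' j a' V b' where 1: "infer_type F \<Gamma> A = Some (A', i)"
    "infer_type F (A # \<Gamma>) B = Some (B', j)" "check_type F \<Gamma> A' a = Some a'"
    "normal_type F \<Gamma> (pinst1 a B) = Some V" "check_type F \<Gamma> V b = Some b'"
    and t': "t' = PDpair A' B' a' b'" "T = PSig A' B'"
    using step by (auto simp: PDpair bind_eq_Some_conv)
  show ?thesis
    using infer_type[OF 1(1) wf] infer_type[OF 1(2) wf_infer_type[OF 1(1) wf]]
      check_type[OF 1(3) wf] normal_type[OF 1(4) wf] check_type[OF 1(5) wf]
    by (auto simp: PDpair t' er_inst intro: evals_Dpair)
next
  case (PSplit C g p)
  obtain p' A B A' i B' j C' k U g' where 1: "F \<Gamma> p = Some (p', PSig A B)"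
    "infer_type F \<Gamma> A = Some (A', i)" "infer_type F (A # \<Gamma>) B = Some (B', j)"
    "infer_type F (PSig A B # \<Gamma>) C = Some (C', k)"
    "normal_type F (B # A # \<Gamma>) (pat2 (PDpair (pren (\<lambda>n. Suc (Suc n)) A)
       (pren (upr (\<lambda>n. Suc (Suc n))) B) (PVar (Suc 0)) (PVar 0)) C) = Some U"
    "check_type F (B # A # \<Gamma>) U g = Some g'" "normal_type F \<Gamma> (pinst1 p C) = Some T"
    and t': "if intro_form p' then \<exists>A' B' a b a' V b'. p' = PDpair A' B' a b \<and>
        check_type F \<Gamma> A a = Some a' \<and> normal_type F \<Gamma> (pinst1 a B) = Some V \<and>
        check_type F \<Gamma> V b = Some b' \<and> normal_type F \<Gamma> (pinst1 p' C) = Some T \<and>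
        check_type F \<Gamma> T (pinst2 a b g) = Some t'
      else t' = PSplit C' g' p'"
    using step by (auto simp: PSplit bind_eq_Some_conv same_def split: if_splits)
  note wfA = wf_infer_type[OF 1(2) wf]
  note wfB = wf_infer_type[OF 1(3) wfA]
  \<comment> \<open>An inferred type need not come with a derivation that it is a type. The two
    components are checked separately so that the context of the motive is well formed.\<close>
  have wfS: "wf_ctx (ctx \<Theta> N (PSig A B # \<Gamma>))"
    using evals_Sig[OF infer_type[OF 1(2) wf] infer_type[OF 1(3) wfA, simplified]]
    by (auto intro: wf_evals)
  note 2 = F[OF 1(1) wf] infer_type[OF 1(4) wfS] normal_type[OF 1(5) wfB]
    check_type[OF 1(6) wfB] normal_type[OF 1(7) wf]
  show ?thesis
  proof (cases "intro_form p'")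
    case True
    then obtain A' B' a b a' V b' where 3: "p' = PDpair A' B' a b"
      "check_type F \<Gamma> A a = Some a'" "normal_type F \<Gamma> (pinst1 a B) = Some V"
      "check_type F \<Gamma> V b = Some b'" "normal_type F \<Gamma> (pinst1 p' C) = Some T"
      "check_type F \<Gamma> T (pinst2 a b g) = Some t'"
      using t' by auto
    show ?thesis
      using 2 3(1) check_type[OF 3(2) wf] normal_type[OF 3(3) wf] check_type[OF 3(4) wf]
        normal_type[OF 3(5) wf] check_type[OF 3(6) wf]
      by (auto simp: PSplit er_inst intro: evals_Split_Dpair)
  next
    case False
    then show ?thesis using t' 2 by (auto simp: PSplit er_inst intro: evals_Split)
  qed
next
  case (PPlus A B)
  then show ?thesis using step wf
    by (auto simp: bind_eq_Some_conv dest!: infer_type intro!: evals_Plus)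
next
  case (PInj1 B a)
  obtain B' i a' A u where 1: "infer_type F \<Gamma> B = Some (B', i)" "F \<Gamma> a = Some (a', A)"
    "unchanged B B' (infer_type F \<Gamma> A) = Some u" and t': "t' = PInj1 B' a'" "T = PPlus A B'"
    using step by (auto simp: PInj1 bind_eq_Some_conv)
  show ?thesis
    using infer_type[OF 1(1) wf] F[OF 1(2) wf] unchanged[OF 1(3) wf]
    by (auto simp: PInj1 t' intro: evals_Inj1)
next
  case (PInj2 A b)
  obtain A' i b' B u where 1: "infer_type F \<Gamma> A = Some (A', i)" "F \<Gamma> b = Some (b', B)"
    "unchanged A A' (infer_type F \<Gamma> B) = Some u" and t': "t' = PInj2 A' b'" "T = PPlus A' B"
    using step by (auto simp: PInj2 bind_eq_Some_conv)
  show ?thesis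
    using infer_type[OF 1(1) wf] F[OF 1(2) wf] unchanged[OF 1(3) wf]
    by (auto simp: PInj2 t' intro: evals_Inj2)
next
  case (PCase C c d e)
  obtain e' A B A' i B' j C' k U c' V d' where 1: "F \<Gamma> e = Some (e', PPlus A B)"
    "infer_type F \<Gamma> A = Some (A', i)" "infer_type F \<Gamma> B = Some (B', j)"
    "infer_type F (PPlus A B # \<Gamma>) C = Some (C', k)"
    "normal_type F (A # \<Gamma>) (pat1 (PInj1 (pwk B) (PVar 0)) C) = Some U"
    "check_type F (A # \<Gamma>) U c = Some c'"
    "normal_type F (B # \<Gamma>) (pat1 (PInj2 (pwk A) (PVar 0)) C) = Some V"
    "check_type F (B # \<Gamma>) V d = Some d'" "normal_type F \<Gamma> (pinst1 e C) = Some T"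
    and t': "\<not> intro_form e' \<and> t' = PCase C' c' d' e' \<or> normal_type F \<Gamma> (pinst1 e' C) = Some T \<and>
        ((\<exists>B' a a'. e' = PInj1 B' a \<and> check_type F \<Gamma> A a = Some a' \<and>
          check_type F \<Gamma> T (pinst1 a c) = Some t') \<or>
        (\<exists>A' b b'. e' = PInj2 A' b \<and> check_type F \<Gamma> B b = Some b' \<and>
          check_type F \<Gamma> T (pinst1 b d) = Some t'))"
    using step by (auto simp: PCase bind_eq_Some_conv same_def split: if_splits)
  note wfA = wf_infer_type[OF 1(2) wf]
  note wfB = wf_infer_type[OF 1(3) wf]
  have wfS: "wf_ctx (ctx \<Theta> N (PPlus A B # \<Gamma>))"
    using evals_Plus[OF infer_type[OF 1(2) wf] infer_type[OF 1(3) wf]]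
    by (auto intro: wf_evals)
  note 2 = F[OF 1(1) wf] infer_type[OF 1(4) wfS] normal_type[OF 1(5) wfA]
    check_type[OF 1(6) wfA] normal_type[OF 1(7) wfB] check_type[OF 1(8) wfB]
    normal_type[OF 1(9) wf]
  from t' show ?thesis
  proof (elim disjE conjE exE)
    assume "t' = PCase C' c' d' e'"
    then show ?thesis using 2 by (auto simp: PCase er_inst intro: evals_CaseSum)
  next
    fix B' a a'
    assume 3: "e' = PInj1 B' a" "check_type F \<Gamma> A a = Some a'"
      "check_type F \<Gamma> T (pinst1 a c) = Some t'" "normal_type F \<Gamma> (pinst1 e' C) = Some T"
    show ?thesis
      using 2 3(1) check_type[OF 3(2) wf] check_type[OF 3(3) wf] normal_type[OF 3(4) wf]
      by (auto simp: PCase er_inst intro: evals_CaseSum_Inj1)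
  next
    fix A' b b'
    assume 3: "e' = PInj2 A' b" "check_type F \<Gamma> B b = Some b'"
      "check_type F \<Gamma> T (pinst1 b d) = Some t'" "normal_type F \<Gamma> (pinst1 e' C) = Some T"
    show ?thesis
      using 2 3(1) check_type[OF 3(2) wf] check_type[OF 3(3) wf] normal_type[OF 3(4) wf]
      by (auto simp: PCase er_inst intro: evals_CaseSum_Inj2)
  qed
next
  case PEmpty
  then show ?thesis using step wf by (auto intro!: evals_refl ty_Empty)
next
  case (PAbsurd C e)
  obtain C' i e' where 1: "infer_type F (PEmpty # \<Gamma>) C = Some (C', i)"
    "check_type F \<Gamma> PEmpty e = Some e'" "normal_type F \<Gamma> (pinst1 e C) = Some T"
    and t': "t' = PAbsurd C' e'"
    using step by (auto simp: PAbsurd bind_eq_Some_conv)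
  have "wf_ctx (ctx \<Theta> N (PEmpty # \<Gamma>))" using wf by (auto intro: wf_cons ty_Empty)
  then show ?thesis
    using infer_type[OF 1(1)] check_type[OF 1(2) wf] normal_type[OF 1(3) wf]
    by (auto simp: PAbsurd t' er_inst intro: evals_Absurd)
next
  case PTwo
  then show ?thesis using step wf by (auto intro!: evals_refl ty_Two)
next
  case PTwo0
  then show ?thesis using step wf by (auto intro!: evals_refl ty_Two0)
next
  case PTwo1
  then show ?thesis using step wf by (auto intro!: evals_refl ty_Two1)
next
  case (PIndTwo C c d e)
  obtain C' i U c' V d' e' where 1: "infer_type F (PTwo # \<Gamma>) C = Some (C', i)"
    "normal_type F \<Gamma> (pinst1 PTwo0 C) = Some U" "check_type F \<Gamma> U c = Some c'"
    "normal_type F \<Gamma> (pinst1 PTwo1 C) = Some V" "check_type F \<Gamma> V d = Some d'"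
    "check_type F \<Gamma> PTwo e = Some e'" "normal_type F \<Gamma> (pinst1 e C) = Some T"
    and t': "if intro_form e' then e' = PTwo0 \<and> U = T \<and> t' = c' \<or> e' = PTwo1 \<and> V = T \<and> t' = d'
      else t' = PIndTwo C' c' d' e'"
    using step by (auto simp: PIndTwo bind_eq_Some_conv same_def split: if_splits)
  have wf2: "wf_ctx (ctx \<Theta> N (PTwo # \<Gamma>))" using wf by (auto intro: wf_cons ty_Two)
  note 2 = infer_type[OF 1(1) wf2] normal_type[OF 1(2) wf] check_type[OF 1(3) wf]
    normal_type[OF 1(4) wf] check_type[OF 1(5) wf] check_type[OF 1(6) wf] normal_type[OF 1(7) wf]
  show ?thesis
    using 2 t' by (auto simp: PIndTwo er_inst split: if_splits
        intro: evals_IndTwo evals_IndTwo_Two0 evals_IndTwo_Two1)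
next
  case PNat
  then show ?thesis using step wf by (auto intro!: evals_refl ty_NatT)
next
  case PZero
  then show ?thesis using step wf by (auto intro!: evals_refl ty_Zero)
next
  case (PSucc n)
  then show ?thesis using step wf
    by (auto simp: bind_eq_Some_conv evals_def dest!: check_type intro: ty_Succ eq_Succ)
next
  case (PIndNat C z s n)
  obtain C' i U z' V s' n' where 1: "infer_type F (PNat # \<Gamma>) C = Some (C', i)"
    "normal_type F \<Gamma> (pinst1 PZero C) = Some U" "check_type F \<Gamma> U z = Some z'"
    "normal_type F (C # PNat # \<Gamma>) (pat2 (PSucc (PVar (Suc 0))) C) = Some V"
    "check_type F (C # PNat # \<Gamma>) V s = Some s'"
    "check_type F \<Gamma> PNat n = Some n'" "normal_type F \<Gamma> (pinst1 n C) = Some T"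
    and t': "if intro_form n' then n' = PZero \<and> U = T \<and> t' = z' \<or>
        (\<exists>m m'. n' = PSucc m \<and> check_type F \<Gamma> PNat m = Some m' \<and>
          normal_type F \<Gamma> (pinst1 n' C) = Some T \<and>
          check_type F \<Gamma> T (pinst2 m (PIndNat C z s m) s) = Some t')
      else t' = PIndNat C' z' s' n'"
    using step by (auto simp: PIndNat bind_eq_Some_conv same_def split: if_splits option.splits)
  have wfN: "wf_ctx (ctx \<Theta> N (PNat # \<Gamma>))" using wf by (auto intro: wf_cons ty_NatT)
  note wfC = wf_infer_type[OF 1(1) wfN]
  note ev = infer_type[OF 1(1) wfN] normal_type[OF 1(2) wf] check_type[OF 1(3) wf]
    normal_type[OF 1(4) wfC] check_type[OF 1(5) wfC] check_type[OF 1(6) wf] normal_type[OF 1(7) wf]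
  consider "\<not> intro_form n'" "t' = PIndNat C' z' s' n'" | "n' = PZero" "U = T" "t' = z'"
    | m m' where "n' = PSucc m" "check_type F \<Gamma> PNat m = Some m'"
        "normal_type F \<Gamma> (pinst1 n' C) = Some T"
        "check_type F \<Gamma> T (pinst2 m (PIndNat C z s m) s) = Some t'"
    using t' by (auto split: if_splits)
  then show ?thesis
  proof cases
    case 1
    then show ?thesis using ev by (auto simp: PIndNat er_inst intro: evals_IndNat)
  next
    case 2
    then show ?thesis using ev by (auto simp: PIndNat er_inst intro: evals_IndNat_Zero)
  next
    case (3 m m')
    then show ?thesis using ev check_type[OF 3(2) wf] normal_type[OF 3(3) wf] check_type[OF 3(4) wf]
      by (auto simp: PIndNat er_inst intro: evals_IndNat_Succ)
  qed
next
  case (PEq A a b)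
  then show ?thesis using step wf
    by (auto simp: bind_eq_Some_conv dest!: infer_type check_type intro!: evals_Eq)
next
  case (PRefl a)
  obtain a' A u where 1: "F \<Gamma> a = Some (a', A)"
    "unchanged a a' (infer_type F \<Gamma> A) = Some u" and t': "t' = PRefl a'" "T = PEq A a' a'"
    using step by (auto simp: PRefl bind_eq_Some_conv)
  show ?thesis
    using F[OF 1(1) wf] unchanged[OF 1(2) wf] by (auto simp: PRefl t' intro: evals_Refl)
next
  case (PJ C c a b p)
  obtain p' A x y A' i A1 j A2 l C' k U c' where 1: "F \<Gamma> p = Some (p', PEq A x y)"
    "check_type F \<Gamma> A a = Some x" "check_type F \<Gamma> A b = Some y"
    "infer_type F \<Gamma> A = Some (A', i)" "infer_type F (A # \<Gamma>) (pwk A) = Some (A1, j)"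
    "infer_type F (pwk A # A # \<Gamma>) (pwk (pwk A)) = Some (A2, l)"
    "infer_type F (PEq (pwk (pwk A)) (PVar (Suc 0)) (PVar 0) # pwk A # A # \<Gamma>) C = Some (C', k)"
    "normal_type F (A # \<Gamma>) (pdiag C) = Some U" "check_type F (A # \<Gamma>) U c = Some c'"
    "normal_type F \<Gamma> (pinst3 a b p C) = Some T"
    and t': "if intro_form p' then p' = PRefl x \<and> y = x \<and>
        normal_type F \<Gamma> (pinst3 a a (PRefl a) C) = Some T \<and>
        check_type F \<Gamma> T (pinst1 a c) = Some t'
      else t' = PJ C' c' x y p'"
    using step by (auto simp: PJ bind_eq_Some_conv same_def split: if_splits)
  note wfA = wf_infer_type[OF 1(4) wf]
  note wfAA = wf_infer_type[OF 1(5) wfA]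
  have "wf_ctx (Eq (wk (wk (?e A))) (Var 1) (Var 0) # wk (?e A) # ?e A # ?G)"
    using evals_ty[OF infer_type[OF 1(6) wfAA]] wfAA by (intro wf_Eq) simp_all
  then have wfE: "wf_ctx (ctx \<Theta> N (PEq (pwk (pwk A)) (PVar (Suc 0)) (PVar 0) # pwk A # A # \<Gamma>))"
    by simp
  note 2 = F[OF 1(1) wf] check_type[OF 1(2) wf] check_type[OF 1(3) wf] infer_type[OF 1(4) wf]
    infer_type[OF 1(7) wfE] normal_type[OF 1(8) wfA] check_type[OF 1(9) wfA] normal_type[OF 1(10) wf]
  show ?thesis
  proof (cases "intro_form p'")
    case True
    then have 3: "p' = PRefl x" "y = x" "normal_type F \<Gamma> (pinst3 a a (PRefl a) C) = Some T"
      "check_type F \<Gamma> T (pinst1 a c) = Some t'"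
      using t' by auto
    show ?thesis
      using 2 3(1,2) normal_type[OF 3(3) wf] check_type[OF 3(4) wf]
      by (auto simp: PJ er_inst intro: evals_J_Refl)
  next
    case False
    then show ?thesis using t' 2 by (auto simp: PJ er_inst intro: evals_J)
  qed
next
  case (PTrunc A)
  then show ?thesis using step wf
    by (auto simp: bind_eq_Some_conv evals_def dest!: infer_type intro: ty_Trunc eq_Trunc)
next
  case (PTr a)
  then show ?thesis using step wf
    by (auto simp: bind_eq_Some_conv evals_def dest!: F intro: ty_Tr eq_Tr)
next
  case (PTrPath a b)
  obtain a' A b' u v where 1: "F \<Gamma> a = Some (a', PTrunc A)"
    "check_type F \<Gamma> (PTrunc A) b = Some b'"
    "unchanged a a' (infer_type F \<Gamma> (PTrunc A)) = Some u"
    "unchanged b b' (infer_type F \<Gamma> (PTrunc A)) = Some v"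
    and t': "t' = PTrPath a' b'" "T = PEq (PTrunc A) a' b'"
    using step by (auto simp: PTrPath bind_eq_Some_conv)
  show ?thesis
    using F[OF 1(1) wf] check_type[OF 1(2) wf] unchanged[OF 1(3) wf] unchanged[OF 1(4) wf]
    by (auto simp: PTrPath t' intro!: evals_TrPath)
next
  case (PTrRec P h g a)
  obtain P' i U h' a' A V g' where 1: "infer_type F \<Gamma> P = Some (P', i)"
    "normal_type F \<Gamma> (PPi P (PPi (pwk P) (PEq (pwk (pwk P)) (PVar (Suc 0)) (PVar 0)))) = Some U"
    "check_type F \<Gamma> U h = Some h'" "F \<Gamma> a = Some (a', PTrunc A)"
    "normal_type F \<Gamma> (PPi A (pwk P)) = Some V" "check_type F \<Gamma> V g = Some g'"
    and t': "t' = PTrRec P' h' g' a'" "T = P'"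
    using step by (auto simp: PTrRec bind_eq_Some_conv)
  show ?thesis
    using infer_type[OF 1(1) wf] normal_type[OF 1(2) wf] check_type[OF 1(3) wf] F[OF 1(4) wf]
      normal_type[OF 1(5) wf] check_type[OF 1(6) wf]
    by (auto simp: PTrRec t' isProp_def arrow_def intro: evals_TrRec)
qed

end

lemma nf_sound:
  assumes "\<And>k. k < N \<Longrightarrow> scoped 0 k (\<Theta> ! k)"
  shows "sound_judge \<Theta> N (nf n \<Theta> N)"
proof (induction n)
  case 0
  show ?case by unfold_locales (use assms in simp_all)
next
  case (Suc n)
  then interpret sound_judge \<Theta> N "nf n \<Theta> N" .
  show ?case by unfold_locales (use assms step_sound in simp_all)
qed


subsection \<open>Global assumptions and lemmas\<close>

definition valid :: "ptm list \<Rightarrow> nat \<Rightarrow> bool" where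
  "valid \<Theta> N \<longleftrightarrow> (\<forall>k<N. scoped 0 k (\<Theta> ! k)) \<and> wf_ctx (tops \<Theta> N)"

definition derivable :: "ptm list \<Rightarrow> nat \<Rightarrow> ptm \<Rightarrow> bool" where
  "derivable \<Theta> N T \<longleftrightarrow> (\<exists>t. tops \<Theta> N \<turnstile> t \<Colon> er N 0 T)"

definition conservative :: "ptm list \<Rightarrow> nat \<Rightarrow> nat \<Rightarrow> bool" where
  "conservative \<Theta> M N \<longleftrightarrow> M \<le> N \<and> valid \<Theta> N \<and>
     (\<forall>T. scoped 0 M T \<longrightarrow> derivable \<Theta> N T \<longrightarrow> derivable \<Theta> M T)"

lemma valid_0: "valid \<Theta> 0"
  by (simp add: valid_def wf_nil)

lemma extends_type:
  assumes "valid \<Theta> N" "extends \<Theta> N"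
  shows "\<exists>i. tops \<Theta> N \<turnstile> er N 0 (\<Theta> ! N) \<Colon> Univ i"
proof -
  interpret sound_judge \<Theta> N "judgement \<Theta> N"
    by (rule nf_sound) (use assms(1) in \<open>simp add: valid_def\<close>)
  obtain T i where "infer_type (judgement \<Theta> N) [] (\<Theta> ! N) = Some (T, i)"
    using assms(2) by (auto simp: extends_def)
  from infer_type[OF this] assms(1) show ?thesis by (auto simp: valid_def evals_def)
qed

lemma valid_Suc: "valid \<Theta> N \<Longrightarrow> extends \<Theta> N \<Longrightarrow> valid \<Theta> (Suc N)"
  using extends_type[of \<Theta> N] by (auto simp: valid_def extends_def less_Suc_eq intro: wf_cons)

lemma checks_extends: "checks \<Theta> N t \<Longrightarrow> extends \<Theta> N"
  by (auto simp: checks_def extends_def bind_eq_None_conv)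

lemma checks_derivable:
  assumes "valid \<Theta> N" "checks \<Theta> N t"
  shows "derivable \<Theta> N (\<Theta> ! N)"
proof -
  interpret sound_judge \<Theta> N "judgement \<Theta> N"
    by (rule nf_sound) (use assms(1) in \<open>simp add: valid_def\<close>)
  obtain T i t' where 1: "infer_type (judgement \<Theta> N) [] (\<Theta> ! N) = Some (T, i)"
    "check_type (judgement \<Theta> N) [] T t = Some t'"
    using assms(2) by (auto simp: checks_def bind_eq_Some_conv)
  have wf: "wf_ctx (ctx \<Theta> N [])" using assms(1) by (simp add: valid_def)
  have "tops \<Theta> N \<turnstile> er N 0 t \<Colon> er N 0 T" "tops \<Theta> N \<turnstile> er N 0 T \<doteq> er N 0 (\<Theta> ! N) \<Colon> Univ i"
    using infer_type[OF 1(1) wf] check_type[OF 1(2) wf] by (auto simp: evals_def intro: eq_sym)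
  then show ?thesis by (auto simp: derivable_def intro: ty_conv)
qed

lemma scoped_mono: "scoped d M t \<Longrightarrow> M \<le> N \<Longrightarrow> scoped d N t"
  by (induction t arbitrary: d) auto

lemma conservative_refl: "valid \<Theta> N \<Longrightarrow> conservative \<Theta> N N"
  by (simp add: conservative_def)

text \<open>The cut is realised inside the object theory: a term over the extended context is
  abstracted with \<open>ty_Lam\<close> and applied to the proof of the new entry. The resulting
  type is \<open>inst1 a (wk T)\<close>, which is \<open>T\<close>.\<close>

lemma conservative_cut:
  assumes c: "conservative \<Theta> M N" and e: "extends \<Theta> N" and d: "derivable \<Theta> N (\<Theta> ! N)"
  shows "conservative \<Theta> M (Suc N)"
proof -
  have v: "valid \<Theta> N" using c by (simp add: conservative_def)
  obtain i where A: "tops \<Theta> N \<turnstile> er N 0 (\<Theta> ! N) \<Colon> Univ i" using extends_type[OF v e] ..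
  obtain a where a: "tops \<Theta> N \<turnstile> a \<Colon> er N 0 (\<Theta> ! N)" using d by (auto simp: derivable_def)
  have "derivable \<Theta> N T" if T: "scoped 0 N T" "derivable \<Theta> (Suc N) T" for T
  proof -
    \<comment> \<open>\<open>T\<close> does not mention the newest global, so adding it only shifts
      the indices by one.\<close>
    have "er (Suc N) 0 T = wk (er N 0 T)"
      using T(1) by (intro ren_er_scoped[symmetric]) (simp_all add: shifts_def)
    then obtain t where "er N 0 (\<Theta> ! N) # tops \<Theta> N \<turnstile> t \<Colon> wk (er N 0 T)"
      using T(2) by (auto simp: derivable_def)
    from ty_App[OF ty_Lam[OF A this] a] show ?thesis by (auto simp: derivable_def inst1_wk)
  qed
  then show ?thesis
    using c valid_Suc[OF v e] by (auto simp: conservative_def intro: scoped_mono)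
qed

lemma conservative_checks:
  "conservative \<Theta> M N \<Longrightarrow> checks \<Theta> N t \<Longrightarrow> conservative \<Theta> M (Suc N)"
  by (metis checks_derivable checks_extends conservative_cut conservative_def)

primrec checks_all :: "ptm list \<Rightarrow> nat \<Rightarrow> ptm list \<Rightarrow> bool" where
  "checks_all \<Theta> N [] = True"
| "checks_all \<Theta> N (t # ts) = (checks \<Theta> N t \<and> checks_all \<Theta> (Suc N) ts)"

lemma conservative_checks_all:
  "conservative \<Theta> M N \<Longrightarrow> checks_all \<Theta> N ts \<Longrightarrow> conservative \<Theta> M (N + length ts)"
proof (induction ts arbitrary: N)
  case (Cons t ts)
  then show ?case using conservative_checks[OF Cons.prems(1)] by fastforce
qed simp

text \<open>For entries that are hypotheses and have no proof: the newest global is abstracted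
  instead of being filled in. \<open>B\<close> is a raw term because it may mention this
  global.\<close>

lemma derivable_Pi:
  assumes "valid \<Theta> N" "extends \<Theta> N" "\<exists>t. tops \<Theta> (Suc N) \<turnstile> t \<Colon> B"
  shows "\<exists>t. tops \<Theta> N \<turnstile> t \<Colon> Pi (er N 0 (\<Theta> ! N)) B"
  using extends_type[OF assms(1,2)] assms(3) by (auto intro: ty_Lam)

lemma tops_cong: "(\<And>k. k < N \<Longrightarrow> \<Theta> ! k = \<Theta>' ! k) \<Longrightarrow> tops \<Theta> N = tops \<Theta>' N"
  by (induction N) simp_all

lemma valid_cong: "(\<And>k. k < N \<Longrightarrow> \<Theta> ! k = \<Theta>' ! k) \<Longrightarrow> valid \<Theta> N = valid \<Theta>' N"
  using tops_cong[of N \<Theta> \<Theta>'] by (simp add: valid_def)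

lemma derivable_cong: "(\<And>k. k < N \<Longrightarrow> \<Theta> ! k = \<Theta>' ! k) \<Longrightarrow> derivable \<Theta> N = derivable \<Theta>' N"
  using tops_cong[of N \<Theta> \<Theta>'] by (simp add: derivable_def fun_eq_iff)

text \<open>Carries results between lists with a common initial segment, so that shared lemmas are
  evaluated once.\<close>

lemma conservative_cong:
  assumes "conservative \<Theta> M N" "\<And>k. k < N \<Longrightarrow> \<Theta> ! k = \<Theta>' ! k"
  shows "conservative \<Theta>' M N"
  using assms(1) valid_cong[of N \<Theta> \<Theta>'] derivable_cong[of N \<Theta> \<Theta>'] derivable_cong[of M \<Theta> \<Theta>'] assms(2)
  by (auto simp: conservative_def)

section \<open>Proof terms\<close>

subsection \<open>Higher-order syntax\<close>

text \<open>
  Surface terms are functions of the number of enclosing local binders; a bound variable is passed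
  around as its de Bruijn level, so that binders can be written with \<open>\<lambda>\<close>.
\<close>

type_synonym hoas = "nat \<Rightarrow> ptm"

definition bvar :: "nat \<Rightarrow> hoas" where
  "bvar l d = PVar (d - Suc l)"

definition glob :: "nat \<Rightarrow> hoas" where
  "glob k d = PTop k"

definition univ :: "nat \<Rightarrow> hoas" where
  "univ i d = PUniv i"

definition piT :: "hoas \<Rightarrow> (hoas \<Rightarrow> hoas) \<Rightarrow> hoas" where
  "piT A B d = PPi (A d) (B (bvar d) (Suc d))"

definition arr :: "hoas \<Rightarrow> hoas \<Rightarrow> hoas"   (infixr "\<rightarrow>" 60) where
  "(A \<rightarrow> B) d = PPi (A d) (B (Suc d))"

definition lam :: "hoas \<Rightarrow> (hoas \<Rightarrow> hoas) \<Rightarrow> hoas" where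
  "lam A b d = PLam (A d) (b (bvar d) (Suc d))"

definition app :: "hoas \<Rightarrow> hoas \<Rightarrow> hoas" (infixl "\<cdot>" 75) where
  "(f \<cdot> a) d = PApp (f d) (a d)"

definition sigmaT :: "hoas \<Rightarrow> (hoas \<Rightarrow> hoas) \<Rightarrow> hoas" where
  "sigmaT A B d = PSig (A d) (B (bvar d) (Suc d))"

definition pair :: "hoas \<Rightarrow> (hoas \<Rightarrow> hoas) \<Rightarrow> hoas \<Rightarrow> hoas \<Rightarrow> hoas" where
  "pair A B a b d = PDpair (A d) (B (bvar d) (Suc d)) (a d) (b d)"

definition split :: "(hoas \<Rightarrow> hoas) \<Rightarrow> (hoas \<Rightarrow> hoas \<Rightarrow> hoas) \<Rightarrow> hoas \<Rightarrow> hoas" where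
  "split C g p d =
     PSplit (C (bvar d) (Suc d)) (g (bvar d) (bvar (Suc d)) (Suc (Suc d))) (p d)"

definition sumT :: "hoas \<Rightarrow> hoas \<Rightarrow> hoas" (infixr "\<oplus>" 65) where
  "(A \<oplus> B) d = PPlus (A d) (B d)"

definition inl :: "hoas \<Rightarrow> hoas \<Rightarrow> hoas" where
  "inl B a d = PInj1 (B d) (a d)"

definition inr :: "hoas \<Rightarrow> hoas \<Rightarrow> hoas" where
  "inr A b d = PInj2 (A d) (b d)"

definition cases_sum ::
  "(hoas \<Rightarrow> hoas) \<Rightarrow> (hoas \<Rightarrow> hoas) \<Rightarrow> (hoas \<Rightarrow> hoas) \<Rightarrow> hoas \<Rightarrow> hoas" where
  "cases_sum C l r e d =
     PCase (C (bvar d) (Suc d)) (l (bvar d) (Suc d)) (r (bvar d) (Suc d)) (e d)"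

definition emptyT :: hoas where
  "emptyT d = PEmpty"

definition absurd :: "(hoas \<Rightarrow> hoas) \<Rightarrow> hoas \<Rightarrow> hoas" where
  "absurd C e d = PAbsurd (C (bvar d) (Suc d)) (e d)"

definition twoT :: hoas where
  "twoT d = PTwo"

definition ff :: hoas where
  "ff d = PTwo0"

definition tt :: hoas where
  "tt d = PTwo1"

definition ind_two :: "(hoas \<Rightarrow> hoas) \<Rightarrow> hoas \<Rightarrow> hoas \<Rightarrow> hoas \<Rightarrow> hoas" where
  "ind_two C l r b d = PIndTwo (C (bvar d) (Suc d)) (l d) (r d) (b d)"

definition natT :: hoas where
  "natT d = PNat"

definition zeroT :: hoas where
  "zeroT d = PZero"

definition succT :: "hoas \<Rightarrow> hoas" where
  "succT n d = PSucc (n d)"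

definition ind_nat ::
  "(hoas \<Rightarrow> hoas) \<Rightarrow> hoas \<Rightarrow> (hoas \<Rightarrow> hoas \<Rightarrow> hoas) \<Rightarrow> hoas \<Rightarrow> hoas" where
  "ind_nat C z s n d =
     PIndNat (C (bvar d) (Suc d)) (z d) (s (bvar d) (bvar (Suc d)) (Suc (Suc d))) (n d)"

definition path :: "hoas \<Rightarrow> hoas \<Rightarrow> hoas \<Rightarrow> hoas" where
  "path A a b d = PEq (A d) (a d) (b d)"

definition rfl :: "hoas \<Rightarrow> hoas" where
  "rfl a d = PRefl (a d)"

definition path_ind ::
  "(hoas \<Rightarrow> hoas \<Rightarrow> hoas \<Rightarrow> hoas) \<Rightarrow> (hoas \<Rightarrow> hoas) \<Rightarrow> hoas \<Rightarrow> hoas \<Rightarrow> hoas \<Rightarrow> hoas" where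
  "path_ind C c a b p d =
     PJ (C (bvar d) (bvar (Suc d)) (bvar (Suc (Suc d))) (Suc (Suc (Suc d))))
       (c (bvar d) (Suc d)) (a d) (b d) (p d)"

definition trunc :: "hoas \<Rightarrow> hoas" where
  "trunc A d = PTrunc (A d)"

definition trunc_in :: "hoas \<Rightarrow> hoas" where
  "trunc_in a d = PTr (a d)"

definition trunc_path :: "hoas \<Rightarrow> hoas \<Rightarrow> hoas" where
  "trunc_path a b d = PTrPath (a d) (b d)"

definition trunc_rec :: "hoas \<Rightarrow> hoas \<Rightarrow> hoas \<Rightarrow> hoas \<Rightarrow> hoas" where
  "trunc_rec P h g a d = PTrRec (P d) (h d) (g d) (a d)"

syntax
  "_pi" :: "pttrn \<Rightarrow> 'a \<Rightarrow> 'b \<Rightarrow> 'c"  ("(3\<^bold>\<Pi>_ : _./ _)" [0, 60, 10] 10)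
  "_lam" :: "pttrn \<Rightarrow> 'a \<Rightarrow> 'b \<Rightarrow> 'c"  ("(3\<^bold>\<lambda>_ : _./ _)" [0, 60, 10] 10)
  "_sigma" :: "pttrn \<Rightarrow> 'a \<Rightarrow> 'b \<Rightarrow> 'c"  ("(3\<^bold>\<Sigma>_ : _./ _)" [0, 60, 10] 10)
translations
  "\<^bold>\<Pi>x : A. B" \<rightleftharpoons> "CONST piT A (\<lambda>x. B)"
  "\<^bold>\<lambda>x : A. b" \<rightleftharpoons> "CONST lam A (\<lambda>x. b)"
  "\<^bold>\<Sigma>x : A. B" \<rightleftharpoons> "CONST sigmaT A (\<lambda>x. B)"

lemmas hoas_simps =
  bvar_def glob_def univ_def piT_def arr_def lam_def app_def sigmaT_def pair_def split_def sumT_def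
  inl_def inr_def cases_sum_def emptyT_def absurd_def twoT_def ff_def tt_def ind_two_def natT_def
  zeroT_def succT_def ind_nat_def path_def rfl_def path_ind_def trunc_def trunc_in_def
  trunc_path_def trunc_rec_def diff_Suc_Suc diff_0_eq_0 minus_nat.diff_0

subsection \<open>Running the checker\<close>

text \<open>
  The simplifier is used as a call-by-value evaluator. The congruence rules without premises keep it
  out of arguments that are already evaluated. In a redex \<open>(\<lambda>a b. t) x y\<close> it would normalise
  \<open>\<lambda>b. t[x/a]\<close> before \<open>y\<close> is substituted; \<open>stop\<close> prevents that.
\<close>

definition stop :: "'a \<Rightarrow> 'a" where
  "stop x = x"

definition elim_pair :: "('a \<Rightarrow> 'b \<Rightarrow> 'c) \<Rightarrow> 'a \<times> 'b \<Rightarrow> 'c" where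
  "elim_pair f p = f (fst p) (snd p)"

text \<open>Unlike \<open>pren\<close>, this constant has a congruence rule that evaluates its
  argument. Thus the looked-up entry of a substitution is computed before it is renamed.\<close>

definition lift :: "ptm \<Rightarrow> ptm" where
  "lift t = pren Suc t"

lemma case_prod_stop: "case_prod f = elim_pair (\<lambda>a. stop (f a))"
  by (rule ext) (simp add: elim_pair_def stop_def case_prod_beta)

lemma closed_congs:
  "nf n \<Theta> N \<Gamma> t = nf n \<Theta> N \<Gamma> t" "step \<Theta> N F \<Gamma> t = step \<Theta> N F \<Gamma> t"
  "unchanged t t' r = unchanged t t' r" "same s t = same s t" "cumul s t = cumul s t"
  "psub \<sigma> t = psub \<sigma> t" "pren \<rho> t = pren \<rho> t" "isnf t = isnf t" "lookup \<Gamma> n = lookup \<Gamma> n"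
  "intro_form t = intro_form t" "var0 t = var0 t" "applied_to_var0 t = applied_to_var0 t"
  "eta_contract t = eta_contract t" "univ_of t = univ_of t" "pi_of t = pi_of t"
  "lam_of t = lam_of t" "sig_of t = sig_of t" "pair_of t = pair_of t" "plus_of t = plus_of t"
  "inj_of t = inj_of t" "two_of t = two_of t" "nat_of t = nat_of t" "eq_of t = eq_of t"
  "refl_of t = refl_of t" "trunc_of t = trunc_of t" "stop f = stop f"
  by (rule refl)+

lemma weak_congs:
  "t = t' \<Longrightarrow> infer_type F \<Gamma> t = infer_type F \<Gamma> t'"
  "t = t' \<Longrightarrow> check_type F \<Gamma> T t = check_type F \<Gamma> T t'"
  "t = t' \<Longrightarrow> normal_type F \<Gamma> t = normal_type F \<Gamma> t'"
  "t = t' \<Longrightarrow> lift t = lift t'"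
  "m = m' \<Longrightarrow> Option.bind m f = Option.bind m' f"
  "p = p' \<Longrightarrow> elim_pair g p = elim_pair g p'"
  "P = P' \<Longrightarrow> (P \<and> Q) = (P' \<and> Q)"
  by simp_all

lemmas eval_congs =
  closed_congs weak_congs if_weak_cong option.case_cong_weak nat.case_cong_weak

lemma eval_rules:
  "nf (Suc n) \<Theta> N \<Gamma> t = step \<Theta> N (nf n \<Theta> N) \<Gamma> t"
  "same t t = True" "cumul (PUniv i) (PUniv j) = (i \<le> j)"
  "pup \<sigma> 0 = PVar 0" "pup \<sigma> (Suc n) = lift (\<sigma> n)"
  "elim_pair f (x, y) = f x y" "stop h z = h z"
  "max (Suc n) n = Suc n" "max n (Suc n) = Suc n"
  by (simp_all add: same_def lift_def elim_pair_def stop_def)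

lemma cumul_refl: "cumul t t = True"
  by (cases t) simp_all

lemmas eval_simps =
  eval_rules cumul_refl upr_simps lift_def psub.simps pren.simps isnf.simps scoped.simps
  intro_form.simps var0.simps applied_to_var0.simps eta_contract.simps lookup.simps
  univ_of.simps(1) pi_of.simps(1) lam_of.simps(1) sig_of.simps(1) pair_of.simps(1)
  plus_of.simps(1) inj_of.simps(1,2) two_of.simps(1,2) nat_of.simps(1,2) eq_of.simps(1)
  refl_of.simps(1) trunc_of.simps(1)
  step.simps[unfolded case_prod_stop] infer_type_def[unfolded case_prod_stop]
  check_type_def[unfolded case_prod_stop] normal_type_def[unfolded case_prod_stop] unchanged_def
  Option.bind.simps option.case nat.case if_True if_False simp_thms option.distinct
  nat.inject nat.distinct ptm.inject ptm.distinct
  add_0_right add_Suc_right le0 Suc_le_mono order_refl max_0L max_0R max.idem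
  rel_simps zero_less_numeral zero_less_one zero_less_Suc Suc_less_eq not_less_zero

lemmas elaborate =
  checks_def[unfolded case_prod_stop] extends_def
  depth_def[unfolded numeral_eq_Suc pred_numeral_simps BitM.simps]

subsection \<open>Paths, equivalences and univalence\<close>

named_theorems hoas_defs

context
  fixes i j :: nat
begin

definition not_type where [hoas_defs]:
  "not_type A = A \<rightarrow> emptyT"

definition idfun_of where [hoas_defs]:
  "idfun_of A = (\<^bold>\<lambda>x : A. x)"

definition fst_of where [hoas_defs]:
  "fst_of A p = split (\<lambda>_. A) (\<lambda>x _. x) p"

definition ap_path where [hoas_defs]:
  "ap_path B F a b p = path_ind (\<lambda>x y _. path B (F x) (F y)) (\<lambda>x. rfl (F x)) a b p"

definition inv_path where [hoas_defs]:
  "inv_path A a b p = path_ind (\<lambda>x y _. path A y x) rfl a b p"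

definition comp_path where [hoas_defs]:
  "comp_path A a b c p q =
     path_ind (\<lambda>x y _. path A y c \<rightarrow> path A x c) (\<lambda>x. idfun_of (path A x c)) a b p \<cdot> q"

definition transport where [hoas_defs]:
  "transport P a b p z = path_ind (\<lambda>x y _. P x \<rightarrow> P y) (\<lambda>x. idfun_of (P x)) a b p \<cdot> z"

definition right_inv where [hoas_defs]:
  "right_inv A B f g = (\<^bold>\<Pi>y : B. path B (f \<cdot> (g \<cdot> y)) y)"

definition has_section where [hoas_defs]:
  "has_section A B f = (\<^bold>\<Sigma>g : B \<rightarrow> A. right_inv A B f g)"

definition has_retraction where [hoas_defs]:
  "has_retraction A B f = (\<^bold>\<Sigma>h : B \<rightarrow> A. right_inv B A h f)"

definition is_equiv where [hoas_defs]:
  "is_equiv A B f = (\<^bold>\<Sigma>_ : has_section A B f. has_retraction A B f)"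

definition equiv_type where [hoas_defs]:
  "equiv_type A B = (\<^bold>\<Sigma>f : A \<rightarrow> B. is_equiv A B f)"

definition mk_equiv where [hoas_defs]:
  "mk_equiv A B f g e e' =
     pair (A \<rightarrow> B) (is_equiv A B) f
       (pair (has_section A B f) (\<lambda>_. has_retraction A B f) (pair (B \<rightarrow> A) (right_inv A B f) g e)
          (pair (B \<rightarrow> A) (\<lambda>h. right_inv B A h f) g e'))"

definition id_equiv where [hoas_defs]:
  "id_equiv A = mk_equiv A A (idfun_of A) (idfun_of A) (\<^bold>\<lambda>x : A. rfl x) (\<^bold>\<lambda>x : A. rfl x)"

definition path_to_equiv where [hoas_defs]:
  "path_to_equiv A B p = path_ind (\<lambda>X Y _. equiv_type X Y) id_equiv A B p"

definition cast where [hoas_defs]: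
  "cast A B p = path_ind (\<lambda>X Y _. X \<rightarrow> Y) idfun_of A B p"

abbreviation ua where
  "ua \<equiv> glob 0"

definition ua_type :: ptm where
  "ua_type =
     (\<^bold>\<Pi>A : univ i. \<^bold>\<Pi>B : univ i.
      is_equiv (path (univ i) A B) (equiv_type A B)
        (\<^bold>\<lambda>p : path (univ i) A B. path_to_equiv A B p)) 0"

definition cast_claim where [hoas_defs]:
  "cast_claim A B p = path (A \<rightarrow> B) (fst_of (A \<rightarrow> B) (path_to_equiv A B p)) (cast A B p)"

abbreviation cast_eq where
  "cast_eq \<equiv> glob 1"

definition cast_eq_type :: ptm where
  "cast_eq_type = (\<^bold>\<Pi>A : univ i. \<^bold>\<Pi>B : univ i. \<^bold>\<Pi>p : path (univ i) A B. cast_claim A B p) 0"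

definition cast_eq_proof :: ptm where
  "cast_eq_proof =
     (\<^bold>\<lambda>A : univ i. \<^bold>\<lambda>B : univ i. \<^bold>\<lambda>p : path (univ i) A B.
      path_ind cast_claim (\<lambda>X. rfl (idfun_of X)) A B p) 0"

text \<open>The form in which univalence is used throughout: the path is remembered together with
  the function that it induces.\<close>

definition realises where [hoas_defs]:
  "realises A B f = (\<^bold>\<Sigma>p : path (univ i) A B. path (A \<rightarrow> B) (cast A B p) f)"

abbreviation ua_path where
  "ua_path \<equiv> glob 2"

definition ua_path_type :: ptm where
  "ua_path_type =
     (\<^bold>\<Pi>A : univ i. \<^bold>\<Pi>B : univ i. \<^bold>\<Pi>f : A \<rightarrow> B. \<^bold>\<Pi>g : B \<rightarrow> A.
      right_inv A B f g \<rightarrow> right_inv B A g f \<rightarrow> realises A B f) 0"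

text \<open>\<open>u\<close> and \<open>h\<close> form the section of \<open>path_to_equiv\<close>
  contained in univalence. \<open>cast_eq\<close> read backwards, followed by the first projection
  of \<open>h\<close>, identifies the cast along the new path with \<open>f\<close>.\<close>

definition ua_path_proof :: ptm where
  "ua_path_proof =
     (\<^bold>\<lambda>A : univ i. \<^bold>\<lambda>B : univ i. \<^bold>\<lambda>f : A \<rightarrow> B. \<^bold>\<lambda>g : B \<rightarrow> A. \<^bold>\<lambda>e : right_inv A B f g.
      \<^bold>\<lambda>e' : right_inv B A g f.
      split (\<lambda>_. realises A B f)
        (\<lambda>w _.
           split (\<lambda>_. realises A B f)
             (\<lambda>u h.
                pair (path (univ i) A B) (\<lambda>p. path (A \<rightarrow> B) (cast A B p) f)
                  (u \<cdot> mk_equiv A B f g e e')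
                  (comp_path (A \<rightarrow> B) (cast A B (u \<cdot> mk_equiv A B f g e e'))
                     (fst_of (A \<rightarrow> B) (path_to_equiv A B (u \<cdot> mk_equiv A B f g e e'))) f
                     (inv_path (A \<rightarrow> B)
                        (fst_of (A \<rightarrow> B) (path_to_equiv A B (u \<cdot> mk_equiv A B f g e e')))
                        (cast A B (u \<cdot> mk_equiv A B f g e e'))
                        (cast_eq \<cdot> A \<cdot> B \<cdot> (u \<cdot> mk_equiv A B f g e e')))
                     (ap_path (A \<rightarrow> B) (fst_of (A \<rightarrow> B))
                        (path_to_equiv A B (u \<cdot> mk_equiv A B f g e e')) (mk_equiv A B f g e e')
                        (h \<cdot> mk_equiv A B f g e e')))) w) (ua \<cdot> A \<cdot> B)) 0"

definition comp_inj where [hoas_defs]: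
  "comp_inj X A B c =
     (\<^bold>\<Pi>u : X \<rightarrow> A. \<^bold>\<Pi>v : X \<rightarrow> A.
      path (X \<rightarrow> B) (\<^bold>\<lambda>x : X. c \<cdot> (u \<cdot> x)) (\<^bold>\<lambda>x : X. c \<cdot> (v \<cdot> x)) \<rightarrow> path (X \<rightarrow> A) u v)"

abbreviation cast_inj where
  "cast_inj \<equiv> glob 3"

definition cast_inj_type :: ptm where
  "cast_inj_type =
     (\<^bold>\<Pi>X : univ i. \<^bold>\<Pi>A : univ i. \<^bold>\<Pi>B : univ i. \<^bold>\<Pi>p : path (univ i) A B.
      comp_inj X A B (cast A B p)) 0"

text \<open>At reflexivity the cast reduces to the identity, and judgmental eta contracts the
  composites to \<open>u\<close> and \<open>v\<close>, so the identity function has the required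
  type.\<close>

definition cast_inj_proof :: ptm where
  "cast_inj_proof =
     (\<^bold>\<lambda>X : univ i. \<^bold>\<lambda>A : univ i. \<^bold>\<lambda>B : univ i. \<^bold>\<lambda>p : path (univ i) A B.
      path_ind (\<lambda>A B p. comp_inj X A B (cast A B p))
        (\<lambda>A. \<^bold>\<lambda>u : X \<rightarrow> A. \<^bold>\<lambda>v : X \<rightarrow> A. idfun_of (path (X \<rightarrow> A) u v)) A B p) 0"

subsection \<open>Function extensionality\<close>

text \<open>
  The first projection from the type of paths in \<open>B\<close> is an equivalence, hence composition with it
  is injective. Applied to the constant path at \<open>h\<close> and to a homotopy from \<open>h\<close> to \<open>k\<close>, which have
  the same first projection, this yields \<open>h = k\<close>.
\<close>

definition paths_from where [hoas_defs]:
  "paths_from B x = (\<^bold>\<Sigma>y : B. path B x y)"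

definition paths where [hoas_defs]:
  "paths B = (\<^bold>\<Sigma>x : B. paths_from B x)"

definition mk_path where [hoas_defs]:
  "mk_path B x y e = pair B (paths_from B) x (pair B (path B x) y e)"

definition const_path where [hoas_defs]:
  "const_path B x = mk_path B x x (rfl x)"

definition target where [hoas_defs]:
  "target B w = split (\<lambda>_. B) (\<lambda>_ v. fst_of B v) w"

definition paths_contract where [hoas_defs]:
  "paths_contract B w = path (paths B) (const_path B (fst_of B w)) w"

abbreviation paths_retract where
  "paths_retract \<equiv> glob 4"

definition paths_retract_type :: ptm where
  "paths_retract_type = (\<^bold>\<Pi>B : univ i. \<^bold>\<Pi>w : paths B. paths_contract B w) 0"

definition paths_retract_proof :: ptm where
  "paths_retract_proof =
     (\<^bold>\<lambda>B : univ i. \<^bold>\<lambda>w : paths B.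
      split (paths_contract B)
        (\<lambda>x v.
           split (\<lambda>v. path (paths B) (const_path B x) (pair B (paths_from B) x v))
             (\<lambda>y e.
                path_ind (\<lambda>x y e. path (paths B) (const_path B x) (mk_path B x y e))
                  (\<lambda>x. rfl (const_path B x)) x y e) v) w) 0"

definition homotopy where [hoas_defs]:
  "homotopy A B h k = (\<^bold>\<Pi>x : A. path B (h \<cdot> x) (k \<cdot> x))"

abbreviation funext where
  "funext \<equiv> glob 5"

definition funext_type :: ptm where
  "funext_type =
     (\<^bold>\<Pi>A : univ i. \<^bold>\<Pi>B : univ i. \<^bold>\<Pi>h : A \<rightarrow> B. \<^bold>\<Pi>k : A \<rightarrow> B. homotopy A B h k \<rightarrow> path (A \<rightarrow> B) h k) 0"

text \<open>\<open>ua_path\<close> presents the first projection as a cast, and transport along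
  \<open>e\<close> carries \<open>cast_inj\<close> over to the projection itself. Both composites
  with the projection are \<open>h\<close> up to eta, hence \<open>rfl h\<close>; taking targets
  pointwise gives \<open>h\<close> and \<open>k\<close>, again up to eta.\<close>

definition funext_proof :: ptm where
  "funext_proof =
     (\<^bold>\<lambda>A : univ i. \<^bold>\<lambda>B : univ i. \<^bold>\<lambda>h : A \<rightarrow> B. \<^bold>\<lambda>k : A \<rightarrow> B. \<^bold>\<lambda>H : homotopy A B h k.
      split (\<lambda>_. path (A \<rightarrow> B) h k)
        (\<lambda>p e.
           ap_path (A \<rightarrow> B) (\<lambda>u. \<^bold>\<lambda>x : A. target B (u \<cdot> x)) (\<^bold>\<lambda>x : A. const_path B (h \<cdot> x))
             (\<^bold>\<lambda>x : A. mk_path B (h \<cdot> x) (k \<cdot> x) (H \<cdot> x))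
             (transport (comp_inj A (paths B) B) (cast (paths B) B p) (\<^bold>\<lambda>w : paths B. fst_of B w) e
                (cast_inj \<cdot> A \<cdot> paths B \<cdot> B \<cdot> p) \<cdot> (\<^bold>\<lambda>x : A. const_path B (h \<cdot> x))
                \<cdot> (\<^bold>\<lambda>x : A. mk_path B (h \<cdot> x) (k \<cdot> x) (H \<cdot> x)) \<cdot> rfl h))
        (ua_path \<cdot> paths B \<cdot> B \<cdot> (\<^bold>\<lambda>w : paths B. fst_of B w) \<cdot> (\<^bold>\<lambda>b : B. const_path B b)
           \<cdot> (\<^bold>\<lambda>b : B. rfl b) \<cdot> (paths_retract \<cdot> B))) 0"

subsection \<open>Cantor space absorbs copies of itself\<close>

definition Cant where [hoas_defs]:
  "Cant = natT \<rightarrow> twoT"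

definition Cant2 where [hoas_defs]:
  "Cant2 = Cant \<oplus> Cant"

definition tail where [hoas_defs]:
  "tail c = (\<^bold>\<lambda>n : natT. c \<cdot> succT n)"

definition cons where [hoas_defs]:
  "cons b c = (\<^bold>\<lambda>n : natT. ind_nat (\<lambda>_. twoT) b (\<lambda>m _. c \<cdot> m) n)"

definition join where [hoas_defs]:
  "join w = cases_sum (\<lambda>_. Cant) (cons ff) (cons tt) w"

text \<open>The bit is a separate argument so that \<open>join_tagged\<close> can be proved by cases
  on an arbitrary \<open>b\<close> and then instantiated with the head of a sequence.\<close>

definition tagged where [hoas_defs]:
  "tagged b c = ind_two (\<lambda>_. Cant2) (inl Cant c) (inr Cant c) b"

definition unjoin where [hoas_defs]:
  "unjoin c = tagged (c \<cdot> zeroT) (tail c)"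

abbreviation join_tagged where
  "join_tagged \<equiv> glob 6"

definition join_tagged_type :: ptm where
  "join_tagged_type =
     (\<^bold>\<Pi>b : twoT. \<^bold>\<Pi>c : Cant. \<^bold>\<Pi>n : natT. path twoT (join (tagged b c) \<cdot> n) (cons b c \<cdot> n)) 0"

definition join_tagged_proof :: ptm where
  "join_tagged_proof =
     (\<^bold>\<lambda>b : twoT. \<^bold>\<lambda>c : Cant. \<^bold>\<lambda>n : natT.
      ind_two (\<lambda>b. path twoT (join (tagged b c) \<cdot> n) (cons b c \<cdot> n)) (rfl (cons ff c \<cdot> n))
        (rfl (cons tt c \<cdot> n)) b) 0"

abbreviation cons_tail where
  "cons_tail \<equiv> glob 7"

definition cons_tail_type :: ptm where
  "cons_tail_type = (\<^bold>\<Pi>c : Cant. \<^bold>\<Pi>n : natT. path twoT (cons (c \<cdot> zeroT) (tail c) \<cdot> n) (c \<cdot> n)) 0"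

definition cons_tail_proof :: ptm where
  "cons_tail_proof =
     (\<^bold>\<lambda>c : Cant. \<^bold>\<lambda>n : natT.
      ind_nat (\<lambda>n. path twoT (cons (c \<cdot> zeroT) (tail c) \<cdot> n) (c \<cdot> n)) (rfl (c \<cdot> zeroT))
        (\<lambda>m _. rfl (c \<cdot> succT m)) n) 0"

abbreviation join_unjoin where
  "join_unjoin \<equiv> glob 8"

definition join_unjoin_type :: ptm where
  "join_unjoin_type = (\<^bold>\<Pi>c : Cant. path Cant (join (unjoin c)) c) 0"

text \<open>A variable sequence is not judgmentally a \<open>cons\<close>, so the two sides agree
  only coordinate by coordinate and function extensionality is needed. The converse composite
  reduces to the identity on each summand, by eta.\<close>

definition join_unjoin_proof :: ptm where
  "join_unjoin_proof =
     (\<^bold>\<lambda>c : Cant.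
      funext \<cdot> natT \<cdot> twoT \<cdot> join (unjoin c) \<cdot> c
        \<cdot> (\<^bold>\<lambda>n : natT.
           comp_path twoT (join (unjoin c) \<cdot> n) (cons (c \<cdot> zeroT) (tail c) \<cdot> n) (c \<cdot> n)
             (join_tagged \<cdot> (c \<cdot> zeroT) \<cdot> tail c \<cdot> n) (cons_tail \<cdot> c \<cdot> n))) 0"

abbreviation unjoin_join where
  "unjoin_join \<equiv> glob 9"

definition unjoin_join_type :: ptm where
  "unjoin_join_type = (\<^bold>\<Pi>w : Cant2. path Cant2 (unjoin (join w)) w) 0"

definition unjoin_join_proof :: ptm where
  "unjoin_join_proof =
     (\<^bold>\<lambda>w : Cant2.
      cases_sum (\<lambda>w. path Cant2 (unjoin (join w)) w) (\<lambda>c. rfl (inl Cant c)) (\<lambda>c. rfl (inr Cant c))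
        w) 0"

abbreviation double_C where
  "double_C \<equiv> glob 10"

definition double_C_type :: ptm where
  "double_C_type = (path (univ i) Cant2 Cant) 0"

definition double_C_proof :: ptm where
  "double_C_proof =
     (fst_of (path (univ i) Cant2 Cant)
        (ua_path \<cdot> Cant2 \<cdot> Cant \<cdot> (\<^bold>\<lambda>w : Cant2. join w) \<cdot> (\<^bold>\<lambda>c : Cant. unjoin c) \<cdot> join_unjoin
           \<cdot> unjoin_join)) 0"

definition plus2 where [hoas_defs]:
  "plus2 Z = (Z \<oplus> Cant) \<oplus> Cant"

definition plusCC where [hoas_defs]:
  "plusCC Z = Z \<oplus> Cant2"

definition assoc where [hoas_defs]:
  "assoc Z w =
     cases_sum (\<lambda>_. plusCC Z) (cases_sum (\<lambda>_. plusCC Z) (inl Cant2) (\<lambda>c. inr Z (inl Cant c)))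
       (\<lambda>c. inr Z (inr Cant c)) w"

definition unassoc where [hoas_defs]:
  "unassoc Z w =
     cases_sum (\<lambda>_. plus2 Z) (\<lambda>z. inl Cant (inl Cant z))
       (cases_sum (\<lambda>_. plus2 Z) (\<lambda>c. inl Cant (inr Z c)) (inr (Z \<oplus> Cant))) w"

abbreviation assoc_unassoc where
  "assoc_unassoc \<equiv> glob 11"

definition assoc_unassoc_type :: ptm where
  "assoc_unassoc_type = (\<^bold>\<Pi>Z : univ i. \<^bold>\<Pi>w : plusCC Z. path (plusCC Z) (assoc Z (unassoc Z w)) w) 0"

definition assoc_unassoc_proof :: ptm where
  "assoc_unassoc_proof =
     (\<^bold>\<lambda>Z : univ i. \<^bold>\<lambda>w : plusCC Z.
      cases_sum (\<lambda>w. path (plusCC Z) (assoc Z (unassoc Z w)) w) (\<lambda>z. rfl (inl Cant2 z))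
        (\<lambda>v.
           cases_sum (\<lambda>v. path (plusCC Z) (assoc Z (unassoc Z (inr Z v))) (inr Z v))
             (\<lambda>c. rfl (inr Z (inl Cant c))) (\<lambda>c. rfl (inr Z (inr Cant c))) v) w) 0"

abbreviation unassoc_assoc where
  "unassoc_assoc \<equiv> glob 12"

definition unassoc_assoc_type :: ptm where
  "unassoc_assoc_type = (\<^bold>\<Pi>Z : univ i. \<^bold>\<Pi>w : plus2 Z. path (plus2 Z) (unassoc Z (assoc Z w)) w) 0"

definition unassoc_assoc_proof :: ptm where
  "unassoc_assoc_proof =
     (\<^bold>\<lambda>Z : univ i. \<^bold>\<lambda>w : plus2 Z.
      cases_sum (\<lambda>w. path (plus2 Z) (unassoc Z (assoc Z w)) w)
        (\<lambda>v.
           cases_sum (\<lambda>v. path (plus2 Z) (unassoc Z (assoc Z (inl Cant v))) (inl Cant v))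
             (\<lambda>z. rfl (inl Cant (inl Cant z))) (\<lambda>c. rfl (inl Cant (inr Z c))) v)
        (\<lambda>c. rfl (inr (Z \<oplus> Cant) c)) w) 0"

abbreviation absorb where
  "absorb \<equiv> glob 13"

definition absorb_type :: ptm where
  "absorb_type = (\<^bold>\<Pi>Z : univ i. path (univ i) (plus2 Z) (Z \<oplus> Cant)) 0"

text \<open>\<open>(Z + C) + C = Z + (C + C)\<close> by reassociation and univalence, then
  \<open>C + C = C\<close> applied in the second summand.\<close>

definition absorb_proof :: ptm where
  "absorb_proof =
     (\<^bold>\<lambda>Z : univ i.
      comp_path (univ i) (plus2 Z) (plusCC Z) (Z \<oplus> Cant)
        (fst_of (path (univ i) (plus2 Z) (plusCC Z))
           (ua_path \<cdot> plus2 Z \<cdot> plusCC Z \<cdot> (\<^bold>\<lambda>w : plus2 Z. assoc Z w)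
              \<cdot> (\<^bold>\<lambda>w : plusCC Z. unassoc Z w) \<cdot> (assoc_unassoc \<cdot> Z) \<cdot> (unassoc_assoc \<cdot> Z)))
        (ap_path (univ i) (\<lambda>W. Z \<oplus> W) Cant2 Cant double_C)) 0"

subsection \<open>The pre-idempotent on BAut\<close>

definition mere where [hoas_defs]:
  "mere Z = trunc (path (univ i) Z Cant)"

definition BC where [hoas_defs]:
  "BC = (\<^bold>\<Sigma>Z : univ i. mere Z)"

definition mk_BC where [hoas_defs]:
  "mk_BC Z t = pair (univ i) mere Z t"

definition El where [hoas_defs]:
  "El x = fst_of (univ i) x"

definition act where [hoas_defs]:
  "act x y q z = transport El x y q z"

definition lifts1 where [hoas_defs]:
  "lifts1 Z t u q = (\<^bold>\<Pi>z : Z. path Z (act (mk_BC Z t) (mk_BC Z u) q z) z)"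

text \<open>Besides the path in \<open>BC\<close> its action on elements is recorded, since later
  arguments see loops only through this action.\<close>

definition lifts where [hoas_defs]:
  "lifts Z W p t u =
     (\<^bold>\<Sigma>q : path BC (mk_BC Z t) (mk_BC W u). \<^bold>\<Pi>z : Z.
      path W (act (mk_BC Z t) (mk_BC W u) q z) (cast Z W p \<cdot> z))"

abbreviation lift_path where
  "lift_path \<equiv> glob 14"

definition lift_path_type :: ptm where
  "lift_path_type =
     (\<^bold>\<Pi>Z : univ i. \<^bold>\<Pi>W : univ i. \<^bold>\<Pi>p : path (univ i) Z W. \<^bold>\<Pi>t : mere Z. \<^bold>\<Pi>u : mere W.
      lifts Z W p t u) 0"

text \<open>The witnesses \<open>t\<close> and \<open>u\<close> stay quantified in the first path
  induction. On the diagonal they inhabit the same mere proposition, and a second induction on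
  \<open>trunc_path t u\<close> identifies them.\<close>

definition lift_path_proof :: ptm where
  "lift_path_proof =
     (\<^bold>\<lambda>Z : univ i. \<^bold>\<lambda>W : univ i. \<^bold>\<lambda>p : path (univ i) Z W.
      path_ind (\<lambda>Z W p. \<^bold>\<Pi>t : mere Z. \<^bold>\<Pi>u : mere W. lifts Z W p t u)
        (\<lambda>Z. \<^bold>\<lambda>t : mere Z. \<^bold>\<lambda>u : mere Z.
           path_ind (\<lambda>t u _. \<^bold>\<Sigma>q : path BC (mk_BC Z t) (mk_BC Z u). lifts1 Z t u q)
             (\<lambda>t.
                pair (path BC (mk_BC Z t) (mk_BC Z t)) (lifts1 Z t t) (rfl (mk_BC Z t))
                  (\<^bold>\<lambda>z : Z. rfl z)) t u (trunc_path t u)) Z W p) 0"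

abbreviation mere_plus where
  "mere_plus \<equiv> glob 15"

definition mere_plus_type :: ptm where
  "mere_plus_type = (\<^bold>\<Pi>x : BC. mere (El x \<oplus> Cant)) 0"

text \<open>The target is itself a truncation, hence a mere proposition, so an actual path
  \<open>Z = C\<close> may be assumed; it yields \<open>Z + C = C + C = C\<close>.\<close>

definition mere_plus_proof :: ptm where
  "mere_plus_proof =
     (\<^bold>\<lambda>x : BC.
      split (\<lambda>x. mere (El x \<oplus> Cant))
        (\<lambda>Z t.
           trunc_rec (mere (Z \<oplus> Cant))
             (\<^bold>\<lambda>a : mere (Z \<oplus> Cant). \<^bold>\<lambda>b : mere (Z \<oplus> Cant). trunc_path a b)
             (\<^bold>\<lambda>p : path (univ i) Z Cant.
              trunc_in
                (comp_path (univ i) (Z \<oplus> Cant) Cant2 Cant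
                   (ap_path (univ i) (\<lambda>W. W \<oplus> Cant) Z Cant p) double_C)) t) x) 0"

definition shift_pt where [hoas_defs]:
  "shift_pt x = mk_BC (El x \<oplus> Cant) (mere_plus \<cdot> x)"

abbreviation idem where
  "idem \<equiv> glob 16"

text \<open>The left side is the twofold shift of \<open>x\<close> written out, since
  \<open>El (shift_pt x)\<close> reduces to \<open>El x \<oplus> Cant\<close>.\<close>

definition idem_type :: ptm where
  "idem_type = (\<^bold>\<Pi>x : BC. path BC (mk_BC (plus2 (El x)) (mere_plus \<cdot> shift_pt x)) (shift_pt x)) 0"

definition idem_proof :: ptm where
  "idem_proof =
     (\<^bold>\<lambda>x : BC.
      fst_of (path BC (mk_BC (plus2 (El x)) (mere_plus \<cdot> shift_pt x)) (shift_pt x))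
        (lift_path \<cdot> plus2 (El x) \<cdot> (El x \<oplus> Cant) \<cdot> (absorb \<cdot> El x) \<cdot> (mere_plus \<cdot> shift_pt x)
           \<cdot> (mere_plus \<cdot> x))) 0"

subsection \<open>Loops without fixed points\<close>

definition flip where [hoas_defs]:
  "flip b = ind_two (\<lambda>_. twoT) tt ff b"

definition flip_all where [hoas_defs]:
  "flip_all c = (\<^bold>\<lambda>n : natT. flip (c \<cdot> n))"

abbreviation flip_flip where
  "flip_flip \<equiv> glob 17"

definition flip_flip_type :: ptm where
  "flip_flip_type = (\<^bold>\<Pi>b : twoT. path twoT (flip (flip b)) b) 0"

definition flip_flip_proof :: ptm where
  "flip_flip_proof =
     (\<^bold>\<lambda>b : twoT. ind_two (\<lambda>b. path twoT (flip (flip b)) b) (rfl ff) (rfl tt) b) 0"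

abbreviation flip_all_inv where
  "flip_all_inv \<equiv> glob 18"

definition flip_all_inv_type :: ptm where
  "flip_all_inv_type = (\<^bold>\<Pi>c : Cant. path Cant (flip_all (flip_all c)) c) 0"

definition flip_all_inv_proof :: ptm where
  "flip_all_inv_proof =
     (\<^bold>\<lambda>c : Cant.
      funext \<cdot> natT \<cdot> twoT \<cdot> flip_all (flip_all c) \<cdot> c \<cdot> (\<^bold>\<lambda>n : natT. flip_flip \<cdot> (c \<cdot> n))) 0"

abbreviation flip_neq where
  "flip_neq \<equiv> glob 19"

definition flip_neq_type :: ptm where
  "flip_neq_type = (\<^bold>\<Pi>b : twoT. not_type (path twoT (flip b) b)) 0"

text \<open>Large elimination: the family sends one bit to the empty type and the other to the
  inhabited \<open>natT\<close>, so transporting \<open>zeroT\<close> along the supposed path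
  produces an element of the empty type.\<close>

definition flip_neq_proof :: ptm where
  "flip_neq_proof =
     (\<^bold>\<lambda>b : twoT.
      ind_two (\<lambda>b. not_type (path twoT (flip b) b))
        (\<^bold>\<lambda>e : path twoT tt ff. transport (ind_two (\<lambda>_. univ 0) emptyT natT) tt ff e zeroT)
        (\<^bold>\<lambda>e : path twoT ff tt. transport (ind_two (\<lambda>_. univ 0) natT emptyT) ff tt e zeroT) b) 0"

definition moves_all where [hoas_defs]:
  "moves_all Z q = (\<^bold>\<Pi>z : Z. not_type (path Z (cast Z Z q \<cdot> z) z))"

definition free_loop where [hoas_defs]:
  "free_loop Z = (\<^bold>\<Sigma>q : path (univ i) Z Z. moves_all Z q)"

definition flips where [hoas_defs]:
  "flips = (\<^bold>\<lambda>c : Cant. flip_all c)"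

abbreviation free_loop_C where
  "free_loop_C \<equiv> glob 20"

definition free_loop_C_type :: ptm where
  "free_loop_C_type = (free_loop Cant) 0"

text \<open>A fixed sequence would have a fixed bit in coordinate 0, against
  \<open>flip_neq\<close>.\<close>

definition free_loop_C_proof :: ptm where
  "free_loop_C_proof =
     (split (\<lambda>_. free_loop Cant)
        (\<lambda>q e.
           pair (path (univ i) Cant Cant) (moves_all Cant) q
             (\<^bold>\<lambda>c : Cant. \<^bold>\<lambda>h : path Cant (cast Cant Cant q \<cdot> c) c.
              flip_neq \<cdot> (c \<cdot> zeroT)
                \<cdot> comp_path twoT (flip (c \<cdot> zeroT)) (cast Cant Cant q \<cdot> c \<cdot> zeroT) (c \<cdot> zeroT)
                    (inv_path twoT (cast Cant Cant q \<cdot> c \<cdot> zeroT) (flip (c \<cdot> zeroT))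
                       (ap_path twoT (\<lambda>k. k \<cdot> c \<cdot> zeroT) (cast Cant Cant q) flips e))
                    (ap_path twoT (\<lambda>k. k \<cdot> zeroT) (cast Cant Cant q \<cdot> c) c h)))
        (ua_path \<cdot> Cant \<cdot> Cant \<cdot> flips \<cdot> flips \<cdot> flip_all_inv \<cdot> flip_all_inv)) 0"

abbreviation free_loop_copy where
  "free_loop_copy \<equiv> glob 21"

definition free_loop_copy_type :: ptm where
  "free_loop_copy_type = (\<^bold>\<Pi>Z : univ i. path (univ i) Z Cant \<rightarrow> free_loop Z) 0"

text \<open>The motive maps free loops at the end point back to the starting point, so the path from
  \<open>Z\<close> to Cantor space is used without inverting it.\<close>

definition free_loop_copy_proof :: ptm where
  "free_loop_copy_proof =
     (\<^bold>\<lambda>Z : univ i. \<^bold>\<lambda>p : path (univ i) Z Cant.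
      path_ind (\<lambda>Z W _. free_loop W \<rightarrow> free_loop Z) (\<lambda>Z. idfun_of (free_loop Z)) Z Cant p
        \<cdot> free_loop_C) 0"

definition free_at where [hoas_defs]:
  "free_at x q = (\<^bold>\<Pi>z : El x. not_type (path (El x) (act x x q z) z))"

definition free_loop_at where [hoas_defs]:
  "free_loop_at x = (\<^bold>\<Sigma>q : path BC x x. free_at x q)"

text \<open>Passes from a loop \<open>q\<close> of the type \<open>Z\<close> to a loop
  \<open>s\<close> of the point \<open>mk_BC Z t\<close>; \<open>e\<close> is the comparison of
  their actions supplied by \<open>lift_path\<close>.\<close>

definition free_pair where [hoas_defs]:
  "free_pair Z t q n s e =
     pair (path BC (mk_BC Z t) (mk_BC Z t))
       (\<lambda>s. \<^bold>\<Pi>z : Z. not_type (path Z (act (mk_BC Z t) (mk_BC Z t) s z) z)) s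
       (\<^bold>\<lambda>z : Z. \<^bold>\<lambda>h : path Z (act (mk_BC Z t) (mk_BC Z t) s z) z.
        n \<cdot> z
          \<cdot> comp_path Z (cast Z Z q \<cdot> z) (act (mk_BC Z t) (mk_BC Z t) s z) z
              (inv_path Z (act (mk_BC Z t) (mk_BC Z t) s z) (cast Z Z q \<cdot> z) (e \<cdot> z)) h)"

text \<open>
  The truncation can only be eliminated into a mere proposition, hence the double negation.
\<close>

abbreviation free_loop_X where
  "free_loop_X \<equiv> glob 22"

definition free_loop_X_type :: ptm where
  "free_loop_X_type = (\<^bold>\<Pi>x : BC. not_type (not_type (free_loop_at x))) 0"

definition free_loop_X_proof :: ptm where
  "free_loop_X_proof =
     (\<^bold>\<lambda>x : BC.
      split (\<lambda>x. not_type (not_type (free_loop_at x)))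
        (\<lambda>Z t. \<^bold>\<lambda>k : not_type (free_loop_at (mk_BC Z t)).
           trunc_rec emptyT (\<^bold>\<lambda>a : emptyT. \<^bold>\<lambda>b : emptyT. absurd (\<lambda>_. path emptyT a b) a)
             (\<^bold>\<lambda>p : path (univ i) Z Cant.
              split (\<lambda>_. emptyT)
                (\<lambda>q n.
                   split (\<lambda>_. emptyT) (\<lambda>s e. k \<cdot> free_pair Z t q n s e)
                     (lift_path \<cdot> Z \<cdot> Z \<cdot> q \<cdot> t \<cdot> t)) (free_loop_copy \<cdot> Z \<cdot> p)) t) x) 0"

definition inj_at where [hoas_defs]:
  "inj_at x y q =
     (\<^bold>\<Pi>z : El x. \<^bold>\<Pi>w : El x. path (El y) (act x y q z) (act x y q w) \<rightarrow> path (El x) z w)"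

abbreviation act_inj where
  "act_inj \<equiv> glob 23"

definition act_inj_type :: ptm where
  "act_inj_type = (\<^bold>\<Pi>x : BC. \<^bold>\<Pi>y : BC. \<^bold>\<Pi>q : path BC x y. inj_at x y q) 0"

definition act_inj_proof :: ptm where
  "act_inj_proof =
     (\<^bold>\<lambda>x : BC. \<^bold>\<lambda>y : BC. \<^bold>\<lambda>q : path BC x y.
      path_ind inj_at (\<lambda>x. \<^bold>\<lambda>z : El x. \<^bold>\<lambda>w : El x. idfun_of (path (El x) z w)) x y q) 0"

subsection \<open>Loops at the image of a section\<close>

text \<open>
  Hypotheses of the argument: \<open>rt\<close> and \<open>st\<close> exhibit \<open>At\<close> as a retract of \<open>BC\<close>, and \<open>st (rt x)\<close>
  contains a natural copy of \<open>x\<close> and a natural point. Given a loop \<open>q\<close> at \<open>st a\<close>, conjugating \<open>ap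
  rt q\<close> with the homotopy \<open>retr\<close> gives a loop \<open>u\<close> at \<open>a\<close> with \<open>ap rt (ap st u) = ap rt q\<close>. As
  \<open>iota\<close> is injective, \<open>q\<close> acts as \<open>ap st u\<close>, and therefore fixes the image of the natural point.
\<close>

abbreviation At where
  "At \<equiv> glob 24"

definition At_type :: ptm where
  "At_type = (univ j) 0"

abbreviation rt where
  "rt \<equiv> glob 25"

definition rt_type :: ptm where
  "rt_type = (BC \<rightarrow> At) 0"

abbreviation st where
  "st \<equiv> glob 26"

definition st_type :: ptm where
  "st_type = (At \<rightarrow> BC) 0"

abbreviation retr where
  "retr \<equiv> glob 27"

definition retr_type :: ptm where
  "retr_type = (\<^bold>\<Pi>a : At. path At (rt \<cdot> (st \<cdot> a)) a) 0"

definition Fib where [hoas_defs]: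
  "Fib a = El (st \<cdot> a)"

definition sr where [hoas_defs]:
  "sr x = Fib (rt \<cdot> x)"

abbreviation iota where
  "iota \<equiv> glob 28"

definition iota_type :: ptm where
  "iota_type = (\<^bold>\<Pi>x : BC. El x \<rightarrow> sr x) 0"

definition inj_stmt where [hoas_defs]:
  "inj_stmt S T k = (\<^bold>\<Pi>z : S. \<^bold>\<Pi>w : S. path T (k \<cdot> z) (k \<cdot> w) \<rightarrow> path S z w)"

abbreviation iota_inj where
  "iota_inj \<equiv> glob 29"

definition iota_inj_type :: ptm where
  "iota_inj_type = (\<^bold>\<Pi>x : BC. inj_stmt (El x) (sr x) (iota \<cdot> x)) 0"

abbreviation point where
  "point \<equiv> glob 30"

definition point_type :: ptm where
  "point_type = (\<^bold>\<Pi>x : BC. sr x) 0"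

definition rho_path where [hoas_defs]:
  "rho_path x y q = ap_path At (\<lambda>x. rt \<cdot> x) x y q"

definition sigma_path where [hoas_defs]:
  "sigma_path a b u = ap_path BC (\<lambda>a. st \<cdot> a) a b u"

definition actD where [hoas_defs]:
  "actD a b u d = act (st \<cdot> a) (st \<cdot> b) (sigma_path a b u) d"

definition iota_claim where [hoas_defs]:
  "iota_claim x y q =
     (\<^bold>\<Pi>z : El x.
      path (sr y) (actD (rt \<cdot> x) (rt \<cdot> y) (rho_path x y q) (iota \<cdot> x \<cdot> z))
        (iota \<cdot> y \<cdot> act x y q z))"

abbreviation iota_nat where
  "iota_nat \<equiv> glob 31"

definition iota_nat_type :: ptm where
  "iota_nat_type = (\<^bold>\<Pi>x : BC. \<^bold>\<Pi>y : BC. \<^bold>\<Pi>q : path BC x y. iota_claim x y q) 0"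

text \<open>Any family of maps is natural along paths: at reflexivity both sides reduce to the same
  term.\<close>

definition iota_nat_proof :: ptm where
  "iota_nat_proof =
     (\<^bold>\<lambda>x : BC. \<^bold>\<lambda>y : BC. \<^bold>\<lambda>q : path BC x y.
      path_ind iota_claim (\<lambda>x. \<^bold>\<lambda>z : El x. rfl (iota \<cdot> x \<cdot> z)) x y q) 0"

definition point_claim where [hoas_defs]:
  "point_claim x y q =
     path (sr y) (actD (rt \<cdot> x) (rt \<cdot> y) (rho_path x y q) (point \<cdot> x)) (point \<cdot> y)"

abbreviation point_nat where
  "point_nat \<equiv> glob 32"

definition point_nat_type :: ptm where
  "point_nat_type = (\<^bold>\<Pi>x : BC. \<^bold>\<Pi>y : BC. \<^bold>\<Pi>q : path BC x y. point_claim x y q) 0"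

definition point_nat_proof :: ptm where
  "point_nat_proof =
     (\<^bold>\<lambda>x : BC. \<^bold>\<lambda>y : BC. \<^bold>\<lambda>q : path BC x y. path_ind point_claim (\<lambda>x. rfl (point \<cdot> x)) x y q) 0"

definition conj_by where [hoas_defs]:
  "conj_by b a h v u =
     (\<^bold>\<Pi>d : Fib b. path (Fib a) (actD a a u (actD b a h d)) (actD b a h (actD b b v d)))"

definition conj_claim where [hoas_defs]:
  "conj_claim b a h = (\<^bold>\<Pi>v : path At b b. \<^bold>\<Sigma>u : path At a a. conj_by b a h v u)"

abbreviation conjugate where
  "conjugate \<equiv> glob 33"

definition conjugate_type :: ptm where
  "conjugate_type = (\<^bold>\<Pi>b : At. \<^bold>\<Pi>a : At. \<^bold>\<Pi>h : path At b a. conj_claim b a h) 0"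

text \<open>The loop \<open>v\<close> is quantified inside the motive, as its base point moves with
  \<open>h\<close>; at reflexivity \<open>u\<close> is \<open>v\<close> itself.\<close>

definition conjugate_proof :: ptm where
  "conjugate_proof =
     (\<^bold>\<lambda>b : At. \<^bold>\<lambda>a : At. \<^bold>\<lambda>h : path At b a.
      path_ind conj_claim
        (\<lambda>b. \<^bold>\<lambda>v : path At b b.
           pair (path At b b) (\<lambda>u. \<^bold>\<Pi>d : Fib b. path (Fib b) (actD b b u d) (actD b b v d)) v
             (\<^bold>\<lambda>d : Fib b. rfl (actD b b v d))) b a h) 0"

definition rs where [hoas_defs]:
  "rs a = rt \<cdot> (st \<cdot> a)"

definition actH where [hoas_defs]:
  "actH a d = actD (rs a) a (retr \<cdot> a) d"

definition actV where [hoas_defs]: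
  "actV a b u d = actD (rs a) (rs b) (rho_path (st \<cdot> a) (st \<cdot> b) (sigma_path a b u)) d"

definition retr_claim where [hoas_defs]:
  "retr_claim a b u =
     (\<^bold>\<Pi>d : Fib (rs a). path (Fib b) (actD a b u (actH a d)) (actH b (actV a b u d)))"

abbreviation retr_nat where
  "retr_nat \<equiv> glob 34"

definition retr_nat_type :: ptm where
  "retr_nat_type = (\<^bold>\<Pi>a : At. \<^bold>\<Pi>b : At. \<^bold>\<Pi>u : path At a b. retr_claim a b u) 0"

text \<open>Naturality of the homotopy from \<open>rt\<close> after \<open>st\<close> to the
  identity, read as a commuting square of actions on fibres.\<close>

definition retr_nat_proof :: ptm where
  "retr_nat_proof =
     (\<^bold>\<lambda>a : At. \<^bold>\<lambda>b : At. \<^bold>\<lambda>u : path At a b.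
      path_ind retr_claim (\<lambda>a. \<^bold>\<lambda>d : Fib (rs a). rfl (actH a d)) a b u) 0"

definition conj_hyp where [hoas_defs]:
  "conj_hyp a v u = conj_by (rs a) a (retr \<cdot> a) v u"

abbreviation loop_unique where
  "loop_unique \<equiv> glob 35"

definition loop_unique_type :: ptm where
  "loop_unique_type =
     (\<^bold>\<Pi>a : At. \<^bold>\<Pi>v : path At (rs a) (rs a). \<^bold>\<Pi>u : path At a a.
      conj_hyp a v u
        \<rightarrow> (\<^bold>\<Pi>d : Fib (rs a). path (Fib (rs a)) (actD (rs a) (rs a) v d) (actV a a u d))) 0"

text \<open>After the action of \<open>retr \<cdot> a\<close>, both \<open>v\<close> and the image
  of \<open>u\<close> under \<open>rt\<close> after \<open>st\<close> become \<open>u\<close>, the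
  former by \<open>c\<close> and the latter by \<open>retr_nat\<close>. Transport is injective, so
  the two actions agree already before.\<close>

definition loop_unique_proof :: ptm where
  "loop_unique_proof =
     (\<^bold>\<lambda>a : At. \<^bold>\<lambda>v : path At (rs a) (rs a). \<^bold>\<lambda>u : path At a a. \<^bold>\<lambda>c : conj_hyp a v u. \<^bold>\<lambda>d : Fib (rs a).
      act_inj \<cdot> (st \<cdot> rs a) \<cdot> (st \<cdot> a) \<cdot> sigma_path (rs a) a (retr \<cdot> a) \<cdot> actD (rs a) (rs a) v d
        \<cdot> actV a a u d
        \<cdot> comp_path (Fib a) (actH a (actD (rs a) (rs a) v d)) (actD a a u (actH a d))
            (actH a (actV a a u d))
            (inv_path (Fib a) (actD a a u (actH a d)) (actH a (actD (rs a) (rs a) v d)) (c \<cdot> d))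
            (retr_nat \<cdot> a \<cdot> a \<cdot> u \<cdot> d)) 0"

definition loop where [hoas_defs]:
  "loop a = path BC (st \<cdot> a) (st \<cdot> a)"

definition rloop where [hoas_defs]:
  "rloop a q = rho_path (st \<cdot> a) (st \<cdot> a) q"

definition sloop where [hoas_defs]:
  "sloop a q z = act (st \<cdot> a) (st \<cdot> a) q z"

definition iota_s where [hoas_defs]:
  "iota_s a z = iota \<cdot> (st \<cdot> a) \<cdot> z"

abbreviation loop_image where
  "loop_image \<equiv> glob 36"

definition loop_image_type :: ptm where
  "loop_image_type =
     (\<^bold>\<Pi>a : At. \<^bold>\<Pi>q : loop a. \<^bold>\<Pi>u : path At a a.
      conj_hyp a (rloop a q) u \<rightarrow> (\<^bold>\<Pi>z : Fib a. path (Fib a) (sloop a q z) (actD a a u z))) 0"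

text \<open>\<open>iota\<close> intertwines \<open>q\<close> with its image under \<open>rt\<close>,
  and the action of \<open>u\<close> with that of its image. By \<open>loop_unique\<close> these
  images act alike, and \<open>iota_inj\<close> cancels \<open>iota\<close>.\<close>

definition loop_image_proof :: ptm where
  "loop_image_proof =
     (\<^bold>\<lambda>a : At. \<^bold>\<lambda>q : loop a. \<^bold>\<lambda>u : path At a a. \<^bold>\<lambda>c : conj_hyp a (rloop a q) u. \<^bold>\<lambda>z : Fib a.
      iota_inj \<cdot> (st \<cdot> a) \<cdot> sloop a q z \<cdot> actD a a u z
        \<cdot> comp_path (Fib (rs a)) (iota_s a (sloop a q z))
            (actD (rs a) (rs a) (rloop a q) (iota_s a z)) (iota_s a (actD a a u z))
            (inv_path (Fib (rs a)) (actD (rs a) (rs a) (rloop a q) (iota_s a z))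
               (iota_s a (sloop a q z)) (iota_nat \<cdot> (st \<cdot> a) \<cdot> (st \<cdot> a) \<cdot> q \<cdot> z))
            (comp_path (Fib (rs a)) (actD (rs a) (rs a) (rloop a q) (iota_s a z))
               (actV a a u (iota_s a z)) (iota_s a (actD a a u z))
               (loop_unique \<cdot> a \<cdot> rloop a q \<cdot> u \<cdot> c \<cdot> iota_s a z)
               (iota_nat \<cdot> (st \<cdot> a) \<cdot> (st \<cdot> a) \<cdot> sigma_path a a u \<cdot> z))) 0"

definition is_fixed where [hoas_defs]:
  "is_fixed a q z = path (Fib a) (sloop a q z) z"

definition fixed where [hoas_defs]:
  "fixed a q = (\<^bold>\<Sigma>z : Fib a. is_fixed a q z)"

definition base where [hoas_defs]:
  "base a = point \<cdot> (st \<cdot> a)"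

definition fixpt where [hoas_defs]:
  "fixpt a = actH a (base a)"

abbreviation fixed_point where
  "fixed_point \<equiv> glob 37"

definition fixed_point_type :: ptm where
  "fixed_point_type = (\<^bold>\<Pi>a : At. \<^bold>\<Pi>q : loop a. fixed a q) 0"

text \<open>\<open>q\<close> acts as \<open>u\<close>; the conjugation \<open>c\<close> moves
  \<open>u\<close> past \<open>actH\<close> to the image of \<open>q\<close> under
  \<open>rt\<close>, and this fixes the natural point by \<open>point_nat\<close>.\<close>

definition fixed_point_proof :: ptm where
  "fixed_point_proof =
     (\<^bold>\<lambda>a : At. \<^bold>\<lambda>q : loop a.
      split (\<lambda>_. fixed a q)
        (\<lambda>u c.
           pair (Fib a) (is_fixed a q) (fixpt a)
             (comp_path (Fib a) (sloop a q (fixpt a)) (actD a a u (fixpt a)) (fixpt a)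
                (loop_image \<cdot> a \<cdot> q \<cdot> u \<cdot> c \<cdot> fixpt a)
                (comp_path (Fib a) (actD a a u (fixpt a))
                   (actH a (actD (rs a) (rs a) (rloop a q) (base a))) (fixpt a) (c \<cdot> base a)
                   (ap_path (Fib a) (actH a) (actD (rs a) (rs a) (rloop a q) (base a)) (base a)
                      (point_nat \<cdot> (st \<cdot> a) \<cdot> (st \<cdot> a) \<cdot> q)))))
        (conjugate \<cdot> rs a \<cdot> a \<cdot> (retr \<cdot> a) \<cdot> rloop a q)) 0"

text \<open>The type inferred for reflexivity at \<open>Cant\<close> is a path type over
  \<open>univ 0\<close>, whereas \<open>double_C\<close> is a path in \<open>univ i\<close>, as
  membership in \<open>BC\<close> demands.\<close>

definition some_a where [hoas_defs]:
  "some_a = rt \<cdot> mk_BC Cant2 (trunc_in double_C)"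

abbreviation contradiction where
  "contradiction \<equiv> glob 38"

definition contradiction_type :: ptm where
  "contradiction_type = (emptyT) 0"

definition contradiction_proof :: ptm where
  "contradiction_proof =
     (free_loop_X \<cdot> (st \<cdot> some_a)
        \<cdot> (\<^bold>\<lambda>w : free_loop_at (st \<cdot> some_a).
           split (\<lambda>_. emptyT)
             (\<lambda>q n. split (\<lambda>_. emptyT) (\<lambda>z e. n \<cdot> z \<cdot> e) (fixed_point \<cdot> some_a \<cdot> q)) w)) 0"

subsection \<open>The splitting\<close>

definition retraction where [hoas_defs]:
  "retraction A r s = (\<^bold>\<Pi>a : A. path A (r \<cdot> (s \<cdot> a)) a)"

abbreviation no_injection where
  "no_injection \<equiv> glob 24"

text \<open>The seven hypotheses from \<open>At_type\<close> to \<open>point_type\<close> as one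
  iterated product ending in the empty type. Position 24 now refers to \<open>fin\<close>.\<close>

definition no_injection_type :: ptm where
  "no_injection_type =
     (\<^bold>\<Pi>A : univ j. \<^bold>\<Pi>r : BC \<rightarrow> A. \<^bold>\<Pi>s : A \<rightarrow> BC.
      retraction A r s
        \<rightarrow> (\<^bold>\<Pi>k : (\<^bold>\<Pi>x : BC. El x \<rightarrow> El (s \<cdot> (r \<cdot> x))).
           (\<^bold>\<Pi>x : BC. inj_stmt (El x) (El (s \<cdot> (r \<cdot> x))) (k \<cdot> x))
             \<rightarrow> (\<^bold>\<Pi>x : BC. El (s \<cdot> (r \<cdot> x))) \<rightarrow> emptyT)) 0"

definition embeds where [hoas_defs]:
  "embeds S T = (\<^bold>\<Sigma>k : S \<rightarrow> T. inj_stmt S T k)"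

abbreviation pull_back where
  "pull_back \<equiv> glob 25"

definition pull_back_type :: ptm where
  "pull_back_type = (\<^bold>\<Pi>x : BC. \<^bold>\<Pi>y : BC. path BC x y \<rightarrow> embeds (El y) (El x)) 0"

text \<open>The embedding runs against the path, so the homotopy from \<open>s (r x)\<close> to the
  shift of \<open>x\<close> directly embeds the enlarged type into
  \<open>El (s (r x))\<close>.\<close>

definition pull_back_proof :: ptm where
  "pull_back_proof =
     (\<^bold>\<lambda>x : BC. \<^bold>\<lambda>y : BC. \<^bold>\<lambda>q : path BC x y.
      path_ind (\<lambda>x y _. embeds (El y) (El x))
        (\<lambda>x.
           pair (El x \<rightarrow> El x) (inj_stmt (El x) (El x)) (idfun_of (El x))
             (\<^bold>\<lambda>z : El x. \<^bold>\<lambda>w : El x. idfun_of (path (El x) z w))) x y q) 0"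

abbreviation inl_inj where
  "inl_inj \<equiv> glob 26"

definition inl_inj_type :: ptm where
  "inl_inj_type = (\<^bold>\<Pi>x : BC. inj_stmt (El x) (El x \<oplus> Cant) (\<^bold>\<lambda>z : El x. inl Cant z)) 0"

text \<open>A left inverse of \<open>inl\<close> is applied to the path; on the right summand it
  takes the default value \<open>z\<close>.\<close>

definition inl_inj_proof :: ptm where
  "inl_inj_proof =
     (\<^bold>\<lambda>x : BC. \<^bold>\<lambda>z : El x. \<^bold>\<lambda>w : El x. \<^bold>\<lambda>e : path (El x \<oplus> Cant) (inl Cant z) (inl Cant w).
      ap_path (El x) (cases_sum (\<lambda>_. El x) (\<lambda>y. y) (\<lambda>_. z)) (inl Cant z) (inl Cant w) e) 0"

abbreviation extend where
  "extend \<equiv> glob 27"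

definition extend_type :: ptm where
  "extend_type = (\<^bold>\<Pi>x : BC. \<^bold>\<Pi>y : BC. path BC y (shift_pt x) \<rightarrow> (\<^bold>\<Sigma>_ : embeds (El x) (El y). El y)) 0"

text \<open>The embedding of \<open>El x + C\<close> is restricted to the left summand, and the
  point is the image of the constant sequence \<open>ff\<close> in the right summand.\<close>

definition extend_proof :: ptm where
  "extend_proof =
     (\<^bold>\<lambda>x : BC. \<^bold>\<lambda>y : BC. \<^bold>\<lambda>q : path BC y (shift_pt x).
      split (\<lambda>_. \<^bold>\<Sigma>_ : embeds (El x) (El y). El y)
        (\<lambda>k m.
           pair (embeds (El x) (El y)) (\<lambda>_. El y)
             (pair (El x \<rightarrow> El y) (inj_stmt (El x) (El y)) (\<^bold>\<lambda>z : El x. k \<cdot> inl Cant z)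
                (\<^bold>\<lambda>z : El x. \<^bold>\<lambda>w : El x. \<^bold>\<lambda>e : path (El y) (k \<cdot> inl Cant z) (k \<cdot> inl Cant w).
                 inl_inj \<cdot> x \<cdot> z \<cdot> w \<cdot> (m \<cdot> inl Cant z \<cdot> inl Cant w \<cdot> e)))
             (k \<cdot> inr (El x) (\<^bold>\<lambda>_ : natT. ff))) (pull_back \<cdot> y \<cdot> shift_pt x \<cdot> q)) 0"

definition ext_at where [hoas_defs]:
  "ext_at s r K x = extend \<cdot> x \<cdot> (s \<cdot> (r \<cdot> x)) \<cdot> (K \<cdot> x)"

definition emb where [hoas_defs]:
  "emb s r K x = fst_of (embeds (El x) (El (s \<cdot> (r \<cdot> x)))) (ext_at s r K x)"

text \<open>Takes the embedding \<open>w\<close> as an argument so that the motive of the split that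
  extracts injectivity can depend on it.\<close>

definition embf where [hoas_defs]:
  "embf s r x w = fst_of (El x \<rightarrow> El (s \<cdot> (r \<cdot> x))) w"

definition KT where [hoas_defs]:
  "KT s r = (\<^bold>\<Pi>x : BC. path BC (s \<cdot> (r \<cdot> x)) (shift_pt x))"

abbreviation no_splitting where
  "no_splitting \<equiv> glob 28"

definition no_splitting_type :: ptm where
  "no_splitting_type =
     (\<^bold>\<Pi>A : univ j. \<^bold>\<Pi>r : BC \<rightarrow> A. \<^bold>\<Pi>s : A \<rightarrow> BC. retraction A r s \<rightarrow> KT s r \<rightarrow> emptyT) 0"

definition no_splitting_proof :: ptm where
  "no_splitting_proof =
     (\<^bold>\<lambda>A : univ j. \<^bold>\<lambda>r : BC \<rightarrow> A. \<^bold>\<lambda>s : A \<rightarrow> BC. \<^bold>\<lambda>H : retraction A r s. \<^bold>\<lambda>K : KT s r.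
      no_injection \<cdot> A \<cdot> r \<cdot> s \<cdot> H \<cdot> (\<^bold>\<lambda>x : BC. embf s r x (emb s r K x))
        \<cdot> (\<^bold>\<lambda>x : BC.
           split (\<lambda>w. inj_stmt (El x) (El (s \<cdot> (r \<cdot> x))) (embf s r x w)) (\<lambda>_ m. m) (emb s r K x))
        \<cdot> (\<^bold>\<lambda>x : BC. split (\<lambda>_. El (s \<cdot> (r \<cdot> x))) (\<lambda>_ c. c) (ext_at s r K x))) 0"

definition splitting_of where [hoas_defs]:
  "splitting_of f =
     (\<^bold>\<Sigma>A : univ j. \<^bold>\<Sigma>r : BC \<rightarrow> A. \<^bold>\<Sigma>s : A \<rightarrow> BC. \<^bold>\<Sigma>_ : retraction A r s. \<^bold>\<Pi>x : BC.
      path BC (s \<cdot> (r \<cdot> x)) (f \<cdot> x))"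

definition idempotent where [hoas_defs]:
  "idempotent f = (\<^bold>\<Pi>x : BC. path BC (f \<cdot> (f \<cdot> x)) (f \<cdot> x))"

definition shift where [hoas_defs]:
  "shift = (\<^bold>\<lambda>x : BC. shift_pt x)"

abbreviation main where
  "main \<equiv> glob 29"

definition main_type :: ptm where
  "main_type = (\<^bold>\<Sigma>f : BC \<rightarrow> BC. \<^bold>\<Sigma>_ : idempotent f. not_type (splitting_of f)) 0"

definition main_proof :: ptm where
  "main_proof =
     (pair (BC \<rightarrow> BC) (\<lambda>f. \<^bold>\<Sigma>_ : idempotent f. not_type (splitting_of f)) shift
        (pair (idempotent shift) (\<lambda>_. not_type (splitting_of shift)) idem
           (\<^bold>\<lambda>w : splitting_of shift.
            split (\<lambda>_. emptyT)
              (\<lambda>A w.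
                 split (\<lambda>_. emptyT)
                   (\<lambda>r w.
                      split (\<lambda>_. emptyT)
                        (\<lambda>s w. split (\<lambda>_. emptyT) (\<lambda>H K. no_splitting \<cdot> A \<cdot> r \<cdot> s \<cdot> H \<cdot> K) w) w)
                   w) w))) 0"

subsection \<open>Checking the proof terms\<close>

text \<open>
  The list \<open>sec\<close> extends \<open>lib\<close> by the hypotheses on a retract, \<open>fin\<close> extends it by the closed statement
  \<open>no_injection_type\<close> obtained by discharging them.
\<close>

definition lib :: "ptm list" where
  "lib =
     [ua_type, cast_eq_type, ua_path_type, cast_inj_type, paths_retract_type, funext_type,
     join_tagged_type, cons_tail_type, join_unjoin_type, unjoin_join_type, double_C_type,
     assoc_unassoc_type, unassoc_assoc_type, absorb_type, lift_path_type, mere_plus_type,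
     idem_type, flip_flip_type, flip_all_inv_type, flip_neq_type, free_loop_C_type,
     free_loop_copy_type, free_loop_X_type, act_inj_type]"

definition sec :: "ptm list" where
  "sec = lib @
     [At_type, rt_type, st_type, retr_type, iota_type, iota_inj_type, point_type, iota_nat_type,
     point_nat_type, conjugate_type, retr_nat_type, loop_unique_type, loop_image_type,
     fixed_point_type, contradiction_type]"

definition fin :: "ptm list" where
  "fin = lib @
     [no_injection_type, pull_back_type, inl_inj_type, extend_type, no_splitting_type, main_type]"

lemmas types [unfolded hoas_defs hoas_simps] =
  ua_type_def cast_eq_type_def ua_path_type_def cast_inj_type_def paths_retract_type_def
  funext_type_def join_tagged_type_def cons_tail_type_def join_unjoin_type_def
  unjoin_join_type_def double_C_type_def assoc_unassoc_type_def unassoc_assoc_type_def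
  absorb_type_def lift_path_type_def mere_plus_type_def idem_type_def flip_flip_type_def
  flip_all_inv_type_def flip_neq_type_def free_loop_C_type_def free_loop_copy_type_def
  free_loop_X_type_def act_inj_type_def At_type_def rt_type_def st_type_def retr_type_def
  iota_type_def iota_inj_type_def point_type_def iota_nat_type_def point_nat_type_def
  conjugate_type_def retr_nat_type_def loop_unique_type_def loop_image_type_def
  fixed_point_type_def contradiction_type_def no_injection_type_def pull_back_type_def
  inl_inj_type_def extend_type_def no_splitting_type_def main_type_def

lemma lib_nth:
  "lib ! 0 = ua_type" "lib ! 1 = cast_eq_type" "lib ! 2 = ua_path_type" "lib ! 3 = cast_inj_type"
  "lib ! 4 = paths_retract_type" "lib ! 5 = funext_type" "lib ! 6 = join_tagged_type" "lib ! 7 =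
  cons_tail_type" "lib ! 8 = join_unjoin_type" "lib ! 9 = unjoin_join_type" "lib ! 10 =
  double_C_type" "lib ! 11 = assoc_unassoc_type" "lib ! 12 = unassoc_assoc_type" "lib ! 13 =
  absorb_type" "lib ! 14 = lift_path_type" "lib ! 15 = mere_plus_type" "lib ! 16 = idem_type" "lib
  ! 17 = flip_flip_type" "lib ! 18 = flip_all_inv_type" "lib ! 19 = flip_neq_type" "lib ! 20 =
  free_loop_C_type" "lib ! 21 = free_loop_copy_type" "lib ! 22 = free_loop_X_type" "lib ! 23 =
  act_inj_type"
  by (simp_all add: lib_def)

lemma length_lib: "length lib = 24"
  by (simp add: lib_def)

lemma lib_prefix: "k < 24 \<Longrightarrow> sec ! k = lib ! k" "k < 24 \<Longrightarrow> fin ! k = lib ! k"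
  by (simp_all add: sec_def fin_def nth_append length_lib)

lemma sec_nth:
  "sec ! 24 = At_type" "sec ! 25 = rt_type" "sec ! 26 = st_type" "sec ! 27 = retr_type" "sec ! 28
  = iota_type" "sec ! 29 = iota_inj_type" "sec ! 30 = point_type" "sec ! 31 = iota_nat_type" "sec
  ! 32 = point_nat_type" "sec ! 33 = conjugate_type" "sec ! 34 = retr_nat_type" "sec ! 35 =
  loop_unique_type" "sec ! 36 = loop_image_type" "sec ! 37 = fixed_point_type" "sec ! 38 =
  contradiction_type"
  by (simp_all add: sec_def nth_append length_lib)

lemma fin_nth:
  "fin ! 24 = no_injection_type" "fin ! 25 = pull_back_type" "fin ! 26 = inl_inj_type" "fin ! 27 =
  extend_type" "fin ! 28 = no_splitting_type" "fin ! 29 = main_type"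
  by (simp_all add: fin_def nth_append length_lib)

lemmas globals = lib_nth lib_prefix sec_nth fin_nth types

section \<open>Evaluation of the checker on hypotheses and proof terms\<close>

lemma ua_extends: "extends lib 0"
  by (simp only: elaborate) (simp only: eval_simps globals cong: eval_congs)

lemma cast_eq_checks: "checks lib 1 cast_eq_proof"
  by (simp only: elaborate cast_eq_proof_def hoas_defs hoas_simps)
    (simp only: eval_simps globals cong: eval_congs)

lemma ua_path_checks: "checks lib 2 ua_path_proof"
  by (simp only: elaborate ua_path_proof_def hoas_defs hoas_simps)
    (simp only: eval_simps globals cong: eval_congs)

lemma cast_inj_checks: "checks lib 3 cast_inj_proof"
  by (simp only: elaborate cast_inj_proof_def hoas_defs hoas_simps)
    (simp only: eval_simps globals cong: eval_congs)

lemma paths_retract_checks: "checks lib 4 paths_retract_proof"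
  by (simp only: elaborate paths_retract_proof_def hoas_defs hoas_simps)
    (simp only: eval_simps globals cong: eval_congs)

lemma funext_checks: "checks lib 5 funext_proof"
  by (simp only: elaborate funext_proof_def hoas_defs hoas_simps)
    (simp only: eval_simps globals cong: eval_congs)

lemma join_tagged_checks: "checks lib 6 join_tagged_proof"
  by (simp only: elaborate join_tagged_proof_def hoas_defs hoas_simps)
    (simp only: eval_simps globals cong: eval_congs)

lemma cons_tail_checks: "checks lib 7 cons_tail_proof"
  by (simp only: elaborate cons_tail_proof_def hoas_defs hoas_simps)
    (simp only: eval_simps globals cong: eval_congs)

lemma join_unjoin_checks: "checks lib 8 join_unjoin_proof"
  by (simp only: elaborate join_unjoin_proof_def hoas_defs hoas_simps)
    (simp only: eval_simps globals cong: eval_congs)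

lemma unjoin_join_checks: "checks lib 9 unjoin_join_proof"
  by (simp only: elaborate unjoin_join_proof_def hoas_defs hoas_simps)
    (simp only: eval_simps globals cong: eval_congs)

lemma double_C_checks: "checks lib 10 double_C_proof"
  by (simp only: elaborate double_C_proof_def hoas_defs hoas_simps)
    (simp only: eval_simps globals cong: eval_congs)

lemma assoc_unassoc_checks: "checks lib 11 assoc_unassoc_proof"
  by (simp only: elaborate assoc_unassoc_proof_def hoas_defs hoas_simps)
    (simp only: eval_simps globals cong: eval_congs)

lemma unassoc_assoc_checks: "checks lib 12 unassoc_assoc_proof"
  by (simp only: elaborate unassoc_assoc_proof_def hoas_defs hoas_simps)
    (simp only: eval_simps globals cong: eval_congs)

lemma absorb_checks: "checks lib 13 absorb_proof"
  by (simp only: elaborate absorb_proof_def hoas_defs hoas_simps)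
    (simp only: eval_simps globals cong: eval_congs)

lemma lift_path_checks: "checks lib 14 lift_path_proof"
  by (simp only: elaborate lift_path_proof_def hoas_defs hoas_simps)
    (simp only: eval_simps globals cong: eval_congs)

lemma mere_plus_checks: "checks lib 15 mere_plus_proof"
  by (simp only: elaborate mere_plus_proof_def hoas_defs hoas_simps)
    (simp only: eval_simps globals cong: eval_congs)

lemma idem_checks: "checks lib 16 idem_proof"
  by (simp only: elaborate idem_proof_def hoas_defs hoas_simps)
    (simp only: eval_simps globals cong: eval_congs)

lemma flip_flip_checks: "checks lib 17 flip_flip_proof"
  by (simp only: elaborate flip_flip_proof_def hoas_defs hoas_simps)
    (simp only: eval_simps globals cong: eval_congs)

lemma flip_all_inv_checks: "checks lib 18 flip_all_inv_proof"
  by (simp only: elaborate flip_all_inv_proof_def hoas_defs hoas_simps)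
    (simp only: eval_simps globals cong: eval_congs)

lemma flip_neq_checks: "checks lib 19 flip_neq_proof"
  by (simp only: elaborate flip_neq_proof_def hoas_defs hoas_simps)
    (simp only: eval_simps globals cong: eval_congs)

lemma free_loop_C_checks: "checks lib 20 free_loop_C_proof"
  by (simp only: elaborate free_loop_C_proof_def hoas_defs hoas_simps)
    (simp only: eval_simps globals cong: eval_congs)

lemma free_loop_copy_checks: "checks lib 21 free_loop_copy_proof"
  by (simp only: elaborate free_loop_copy_proof_def hoas_defs hoas_simps)
    (simp only: eval_simps globals cong: eval_congs)

lemma free_loop_X_checks: "checks lib 22 free_loop_X_proof"
  by (simp only: elaborate free_loop_X_proof_def hoas_defs hoas_simps)
    (simp only: eval_simps globals cong: eval_congs)

lemma act_inj_checks: "checks lib 23 act_inj_proof"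
  by (simp only: elaborate act_inj_proof_def hoas_defs hoas_simps)
    (simp only: eval_simps globals cong: eval_congs)

lemma At_extends: "extends sec 24"
  by (simp only: elaborate) (simp only: eval_simps globals cong: eval_congs)

lemma rt_extends: "extends sec 25"
  by (simp only: elaborate) (simp only: eval_simps globals cong: eval_congs)

lemma st_extends: "extends sec 26"
  by (simp only: elaborate) (simp only: eval_simps globals cong: eval_congs)

lemma retr_extends: "extends sec 27"
  by (simp only: elaborate) (simp only: eval_simps globals cong: eval_congs)

lemma iota_extends: "extends sec 28"
  by (simp only: elaborate) (simp only: eval_simps globals cong: eval_congs)

lemma iota_inj_extends: "extends sec 29"
  by (simp only: elaborate) (simp only: eval_simps globals cong: eval_congs)

lemma point_extends: "extends sec 30"
  by (simp only: elaborate) (simp only: eval_simps globals cong: eval_congs)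

lemma iota_nat_checks: "checks sec 31 iota_nat_proof"
  by (simp only: elaborate iota_nat_proof_def hoas_defs hoas_simps)
    (simp only: eval_simps globals cong: eval_congs)

lemma point_nat_checks: "checks sec 32 point_nat_proof"
  by (simp only: elaborate point_nat_proof_def hoas_defs hoas_simps)
    (simp only: eval_simps globals cong: eval_congs)

lemma conjugate_checks: "checks sec 33 conjugate_proof"
  by (simp only: elaborate conjugate_proof_def hoas_defs hoas_simps)
    (simp only: eval_simps globals cong: eval_congs)

lemma retr_nat_checks: "checks sec 34 retr_nat_proof"
  by (simp only: elaborate retr_nat_proof_def hoas_defs hoas_simps)
    (simp only: eval_simps globals cong: eval_congs)

lemma loop_unique_checks: "checks sec 35 loop_unique_proof"
  by (simp only: elaborate loop_unique_proof_def hoas_defs hoas_simps)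
    (simp only: eval_simps globals cong: eval_congs)

lemma loop_image_checks: "checks sec 36 loop_image_proof"
  by (simp only: elaborate loop_image_proof_def hoas_defs hoas_simps)
    (simp only: eval_simps globals cong: eval_congs)

lemma fixed_point_checks: "checks sec 37 fixed_point_proof"
  by (simp only: elaborate fixed_point_proof_def hoas_defs hoas_simps)
    (simp only: eval_simps globals cong: eval_congs)

lemma contradiction_checks: "checks sec 38 contradiction_proof"
  by (simp only: elaborate contradiction_proof_def hoas_defs hoas_simps)
    (simp only: eval_simps globals cong: eval_congs)

lemma no_injection_extends: "extends fin 24"
  by (simp only: elaborate) (simp only: eval_simps globals cong: eval_congs)

lemma pull_back_checks: "checks fin 25 pull_back_proof"
  by (simp only: elaborate pull_back_proof_def hoas_defs hoas_simps)
    (simp only: eval_simps globals cong: eval_congs)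

lemma inl_inj_checks: "checks fin 26 inl_inj_proof"
  by (simp only: elaborate inl_inj_proof_def hoas_defs hoas_simps)
    (simp only: eval_simps globals cong: eval_congs)

lemma extend_checks: "checks fin 27 extend_proof"
  by (simp only: elaborate extend_proof_def hoas_defs hoas_simps)
    (simp only: eval_simps globals cong: eval_congs)

lemma no_splitting_checks: "checks fin 28 no_splitting_proof"
  by (simp only: elaborate no_splitting_proof_def hoas_defs hoas_simps)
    (simp only: eval_simps globals cong: eval_congs)

lemma main_checks: "checks fin 29 main_proof"
  by (simp only: elaborate main_proof_def hoas_defs hoas_simps)
    (simp only: eval_simps globals cong: eval_congs)

section \<open>Removal of lemmas and discharge of hypotheses\<close>

lemma lib_conservative: "conservative lib 1 24"
proof -
  have "valid lib 1" using valid_Suc[OF valid_0 ua_extends] by simp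
  then have "conservative lib 1 (1 + length
     [cast_eq_proof, ua_path_proof, cast_inj_proof, paths_retract_proof, funext_proof,
     join_tagged_proof, cons_tail_proof, join_unjoin_proof, unjoin_join_proof, double_C_proof,
     assoc_unassoc_proof, unassoc_assoc_proof, absorb_proof, lift_path_proof, mere_plus_proof,
     idem_proof, flip_flip_proof, flip_all_inv_proof, flip_neq_proof, free_loop_C_proof,
     free_loop_copy_proof, free_loop_X_proof, act_inj_proof])"
    by (intro conservative_checks_all conservative_refl)
      (simp_all del: One_nat_def add: cast_eq_checks ua_path_checks cast_inj_checks paths_retract_checks funext_checks
      join_tagged_checks cons_tail_checks join_unjoin_checks unjoin_join_checks double_C_checks
      assoc_unassoc_checks unassoc_assoc_checks absorb_checks lift_path_checks mere_plus_checks
      idem_checks flip_flip_checks flip_all_inv_checks flip_neq_checks free_loop_C_checks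
      free_loop_copy_checks free_loop_X_checks act_inj_checks)
  then show ?thesis by (simp add: numeral_eq_Suc)
qed

lemma no_injection_derivable: "derivable lib 24 no_injection_type"
proof -
  have v0: "valid sec 24"
    using lib_conservative valid_cong[of 24 sec lib] by (simp add: conservative_def lib_prefix)
  have v1: "valid sec 25" using valid_Suc[OF v0 At_extends] by simp
  have v2: "valid sec 26" using valid_Suc[OF v1 rt_extends] by simp
  have v3: "valid sec 27" using valid_Suc[OF v2 st_extends] by simp
  have v4: "valid sec 28" using valid_Suc[OF v3 retr_extends] by simp
  have v5: "valid sec 29" using valid_Suc[OF v4 iota_extends] by simp
  have v6: "valid sec 30" using valid_Suc[OF v5 iota_inj_extends] by simp
  have v7: "valid sec 31" using valid_Suc[OF v6 point_extends] by simp
  have "conservative sec 31 (31 + length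
     [iota_nat_proof, point_nat_proof, conjugate_proof, retr_nat_proof, loop_unique_proof,
     loop_image_proof, fixed_point_proof])"
    using v7 by (intro conservative_checks_all conservative_refl)
      (simp_all add: iota_nat_checks point_nat_checks conjugate_checks retr_nat_checks loop_unique_checks
      loop_image_checks fixed_point_checks)
  then have c: "conservative sec 31 38" by simp
  then have "derivable sec 38 (sec ! 38)"
    by (intro checks_derivable[OF _ contradiction_checks]) (simp add: conservative_def)
  \<comment> \<open>The empty type mentions no global, so the seven lemmas after the hypotheses can
    be eliminated from its derivation.\<close>
  then have "derivable sec 31 PEmpty"
    using c by (simp add: conservative_def sec_nth types)
  then have "\<exists>t. tops sec 31 \<turnstile> t \<Colon> Empty"
    by (simp add: derivable_def)
  \<comment> \<open>The hypotheses are abstracted one at a time, from the newest to the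
    oldest.\<close>
  then have "\<exists>t. tops sec 30 \<turnstile> t \<Colon> Pi (er 30 0 (sec ! 30)) Empty"
    by (intro derivable_Pi[OF v6 point_extends]) simp
  then have "\<exists>t. tops sec 29 \<turnstile> t \<Colon>
     Pi (er 29 0 (sec ! 29)) (Pi (er 30 0 (sec ! 30)) Empty)"
    by (intro derivable_Pi[OF v5 iota_inj_extends]) simp
  then have "\<exists>t. tops sec 28 \<turnstile> t \<Colon>
     Pi (er 28 0 (sec ! 28)) (Pi (er 29 0 (sec ! 29)) (Pi (er 30 0 (sec ! 30)) Empty))"
    by (intro derivable_Pi[OF v4 iota_extends]) simp
  then have "\<exists>t. tops sec 27 \<turnstile> t \<Colon>
     Pi (er 27 0 (sec ! 27)) (Pi (er 28 0 (sec ! 28)) (Pi (er 29 0 (sec ! 29)) (Pi (er 30 0 (sec !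
     30)) Empty)))"
    by (intro derivable_Pi[OF v3 retr_extends]) simp
  then have "\<exists>t. tops sec 26 \<turnstile> t \<Colon>
     Pi (er 26 0 (sec ! 26)) (Pi (er 27 0 (sec ! 27)) (Pi (er 28 0 (sec ! 28)) (Pi (er 29 0 (sec !
     29)) (Pi (er 30 0 (sec ! 30)) Empty))))"
    by (intro derivable_Pi[OF v2 st_extends]) simp
  then have "\<exists>t. tops sec 25 \<turnstile> t \<Colon>
     Pi (er 25 0 (sec ! 25)) (Pi (er 26 0 (sec ! 26)) (Pi (er 27 0 (sec ! 27)) (Pi (er 28 0 (sec !
     28)) (Pi (er 29 0 (sec ! 29)) (Pi (er 30 0 (sec ! 30)) Empty)))))"
    by (intro derivable_Pi[OF v1 rt_extends]) simp
  then have "\<exists>t. tops sec 24 \<turnstile> t \<Colon>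
     Pi (er 24 0 (sec ! 24)) (Pi (er 25 0 (sec ! 25)) (Pi (er 26 0 (sec ! 26)) (Pi (er 27 0 (sec !
     27)) (Pi (er 28 0 (sec ! 28)) (Pi (er 29 0 (sec ! 29)) (Pi (er 30 0 (sec ! 30)) Empty))))))"
    by (intro derivable_Pi[OF v0 At_extends]) simp
  \<comment> \<open>In \<open>sec\<close> the hypotheses are globals, in
    \<open>no_injection_type\<close> bound variables; erasure gives both the same indices.\<close>
  then show ?thesis
    using tops_cong[of 24 sec lib]
    by (simp add: derivable_def lib_prefix sec_nth types) (simp add: numeral_eq_Suc)
qed

lemma main_derivable: "derivable fin 1 main_type"
proof -
  have "conservative fin 1 24"
    using lib_conservative by (rule conservative_cong) (simp add: lib_prefix)
  moreover have "derivable fin 24 (fin ! 24)"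
    using no_injection_derivable derivable_cong[of 24 fin lib] by (simp add: lib_prefix fin_nth)
  \<comment> \<open>The derivation of \<open>no_injection_type\<close> arose by abstraction and not
    from a single checked preterm, so it enters through a cut instead of
    \<open>checks\<close>.\<close>
  ultimately have "conservative fin 1 (Suc 24)"
    by (intro conservative_cut no_injection_extends)
  then have "conservative fin 1 (25 + length
     [pull_back_proof, inl_inj_proof, extend_proof, no_splitting_proof])"
    by (intro conservative_checks_all)
      (simp_all add: pull_back_checks inl_inj_checks extend_checks no_splitting_checks)
  then have c: "conservative fin 1 29" by simp
  then have "derivable fin 29 (fin ! 29)"
    by (intro checks_derivable[OF _ main_checks]) (simp add: conservative_def)
  then show ?thesis
    using c by (simp add: conservative_def fin_nth types)
qed

end

theorem theorem4p6:
  fixes i j :: nat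
  shows "\<exists>t. [univalence i] \<turnstile> t \<Colon>
           Sig (arrow (BAut i Cantor) (BAut i Cantor))
            (Sig (preIdem (wk (BAut i Cantor)) (Var 0))
              (neg (splitting j (wk (wk (BAut i Cantor))) (Var 1))))"
proof -
  have "tops (fin i j) 1 = [univalence i]"
    by (simp add: lib_prefix lib_nth types univalence_def isEquiv_def Equiv_def idtoeqv_def idEquiv_def
        idfun_def arrow_def prodT_def numeral_eq_Suc)
  \<comment> \<open>The type mentions no global, and its erasure is literally the type in the
    statement once the abbreviating definitions are unfolded.\<close>
  moreover have "er 1 0 (main_type i j) = Sig (arrow (BAut i Cantor) (BAut i Cantor))
      (Sig (preIdem (wk (BAut i Cantor)) (Var 0))
        (neg (splitting j (wk (wk (BAut i Cantor))) (Var 1))))"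
    by (simp add: types arrow_def BAut_def Cantor_def preIdem_def neg_def splitting_def prodT_def
        Let_def numeral_eq_Suc)
  ultimately show ?thesis using main_derivable[of i j] by (simp add: derivable_def)
qed

end
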